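(* For every integer $n\geq 1$, there exists a minimal topological dynamical system $(X_n,T_n)$ such that $$\dim(X_n,T_n)=\frac n2,$$ but $(X_n,T_n)$ does not embed equivariantly into $(([0,1]^n)^{\mathbb Z},\sigma)$.
   Context: A topological dynamical system $(X,T)$ consists of a nonempty compact metrizable space $X$ and a homeomorphism $T\colon X\to X$; it is minimal if every orbit $\{T^kx:k\in\mathbb Z\}$ is dense in $X$. The shift on $([0,1]^n)^{\mathbb Z}$ (product topology) is $(\sigma z)_k=z_{k+1}$. An equivariant embedding of $(X,T)$ into $(([0,1]^n)^{\mathbb Z},\sigma)$ is a topological embedding $F$ with $F\circ T=\sigma\circ F$. Dynamical dimension (Meyerovitch): let $\mathrm{Cov}(X)$ be the set of finite open covers of $X$, and $\mathrm{Prob}(X,T)$ the set of $T$-invariant Borel probability measures on $X$. For $\mathcal V\in\mathrm{Cov}(X)$ put $\mathrm{ord}(\mathcal V,x)=\#\{V\in\mathcal V:x\in V\}-1$ and $\mathrm{ord}(\mathcal V,T)=\sup_{\mu\in\mathrm{Prob}(X,T)}\int_X\mathrm{ord}(\mathcal V,x)\,d\mu(x)$. Write $\mathcal V\succeq\mathcal U$ if every $V\in\mathcal V$ is contained in some $U\in\mathcal U$. Then $$\dim(\mathcal U,T)=\inf_{\mathcal V\in\mathrm{Cov}(X),\ \mathcal V\succeq\mathcal U}\mathrm{ord}(\mathcal V,T),\qquad \dim(X,T)=\sup_{\mathcal U\in\mathrm{Cov}(X)}\dim(\mathcal U,T)\in[0,\infty].$$ *)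

theory Defs
  imports "HOL-Probability.Probability"
begin

definition top_dyn_system :: "'a topology \<Rightarrow> ('a \<Rightarrow> 'a) \<Rightarrow> bool" where
  "top_dyn_system X T \<longleftrightarrow>
     topspace X \<noteq> {} \<and> compact_space X \<and> metrizable_space X \<and> homeomorphic_map X X T"

(* The inverse is taken relative to topspace X, since T need not be injective on the whole type. *)
definition int_iterate :: "'a topology \<Rightarrow> ('a \<Rightarrow> 'a) \<Rightarrow> int \<Rightarrow> 'a \<Rightarrow> 'a" where
  "int_iterate X T k =
     (if 0 \<le> k then T ^^ nat k else inv_into (topspace X) T ^^ nat (- k))"

definition minimal_system :: "'a topology \<Rightarrow> ('a \<Rightarrow> 'a) \<Rightarrow> bool" where
  "minimal_system X T \<longleftrightarrow>
     top_dyn_system X T \<and>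
     (\<forall>x\<in>topspace X. X closure_of (range (\<lambda>k. int_iterate X T k x)) = topspace X)"

definition borel_sigma :: "'a topology \<Rightarrow> 'a measure" where
  "borel_sigma X = sigma (topspace X) {U. openin X U}"

definition invariant_probs :: "'a topology \<Rightarrow> ('a \<Rightarrow> 'a) \<Rightarrow> 'a measure set" where
  "invariant_probs X T =
     {\<mu>. sets \<mu> = sets (borel_sigma X) \<and> prob_space \<mu> \<and> distr \<mu> \<mu> T = \<mu>}"

definition open_covers :: "'a topology \<Rightarrow> 'a set set set" where
  "open_covers X = {\<V>. finite \<V> \<and> (\<forall>V\<in>\<V>. openin X V) \<and> \<Union>\<V> = topspace X}"

definition refines :: "'a set set \<Rightarrow> 'a set set \<Rightarrow> bool" where
  "refines \<V> \<U> \<longleftrightarrow> (\<forall>V\<in>\<V>. \<exists>U\<in>\<U>. V \<subseteq> U)"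

(* On points covered by \<V> the cardinality is at least 1, so the truncated subtraction is exact. *)
definition ord_at :: "'a set set \<Rightarrow> 'a \<Rightarrow> nat" where
  "ord_at \<V> x = card {V \<in> \<V>. x \<in> V} - 1"

definition ord_cover :: "'a topology \<Rightarrow> ('a \<Rightarrow> 'a) \<Rightarrow> 'a set set \<Rightarrow> ennreal" where
  "ord_cover X T \<V> = (SUP \<mu>\<in>invariant_probs X T. \<integral>\<^sup>+ x. of_nat (ord_at \<V> x) \<partial>\<mu>)"

definition dyn_dim_cover :: "'a topology \<Rightarrow> ('a \<Rightarrow> 'a) \<Rightarrow> 'a set set \<Rightarrow> ennreal" where
  "dyn_dim_cover X T \<U> = (INF \<V>\<in>{\<V> \<in> open_covers X. refines \<V> \<U>}. ord_cover X T \<V>)"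

definition dyn_dim :: "'a topology \<Rightarrow> ('a \<Rightarrow> 'a) \<Rightarrow> ennreal" where
  "dyn_dim X T = (SUP \<U>\<in>open_covers X. dyn_dim_cover X T \<U>)"

(* The cube [0,1]^n consists of the functions on {..<n} with values in {0..1}; as usual for
   product_topology, they are extended by undefined outside {..<n}. *)
definition cube_shift_space :: "nat \<Rightarrow> (int \<Rightarrow> nat \<Rightarrow> real) topology" where
  "cube_shift_space n =
     product_topology
       (\<lambda>_. product_topology (\<lambda>_. top_of_set {0..1}) {..<n}) UNIV"

definition seq_shift :: "(int \<Rightarrow> 'b) \<Rightarrow> (int \<Rightarrow> 'b)" where
  "seq_shift z = (\<lambda>k. z (k + 1))"

definition equivariant_embedding ::
    "'a topology \<Rightarrow> ('a \<Rightarrow> 'a) \<Rightarrow> 'b topology \<Rightarrow> ('b \<Rightarrow> 'b) \<Rightarrow> ('a \<Rightarrow> 'b) \<Rightarrow> bool" where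
  "equivariant_embedding X T Y S F \<longleftrightarrow>
     embedding_map X Y F \<and> (\<forall>x\<in>topspace X. F (T x) = S (F x))"

end

(* The system is a shift on sequences over n triods (cones over three points). Toeplitz-like levels
   freeze more and more positions to prescribed values, periodically with period N_j; the frozen words
   of level j+1 approximate every word of length 2 N_j of level j, whence minimality. The number d_j of
   free positions per period satisfies 2 d_j / N_j -> n and 2 d_j - n N_j -> infinity.

   The first limit gives dimension n/2. From above: a triod is cut by finitely many walls, and moving
   the walls with time lets each coordinate meet a wall at only one time of its window. From below:
   the cube of free coordinates forces, through Poincare-Miranda, some orbit to see total order at
   least d_j along a period; empirical measures of such orbits accumulate at an invariant measure.

   The second limit excludes an embedding: by compactness it would separate far apart points of the
   family of d_j free triods through n (N_j + 2L) real functions, L fixed. The pairs of points of a triod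
   contain an antipodal disc whose boundary consists of far apart pairs, so for n (N_j + 2L) < 2 d_j this
   contradicts the Borsuk-Ulam theorem in the cube [-1,1]^(2 d_j). *)
theory Submission
  imports Defs "HOL-Homology.Homology" "HOL-Library.Z2"
begin

text \<open>Why triods: a triod is one-dimensional, so a free position costs one unit of order, but
  a continuous map that separates far apart points of d triods needs at least 2 d real values; for
  intervals d would do. This factor 2 makes dimension n / 2 collide with n functions per unit of
  time. Since the dimension is exactly n / 2, no linear margin remains: the contradiction has to
  come from the excess 2 d_j - n N_j, which must outgrow the constant loss 2 n L at the ends of a
  window and still be o(N_j). Hence as much as possible is frozen, subject to an excess of at least
  j + 1 at level j. Positions free in the first block of a level are never frozen later, so the d_j
  free triods of a period really occur in the system. Markers make the phases open and disjoint, so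
  covers can be chosen phase by phase, and order is averaged over a period instead of being counted
  at one time. All topology rests on Borsuk-Ulam, proved with subdivided singular chains modulo 2;
  even the solvability of underdetermined linear systems is read off from it. Order is not
  continuous, so the passage to a limit measure uses a continuous function below it.\<close>

section \<open>The Borsuk--Ulam theorem\<close>

declare add_bit_eq_xor [simp del] mult_bit_eq_and [simp del]

section \<open>Singular chains evaluated by cochains modulo 2\<close>

lemma bit_add_self [simp]: "(x::bit) + x = 0"
  by (cases x) (auto simp: add_bit_eq_xor)

lemma bit_minus_eq [simp]: "- (x::bit) = x"
  by (metis add_eq_0_iff bit_add_self)

text \<open>Pairing of a mod 2 cochain with an integral chain. Reducing the coefficients to
  \<open>bit\<close> makes all boundary and orientation signs disappear.\<close>

definition chain_eval :: "('s \<Rightarrow> bit) \<Rightarrow> ('s \<Rightarrow>\<^sub>0 int) \<Rightarrow> bit" where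
  "chain_eval g c = (\<Sum>\<sigma>\<in>Poly_Mapping.keys c. of_int (Poly_Mapping.lookup c \<sigma>) * g \<sigma>)"

lemma chain_eval_superset:
  assumes "finite S" "Poly_Mapping.keys c \<subseteq> S"
  shows "chain_eval g c = (\<Sum>\<sigma>\<in>S. of_int (Poly_Mapping.lookup c \<sigma>) * g \<sigma>)"
  unfolding chain_eval_def
  by (rule sum.mono_neutral_left) (use assms in \<open>auto simp: in_keys_iff\<close>)

lemma chain_eval_diff: "chain_eval g (a - b) = chain_eval g a + chain_eval g b"
proof -
  let ?S = "Poly_Mapping.keys a \<union> Poly_Mapping.keys b"
  have "Poly_Mapping.keys (a - b) \<subseteq> ?S"
    by (rule keys_diff)
  then have "chain_eval g (a - b) = (\<Sum>\<sigma>\<in>?S. of_int (Poly_Mapping.lookup a \<sigma>) * g \<sigma> + of_int (Poly_Mapping.lookup b \<sigma>) * g \<sigma>)"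
    by (subst chain_eval_superset[of ?S]) (auto simp: lookup_minus algebra_simps simp flip: diff_conv_add_uminus intro!: sum.cong)
  also have "\<dots> = chain_eval g a + chain_eval g b"
    by (simp add: sum.distrib chain_eval_superset[of ?S])
  finally show ?thesis .
qed

lemma chain_eval_0 [simp]: "chain_eval g 0 = 0"
  by (simp add: chain_eval_def)

lemma chain_eval_of [simp]: "chain_eval g (frag_of \<sigma>) = g \<sigma>"
  by (simp add: chain_eval_def)

lemma chain_eval_uminus [simp]: "chain_eval g (- a) = chain_eval g a"
  using chain_eval_diff[of g 0 a] by simp

lemma chain_eval_add: "chain_eval g (a + b) = chain_eval g a + chain_eval g b"
  using chain_eval_diff[of g a "- b"] by simp

lemma chain_eval_sum: "chain_eval g (sum c I) = (\<Sum>i\<in>I. chain_eval g (c i))"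
  by (induction I rule: infinite_finite_induct) (auto simp: chain_eval_add)

lemma chain_eval_sign [simp]: "chain_eval g (frag_cmul ((-1) ^ k) c) = chain_eval g c"
  by (cases "even k") auto

lemma chain_eval_frag_extend: "chain_eval g (frag_extend b c) = chain_eval (\<lambda>\<sigma>. chain_eval g (b \<sigma>)) c"
  using subset_UNIV
  by (induction c rule: frag_induction) (auto simp: frag_extend_diff chain_eval_diff)

lemma chain_eval_cong:
  "(\<And>\<sigma>. \<sigma> \<in> Poly_Mapping.keys c \<Longrightarrow> g \<sigma> = h \<sigma>) \<Longrightarrow> chain_eval g c = chain_eval h c"
  by (simp add: chain_eval_def)

lemma chain_eval_add_fun: "chain_eval (\<lambda>\<sigma>. g \<sigma> + h \<sigma>) c = chain_eval g c + chain_eval h c"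
  by (simp add: chain_eval_def distrib_left sum.distrib)

text \<open>The s j will be sign functions, which change by 1 under the antipode. Modulo 2 their coboundaries are
  antipodally invariant, and a cup product of coboundaries is the coboundary of s j times the remaining
  product; this lowers the degree by one when evaluated on a hemisphere.\<close>

definition cup_cochain :: "(nat \<Rightarrow> 'a \<Rightarrow> bit) \<Rightarrow> nat \<Rightarrow> nat \<Rightarrow> (nat \<Rightarrow> 'a) \<Rightarrow> bit" where
  "cup_cochain s j p v = (\<Prod>i<p. s (j + i) (v i) + s (j + i) (v (Suc i)))"

lemma cup_cochain_0 [simp]: "cup_cochain s j 0 v = 1"
  by (simp add: cup_cochain_def)

lemma cup_cochain_Suc:
  "cup_cochain s j (Suc p) v = (s j (v 0) + s j (v 1)) * cup_cochain s (Suc j) p (v \<circ> Suc)"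
  by (simp add: cup_cochain_def prod.lessThan_Suc_shift del: prod.lessThan_Suc)

lemma cup_cochain_cong:
  "(\<And>i. i \<le> p \<Longrightarrow> v i = w i) \<Longrightarrow> cup_cochain s j p v = cup_cochain s j p w"
  by (auto simp: cup_cochain_def intro!: prod.cong)

text \<open>The coface map: \<open>v \<circ> skip_index k\<close> lists the vertices of the
  \<open>k\<close>-th face of the simplex with vertices \<open>v\<close>.\<close>

definition skip_index :: "nat \<Rightarrow> nat \<Rightarrow> nat" where
  "skip_index k i = (if i < k then i else Suc i)"

lemma skip_index_simps [simp]:
  "skip_index 0 = Suc" "skip_index (Suc k) 0 = 0" "skip_index (Suc k) (Suc i) = Suc (skip_index k i)"
  by (auto simp: skip_index_def)

text \<open>Split off the first factor. Faces from the second on keep the edge from 0 to 1 and are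
  handled by induction; faces 0 and 1 carry the edges from 1 to 2 and from 0 to 2 times the same
  remaining product. The three edges of a triangle cancel modulo 2.\<close>

lemma cup_cochain_cocycle: "(\<Sum>k\<le>Suc p. cup_cochain s j p (v \<circ> skip_index k)) = 0"
proof (induction p arbitrary: j v)
  case 0
  then show ?case by simp
next
  case (Suc p)
  have shift: "(v \<circ> skip_index (Suc k)) \<circ> Suc = (v \<circ> Suc) \<circ> skip_index k" for k
    by (auto simp: fun_eq_iff)
  let ?Q = "\<lambda>k. cup_cochain s (Suc j) p ((v \<circ> Suc) \<circ> skip_index k)"
  have IH: "?Q 0 + (\<Sum>k\<le>p. ?Q (Suc k)) = 0"
    using Suc.IH[of "Suc j" "v \<circ> Suc"] by (simp only: sum.atMost_Suc_shift[of _ p])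
  have faces: "cup_cochain s j (Suc p) (v \<circ> skip_index (Suc (Suc k))) = (s j (v 0) + s j (v 1)) * ?Q (Suc k)" for k
    by (simp add: cup_cochain_Suc shift)
  have Q0: "v \<circ> Suc \<circ> skip_index 0 = v \<circ> Suc \<circ> Suc"
    by simp
  have "(\<Sum>k\<le>Suc (Suc p). cup_cochain s j (Suc p) (v \<circ> skip_index k))
      = cup_cochain s j (Suc p) (v \<circ> Suc) + (cup_cochain s j (Suc p) (v \<circ> skip_index (Suc 0))
        + (s j (v 0) + s j (v 1)) * (\<Sum>k\<le>p. ?Q (Suc k)))"
    by (subst sum.atMost_Suc_shift, subst sum.atMost_Suc_shift)
       (simp only: faces sum_distrib_left skip_index_simps(1))
  also have "(\<Sum>k\<le>p. ?Q (Suc k)) = ?Q 0"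
    using IH by (metis add_eq_0_iff bit_minus_eq)
  also have "cup_cochain s j (Suc p) (v \<circ> skip_index (Suc 0)) = (s j (v 0) + s j (v 2)) * ?Q 0"
    by (simp add: cup_cochain_Suc shift numeral_2_eq_2)
  also have "cup_cochain s j (Suc p) (v \<circ> Suc) = (s j (v 1) + s j (v 2)) * ?Q 0"
    by (simp add: cup_cochain_Suc numeral_2_eq_2 o_assoc)
  also have "(s j (v 1) + s j (v 2)) * ?Q 0 + ((s j (v 0) + s j (v 2)) * ?Q 0 + (s j (v 0) + s j (v 1)) * ?Q 0)
      = ((s j (v 0) + s j (v 0)) + (s j (v 1) + s j (v 1)) + (s j (v 2) + s j (v 2))) * ?Q 0"
    by (simp only: distrib_right add_ac)
  finally show ?case by simp
qed

text \<open>Leibniz rule: the remaining product is a cocycle, so only the change of the first vertex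
  counts, and it changes in face 0 alone.\<close>

lemma cup_cochain_coboundary:
  "(\<Sum>k\<le>Suc p. s j (v (skip_index k 0)) * cup_cochain s (Suc j) p (v \<circ> skip_index k)) = cup_cochain s j (Suc p) v"
proof -
  let ?Q = "\<lambda>k. cup_cochain s (Suc j) p (v \<circ> skip_index k)"
  have "?Q 0 + (\<Sum>k\<le>p. ?Q (Suc k)) = 0"
    using cup_cochain_cocycle[of s "Suc j" p v] by (simp add: sum.atMost_Suc_shift del: sum.atMost_Suc)
  then have "(\<Sum>k\<le>p. ?Q (Suc k)) = ?Q 0"
    by (metis add_eq_0_iff bit_minus_eq)
  then show ?thesis
    by (simp add: sum.atMost_Suc_shift cup_cochain_Suc algebra_simps flip: sum_distrib_left del: sum.atMost_Suc)
qed

lemma simplicial_vertex_singular_face: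
  assumes "k \<le> Suc p" "i \<le> p"
  shows "simplicial_vertex i (singular_face (Suc p) k f) = simplicial_vertex (skip_index k i) f"
proof -
  have "simplical_face k (\<lambda>j. if j = i then 1 else 0) = (\<lambda>j. if j = skip_index k i then 1 else (0::real))"
    using assms by (auto simp: simplical_face_def skip_index_def fun_eq_iff)
  then show ?thesis
    using assms by (simp add: simplicial_vertex_def singular_face_def)
qed

lemma simplicial_vertex_simplex_map:
  "i \<le> p \<Longrightarrow> simplicial_vertex i (simplex_map p g f) = g (simplicial_vertex i f)"
  by (simp add: simplicial_vertex_def simplex_map_def)

abbreviation cup_eval :: "(nat \<Rightarrow> 'a \<Rightarrow> bit) \<Rightarrow> nat \<Rightarrow> nat \<Rightarrow> 'a chain \<Rightarrow> bit" where
  "cup_eval s j p \<equiv> chain_eval (\<lambda>\<sigma>. cup_cochain s j p (\<lambda>i. simplicial_vertex i \<sigma>))"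

text \<open>Stokes' formula: a coboundary on a chain is the original cochain on the boundary of the
  chain.\<close>

lemma cup_eval_boundary:
  "cup_eval s j (Suc p) c =
   chain_eval (\<lambda>\<sigma>. s j (simplicial_vertex 0 \<sigma>) * cup_cochain s (Suc j) p (\<lambda>i. simplicial_vertex i \<sigma>)) (chain_boundary (Suc p) c)"
proof -
  have "(\<Sum>k\<le>Suc p. s j (simplicial_vertex 0 (singular_face (Suc p) k \<sigma>)) *
          cup_cochain s (Suc j) p (\<lambda>i. simplicial_vertex i (singular_face (Suc p) k \<sigma>)))
       = cup_cochain s j (Suc p) (\<lambda>i. simplicial_vertex i \<sigma>)" for \<sigma> :: "(nat \<Rightarrow> real) \<Rightarrow> 'a"
    unfolding cup_cochain_coboundary[symmetric]
    by (intro sum.cong arg_cong2[where f="(*)"] cup_cochain_cong refl)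
       (auto simp: simplicial_vertex_singular_face)
  then show ?thesis
    by (simp add: chain_boundary_def chain_eval_frag_extend chain_eval_sum del: sum.atMost_Suc)
qed

text \<open>On the antipodal copy the factor \<open>s j\<close> changes by 1 while each later
  factor, a difference of two signs, is unchanged. Adding both copies of \<open>c\<close> cancels
  everything except the product without \<open>s j\<close>.\<close>

lemma cup_eval_antipodal_step:
  assumes bd: "chain_boundary (Suc p) c' = c + frag_cmul ((-1) ^ q) (chain_map p \<nu> c)"
    and c: "singular_chain p X c"
    and odd: "\<And>i x. x \<in> topspace X \<Longrightarrow> s i (\<nu> x) = s i x + 1"
  shows "cup_eval s j (Suc p) c' = cup_eval s (Suc j) p c"
proof -
  let ?g = "\<lambda>\<sigma>. s j (simplicial_vertex 0 \<sigma>) * cup_cochain s (Suc j) p (\<lambda>i. simplicial_vertex i \<sigma>)"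
  have "?g (simplex_map p \<nu> \<sigma>) = ?g \<sigma> + cup_cochain s (Suc j) p (\<lambda>i. simplicial_vertex i \<sigma>)"
    if "\<sigma> \<in> Poly_Mapping.keys c" for \<sigma>
  proof -
    have "singular_simplex p X \<sigma>"
      using c that by (auto simp: singular_chain_def)
    then have v: "simplicial_vertex i \<sigma> \<in> topspace X" if "i \<le> p" for i
      using that unfolding singular_simplex_def simplicial_vertex_def continuous_map_def by auto
    have "cup_cochain s (Suc j) p (\<lambda>i. simplicial_vertex i (simplex_map p \<nu> \<sigma>))
        = cup_cochain s (Suc j) p (\<lambda>i. simplicial_vertex i \<sigma>)"
      unfolding cup_cochain_def
    proof (intro prod.cong refl)
      fix i assume "i \<in> {..<p}"
      then have "i \<le> p" "Suc i \<le> p" by auto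
      then have "s (Suc j + i) (simplicial_vertex i (simplex_map p \<nu> \<sigma>)) + s (Suc j + i) (simplicial_vertex (Suc i) (simplex_map p \<nu> \<sigma>))
        = s (Suc j + i) (simplicial_vertex i \<sigma>) + s (Suc j + i) (simplicial_vertex (Suc i) \<sigma>) + (1 + 1)"
        by (simp only: simplicial_vertex_simplex_map odd v add_ac)
      then show "s (Suc j + i) (simplicial_vertex i (simplex_map p \<nu> \<sigma>)) + s (Suc j + i) (simplicial_vertex (Suc i) (simplex_map p \<nu> \<sigma>))
        = s (Suc j + i) (simplicial_vertex i \<sigma>) + s (Suc j + i) (simplicial_vertex (Suc i) \<sigma>)"
        by (simp only: bit_add_self add_0_right)
    qed
    then show ?thesis
      by (simp add: simplicial_vertex_simplex_map odd v distrib_right)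
  qed
  then have "chain_eval ?g (chain_map p \<nu> c) = chain_eval (\<lambda>\<sigma>. ?g \<sigma> + cup_cochain s (Suc j) p (\<lambda>i. simplicial_vertex i \<sigma>)) c"
    by (auto simp: chain_map_def chain_eval_frag_extend intro!: chain_eval_cong)
  then show ?thesis
    unfolding cup_eval_boundary bd
    by (simp add: chain_eval_add chain_eval_add_fun flip: add.assoc)
qed

section \<open>Hemispheres of the cross-polytope\<close>

abbreviation l1_sphere :: "nat \<Rightarrow> (nat \<Rightarrow> real) set" where
  "l1_sphere m \<equiv> {x. (\<forall>i>m. x i = 0) \<and> (\<Sum>i\<le>m. \<bar>x i\<bar>) = 1}"

text \<open>The next hemisphere is the cone, from the new unit vector, over the whole lower sphere.
  The sign makes hemisphere plus antipodal hemisphere a cycle.\<close>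

fun hemisphere :: "nat \<Rightarrow> (nat \<Rightarrow> real) chain" where
  "hemisphere 0 = frag_of (oriented_simplex 0 (\<lambda>_ i. if i = 0 then 1 else 0))"
| "hemisphere (Suc p) = simplicial_cone p (\<lambda>i. if i = Suc p then 1 else 0)
     (hemisphere p + frag_cmul ((-1) ^ Suc p) (chain_map p (\<lambda>x i. - x i) (hemisphere p)))"

lemma simplicial_chain_uminus:
  assumes "simplicial_chain p S c" "\<And>x. x \<in> S \<Longrightarrow> (\<lambda>i. - x i) \<in> S"
  shows "simplicial_chain p S (chain_map p (\<lambda>x i. - x i) c)"
  using assms(1) unfolding simplicial_chain_def
proof (induction rule: frag_induction)
  case (one f)
  then obtain l where l: "f = oriented_simplex p l" "f ` standard_simplex p \<subseteq> S"
    by (auto simp: simplicial_simplex)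
  have "simplex_map p (\<lambda>x i. - x i) f = oriented_simplex p (\<lambda>j i. - l j i)"
    by (auto simp: l simplex_map_def oriented_simplex_def fun_eq_iff sum_negf)
  moreover have "simplex_map p (\<lambda>x i. - x i) f ` standard_simplex p \<subseteq> S"
    using l assms(2) by (auto simp: simplex_map_def)
  ultimately show ?case by (auto simp: simplicial_simplex)
next
  case (diff a b)
  then show ?case
    by (metis chain_map_diff simplicial_chain_def simplicial_chain_diff)
qed auto

lemma simplicial_chain_add:
  "simplicial_chain p S a \<Longrightarrow> simplicial_chain p S b \<Longrightarrow> simplicial_chain p S (a + b)"
  using keys_add[of a b] by (auto simp: simplicial_chain_def)

text \<open>The apex coordinate vanishes on the base, so along a cone segment the absolute values
  sum to \<open>(1 - u) + u = 1\<close>. This is why the l1 norm is used: affine simplices stay on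
  the sphere.\<close>

lemma simplicial_chain_hemisphere: "simplicial_chain p (l1_sphere p) (hemisphere p)"
proof (induction p)
  case 0
  then show ?case
    by (auto simp: simplicial_simplex standard_simplex_0 oriented_simplex_def)
next
  case (Suc p)
  have "simplicial_chain p (l1_sphere p) (hemisphere p + frag_cmul ((-1) ^ Suc p) (chain_map p (\<lambda>x i. - x i) (hemisphere p)))"
    by (intro simplicial_chain_add simplicial_chain_cmul simplicial_chain_uminus Suc) auto
  then show ?case
    unfolding hemisphere.simps
  proof (rule simplicial_chain_simplicial_cone)
    fix x :: "nat \<Rightarrow> real" and u :: real
    assume u: "0 \<le> u" "u \<le> 1" and x: "x \<in> l1_sphere p"
    have "(\<Sum>i\<le>p. \<bar>(1 - u) * (if i = Suc p then 1 else 0) + u * x i\<bar>) = (\<Sum>i\<le>p. u * \<bar>x i\<bar>)"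
      by (intro sum.cong) (use u in \<open>auto simp: abs_mult\<close>)
    also have "\<dots> = u" using x by (simp flip: sum_distrib_left)
    finally show "(\<lambda>i. (1 - u) * (if i = Suc p then 1 else 0) + u * x i) \<in> l1_sphere (Suc p)"
      using u x by auto
  qed
qed

lemma chain_map_uminus_involution:
  assumes "singular_chain p (subtopology (powertop_real UNIV) S) c"
  shows "chain_map p (\<lambda>x i. - x i) (chain_map p (\<lambda>x i. - x i) c) = c"
proof -
  have "chain_map p (\<lambda>x i. - x i) (chain_map p (\<lambda>x i. - x i) c)
      = chain_map p ((\<lambda>x i. - x i) \<circ> (\<lambda>x i. - x i)) c"
    by (simp only: chain_map_compose o_apply)
  also have "\<dots> = c"
    by (rule chain_map_id_gen[OF assms]) simp
  finally show ?thesis .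
qed

text \<open>The boundary of a cone is its base minus the cone over the boundary of the base, and the
  base is a cycle by induction. In degree 0 the correction is the coefficient sum at the apex, which
  vanishes for a difference of two points.\<close>

lemma chain_boundary_hemisphere:
  "chain_boundary (Suc p) (hemisphere (Suc p)) =
   hemisphere p + frag_cmul ((-1) ^ Suc p) (chain_map p (\<lambda>x i. - x i) (hemisphere p))"
proof (induction p)
  case 0
  have "simplicial_chain 0 (l1_sphere 0) (hemisphere 0 - chain_map 0 (\<lambda>x i. - x i) (hemisphere 0))"
    by (intro simplicial_chain_diff simplicial_chain_uminus simplicial_chain_hemisphere) auto
  from chain_boundary_simplicial_cone[OF this]
  show ?case
    by (simp add: frag_extend_diff)
next
  case (Suc p)
  let ?\<nu> = "\<lambda>(x::nat\<Rightarrow>real) i. - x i"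
  let ?d = "hemisphere (Suc p) + frag_cmul ((-1) ^ Suc (Suc p)) (chain_map (Suc p) ?\<nu> (hemisphere (Suc p)))"
  have d: "simplicial_chain (Suc p) (l1_sphere (Suc p)) ?d"
    by (intro simplicial_chain_add simplicial_chain_cmul simplicial_chain_uminus simplicial_chain_hemisphere) auto
  have sc: "singular_chain q (subtopology (powertop_real UNIV) (l1_sphere q)) (hemisphere q)" for q
    by (rule simplicial_imp_singular_chain[OF simplicial_chain_hemisphere])
  have "chain_boundary (Suc p) ?d = 0"
    using chain_boundary_chain_map[OF sc[of "Suc p"], of ?\<nu>] Suc
    by (simp add: chain_boundary_add chain_boundary_cmul chain_map_add chain_map_minus chain_map_uminus_involution[OF sc]
        del: hemisphere.simps)
       (cases "even p"; simp add: chain_boundary_minus)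
  then show ?case
    using chain_boundary_simplicial_cone[OF d]
    by (simp add: simplicial_cone_def)
qed

text \<open>Subdivision commutes with boundary and with the antipode and fixes 0-chains, so the
  descent from hemisphere to hemisphere survives while the simplices become as small as a given
  cover demands.\<close>

lemma subdivided_hemisphere:
  fixes r :: nat
  defines "h \<equiv> \<lambda>p. (singular_subdivision p ^^ r) (hemisphere p)"
  shows "singular_chain p (subtopology (powertop_real UNIV) (l1_sphere p)) (h p)"
    and "h 0 = hemisphere 0"
    and "chain_boundary (Suc p) (h (Suc p)) = h p + frag_cmul ((-1) ^ Suc p) (chain_map p (\<lambda>x i. - x i) (h p))"
proof -
  let ?X = "\<lambda>q. subtopology (powertop_real UNIV) (l1_sphere q)"
  have sc: "singular_chain q (?X q) ((singular_subdivision q ^^ t) (hemisphere q))" for q t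
  proof (induction t)
    case 0
    then show ?case by (simp add: simplicial_imp_singular_chain simplicial_chain_hemisphere)
  next
    case (Suc t)
    then show ?case by (simp add: singular_chain_singular_subdivision)
  qed
  show "singular_chain p (?X p) (h p)"
    unfolding h_def by (rule sc)
  show "h 0 = hemisphere 0"
    unfolding h_def
  proof (induction r)
    case (Suc r)
    then show ?case
      using singular_subdivision_zero[OF sc[of 0 r]] by simp
  qed auto
  have sub_add: "singular_subdivision p (a + frag_cmul ((-1) ^ k) b) = singular_subdivision p a + frag_cmul ((-1) ^ k) (singular_subdivision p b)"
    for k and a b :: "(nat \<Rightarrow> real) chain"
    by (simp add: singular_subdivision_def frag_extend_add frag_extend_cmul)
  have "chain_boundary (Suc p) ((singular_subdivision (Suc p) ^^ t) (hemisphere (Suc p))) =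
      (singular_subdivision p ^^ t) (hemisphere p) + frag_cmul ((-1) ^ Suc p) (chain_map p (\<lambda>x i. - x i) ((singular_subdivision p ^^ t) (hemisphere p)))" for t
  proof (induction t)
    case 0
    then show ?case using chain_boundary_hemisphere[of p] by (simp only: funpow_0)
  next
    case (Suc t)
    show ?case
      using chain_boundary_singular_subdivision[OF sc[of "Suc p" t]]
      unfolding funpow.simps o_apply
      by (simp only: Suc.IH sub_add diff_Suc_Suc diff_zero naturality_singular_subdivision[OF sc[of p t]])
  qed
  then show "chain_boundary (Suc p) (h (Suc p)) = h p + frag_cmul ((-1) ^ Suc p) (chain_map p (\<lambda>x i. - x i) (h p))"
    unfolding h_def .
qed

text \<open>Without a zero, the product of the coboundaries of the signs of \<open>f x j\<close> is
  evaluated twice on a fine hemisphere. Descending through the dimensions gives 1. But on each small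
  simplex some \<open>f x j\<close> has constant sign, so the \<open>j\<close>-th factor vanishes
  and the value is 0.\<close>

theorem borsuk_ulam_l1:
  fixes f :: "(nat \<Rightarrow> real) \<Rightarrow> nat \<Rightarrow> real"
  assumes cont: "\<And>j. j < m \<Longrightarrow> continuous_on (l1_sphere m) (\<lambda>x. f x j)"
    and odd: "\<And>x j. x \<in> l1_sphere m \<Longrightarrow> j < m \<Longrightarrow> f (\<lambda>i. - x i) j = - f x j"
  shows "\<exists>x \<in> l1_sphere m. \<forall>j<m. f x j = 0"
proof (rule ccontr)
  assume "\<not> ?thesis"
  then have nz: "\<exists>j<m. f x j \<noteq> 0" if "x \<in> l1_sphere m" for x
    using that by blast
  let ?\<nu> = "\<lambda>(x::nat\<Rightarrow>real) i. - x i"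
  let ?S = "l1_sphere m"
  let ?X = "subtopology (powertop_real UNIV) ?S"
  have X: "?X = top_of_set ?S"
    by (simp add: euclidean_product_topology)
  \<comment> \<open>Tie-breaking sign, odd under the antipode, for points with
    \<open>f x j = 0\<close> and for \<open>j \<ge> m\<close>. No continuity is required: cochains
    look only at vertices.\<close>
  define lead where "lead x \<longleftrightarrow> 0 < x (LEAST i. x i \<noteq> 0)" for x :: "nat \<Rightarrow> real"
  have lead: "lead (?\<nu> x) \<longleftrightarrow> \<not> lead x" if "x \<in> ?S" for x
  proof -
    have "\<exists>i. x i \<noteq> 0"
      using that by (metis (mono_tags, lifting) abs_0 mem_Collect_eq sum.neutral zero_neq_one)
    then have "x (LEAST i. x i \<noteq> 0) \<noteq> 0"
      by (rule LeastI_ex)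
    then show ?thesis by (auto simp: lead_def)
  qed
  define pos where "pos j x \<longleftrightarrow> (if j < m \<and> f x j \<noteq> 0 then 0 < f x j else lead x)" for j x
  define s :: "nat \<Rightarrow> (nat \<Rightarrow> real) \<Rightarrow> bit" where "s j x = of_bool (pos j x)" for j x
  have odd_s: "s j (?\<nu> x) = s j x + 1" if "x \<in> ?S" for j x
  proof -
    have "pos j (?\<nu> x) \<longleftrightarrow> \<not> pos j x"
      using odd[of x j] lead[OF that] that by (auto simp: pos_def)
    then show ?thesis by (auto simp: s_def)
  qed
  define \<C> where "\<C> = (\<Union>j<m. {{x \<in> ?S. f x j > 0}, {x \<in> ?S. f x j < 0}})"
  have cont': "continuous_map ?X euclideanreal (\<lambda>x. f x j)" if "j < m" for j
    using cont[OF that] unfolding X by simp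
  have op: "openin ?X U" if "U \<in> \<C>" for U
    using that openin_continuous_map_preimage[OF cont', of _ "{0<..}"] openin_continuous_map_preimage[OF cont', of _ "{..<0}"]
    by (auto simp: \<C>_def)
  have cov: "topspace ?X \<subseteq> \<Union>\<C>"
  proof
    fix x assume "x \<in> topspace ?X"
    then have x: "x \<in> ?S" by simp
    with nz obtain j where "j < m" "f x j \<noteq> 0" by blast
    with x show "x \<in> \<Union>\<C>" unfolding \<C>_def by (auto simp: neq_iff)
  qed
  have "singular_chain m ?X (hemisphere m)"
    by (rule simplicial_imp_singular_chain[OF simplicial_chain_hemisphere])
  from sufficient_iterated_singular_subdivision_exists[OF op cov this]
  obtain r where "\<And>t \<sigma>. r \<le> t \<Longrightarrow> \<sigma> \<in> Poly_Mapping.keys ((singular_subdivision m ^^ t) (hemisphere m)) \<Longrightarrow> \<exists>V\<in>\<C>. \<sigma> \<in> standard_simplex m \<rightarrow> V"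
    by metis
  then have small: "\<exists>V\<in>\<C>. \<sigma> \<in> standard_simplex m \<rightarrow> V"
    if "\<sigma> \<in> Poly_Mapping.keys ((singular_subdivision m ^^ r) (hemisphere m))" for \<sigma>
    using that by blast
  define h where "h = (\<lambda>p. (singular_subdivision p ^^ r) (hemisphere p))"
  have h: "singular_chain p (subtopology (powertop_real UNIV) (l1_sphere p)) (h p)"
    "h 0 = hemisphere 0"
    "chain_boundary (Suc p) (h (Suc p)) = h p + frag_cmul ((-1) ^ Suc p) (chain_map p (\<lambda>x i. - x i) (h p))" for p
    unfolding h_def 
    by (rule subdivided_hemisphere(1), rule subdivided_hemisphere(2), rule subdivided_hemisphere(3))
  have step: "cup_eval s j p (h p) = 1" if "p \<le> m" for j p
    using that
  proof (induction p arbitrary: j)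
    case 0
    then show ?case by (simp add: h(2))
  next
    case (Suc p)
    have "cup_eval s j (Suc p) (h (Suc p)) = cup_eval s (Suc j) p (h p)"
    proof (rule cup_eval_antipodal_step[OF h(3) h(1)])
      fix i and x :: "nat \<Rightarrow> real" assume "x \<in> topspace (subtopology (powertop_real UNIV) (l1_sphere p))"
      then have x: "\<forall>i>p. x i = 0" "(\<Sum>i\<le>p. \<bar>x i\<bar>) = 1" by auto
      have "(\<Sum>i\<le>m. \<bar>x i\<bar>) = (\<Sum>i\<le>p. \<bar>x i\<bar>)"
        by (rule sum.mono_neutral_right) (use x Suc.prems in auto)
      then show "s i (\<lambda>i. - x i) = s i x + 1"
        using x Suc.prems by (intro odd_s) auto
    qed
    then show ?case using Suc by simp
  qed
  have "cup_cochain s 0 m (\<lambda>i. simplicial_vertex i \<sigma>) = 0" if \<sigma>: "\<sigma> \<in> Poly_Mapping.keys (h m)" for \<sigma>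
  proof -
    obtain V where "V \<in> \<C>" "\<sigma> \<in> standard_simplex m \<rightarrow> V"
      using small \<sigma> by (auto simp: h_def)
    then obtain j where j: "j < m" and "V = {x \<in> ?S. f x j > 0} \<or> V = {x \<in> ?S. f x j < 0}"
      by (auto simp: \<C>_def)
    moreover have "simplicial_vertex i \<sigma> \<in> V" if "i \<le> m" for i
      unfolding simplicial_vertex_def by (rule funcset_mem[OF \<open>\<sigma> \<in> standard_simplex m \<rightarrow> V\<close>]) (simp add: that)
    ultimately have "(\<forall>i\<le>m. f (simplicial_vertex i \<sigma>) j > 0) \<or> (\<forall>i\<le>m. f (simplicial_vertex i \<sigma>) j < 0)"
      by blast
    then have "pos j (simplicial_vertex j \<sigma>) = pos j (simplicial_vertex (Suc j) \<sigma>)"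
      using j unfolding pos_def
      by (metis Suc_leI less_imp_le_nat less_irrefl not_less_iff_gr_or_eq)
    then have "s (0 + j) (simplicial_vertex j \<sigma>) + s (0 + j) (simplicial_vertex (Suc j) \<sigma>) = 0"
      by (simp add: s_def)
    then show ?thesis
      unfolding cup_cochain_def using j by (intro prod_zero) auto
  qed
  then have "cup_eval s 0 m (h m) = chain_eval (\<lambda>_. 0) (h m)"
    by (rule chain_eval_cong)
  also have "\<dots> = 0" by (simp add: chain_eval_def)
  finally show False using step[of m 0] by simp
qed

section \<open>Odd maps on cubes, linear systems and generic points\<close>

lemma continuous_on_Max_image:
  fixes f :: "'i \<Rightarrow> 'a::topological_space \<Rightarrow> real"
  assumes "finite A" "A \<noteq> {}" "\<And>i. i \<in> A \<Longrightarrow> continuous_on S (f i)"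
  shows "continuous_on S (\<lambda>x. Max ((\<lambda>i. f i x) ` A))"
  using assms
proof (induction A rule: finite_ne_induct)
  case (insert a A)
  then have "continuous_on S (\<lambda>x. max (f a x) (Max ((\<lambda>i. f i x) ` A)))"
    by (intro continuous_on_max) auto
  with insert show ?case by simp
qed simp

lemma continuous_on_coordinate: "continuous_on S (\<lambda>x :: 'i \<Rightarrow> 'b::topological_space. x i)"
  by (rule continuous_on_subset[OF continuous_on_product_coordinates]) simp

abbreviation sup_cube :: "'i set \<Rightarrow> ('i \<Rightarrow> real) set" where
  "sup_cube I \<equiv> {x. (\<forall>i. i \<notin> I \<longrightarrow> x i = 0) \<and> (\<forall>i\<in>I. \<bar>x i\<bar> \<le> 1)}"

abbreviation sup_sphere :: "'i set \<Rightarrow> ('i \<Rightarrow> real) set" where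
  "sup_sphere I \<equiv> {x. (\<forall>i. i \<notin> I \<longrightarrow> x i = 0) \<and> (\<forall>i\<in>I. \<bar>x i\<bar> \<le> 1) \<and> (\<exists>i\<in>I. \<bar>x i\<bar> = 1)}"

text \<open>Division by the maximum norm projects the l1 sphere radially onto the boundary of the
  cube. The projection is continuous and odd.\<close>

theorem borsuk_ulam_cube:
  fixes f :: "('i \<Rightarrow> real) \<Rightarrow> 'j \<Rightarrow> real"
  assumes I: "finite I" and J: "finite J" "card J < card I"
    and cont: "\<And>j. j \<in> J \<Longrightarrow> continuous_on (sup_sphere I) (\<lambda>x. f x j)"
    and odd: "\<And>x j. j \<in> J \<Longrightarrow> (\<forall>i. i \<notin> I \<longrightarrow> x i = 0) \<Longrightarrow> (\<forall>i\<in>I. \<bar>x i\<bar> \<le> 1) \<Longrightarrow> (\<exists>i\<in>I. \<bar>x i\<bar> = 1) \<Longrightarrow>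
                f (\<lambda>i. - x i) j = - f x j"
  obtains x where "\<And>i. i \<notin> I \<Longrightarrow> x i = 0" "\<And>i. i \<in> I \<Longrightarrow> \<bar>x i\<bar> \<le> 1" "\<exists>i\<in>I. \<bar>x i\<bar> = 1" "\<And>j. j \<in> J \<Longrightarrow> f x j = 0"
proof -
  let ?S = "sup_sphere I"
  have "0 < card I" using J(2) by linarith
  then obtain m where m: "card I = Suc m" using gr0_implies_Suc by blast
  obtain e where e: "bij_betw e I {..m}"
    using ex_bij_betw_finite_nat[OF I] m by (metis atLeast0LessThan lessThan_Suc_atMost)
  obtain e' where e': "bij_betw e' J {..<card J}"
    using ex_bij_betw_finite_nat[OF J(1)] by (metis atLeast0LessThan)
  define M where "M p = Max ((\<lambda>i. \<bar>p i\<bar>) ` {..m})" for p :: "nat \<Rightarrow> real"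
  define X where "X p = (\<lambda>i. if i \<in> I then p (e i) / M p else 0)" for p :: "nat \<Rightarrow> real"
  have M_ge: "\<bar>p i\<bar> \<le> M p" if "i \<le> m" for p i
    unfolding M_def using that by (intro Max_ge) auto
  have M_pos: "M p > 0" if "p \<in> l1_sphere m" for p
  proof (rule ccontr)
    assume "\<not> M p > 0"
    then have "\<bar>p i\<bar> \<le> 0" if "i \<le> m" for i using M_ge[OF that, of p] by linarith
    then have "(\<Sum>i\<le>m. \<bar>p i\<bar>) = 0" by (intro sum.neutral) auto
    with that show False by simp
  qed
  have M_att: "\<exists>i\<le>m. \<bar>p i\<bar> = M p" for p
  proof -
    have "M p \<in> (\<lambda>i. \<bar>p i\<bar>) ` {..m}" unfolding M_def by (intro Max_in) auto
    then show ?thesis by auto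
  qed
  have M_minus: "M (\<lambda>i. - p i) = M p" for p by (simp add: M_def)
  have X_minus: "X (\<lambda>i. - p i) = (\<lambda>i. - X p i)" for p
    by (auto simp: X_def M_minus)
  have contM: "continuous_on T M" for T
    unfolding M_def by (intro continuous_on_Max_image continuous_intros continuous_on_coordinate) auto
  have contX: "continuous_on (l1_sphere m) X"
  proof (rule continuous_on_coordinatewise_then_product)
    fix i
    show "continuous_on (l1_sphere m) (\<lambda>p. X p i)"
    proof (cases "i \<in> I")
      case True
      have "continuous_on (l1_sphere m) (\<lambda>p. p (e i) / M p)"
      proof (rule continuous_on_divide[OF continuous_on_coordinate contM])
        show "\<forall>p\<in>l1_sphere m. M p \<noteq> 0"
        proof
          fix p assume "p \<in> l1_sphere m"
          from M_pos[OF this] show "M p \<noteq> 0" by linarith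
        qed
      qed
      with True show ?thesis by (simp add: X_def)
    qed (simp add: X_def)
  qed
  have XS: "X p \<in> ?S" if "p \<in> l1_sphere m" for p
  proof -
    have "\<bar>X p i\<bar> \<le> 1" if "i \<in> I" for i
    proof -
      have "e i \<le> m" using bij_betwE[OF e] that by auto
      then have "\<bar>p (e i)\<bar> / M p \<le> 1"
        using M_ge[of "e i" p] M_pos[OF \<open>p \<in> l1_sphere m\<close>] by (simp add: divide_le_eq_1_pos)
      then show ?thesis using that M_pos[OF \<open>p \<in> l1_sphere m\<close>] by (simp add: X_def)
    qed
    moreover obtain i where "i \<le> m" "\<bar>p i\<bar> = M p" using M_att by blast
    then obtain k where "k \<in> I" "e k = i" using e by (metis atMost_iff bij_betw_iff_bijections)
    then have "\<bar>X p k\<bar> = 1" using \<open>\<bar>p i\<bar> = M p\<close> M_pos[OF that] by (auto simp: X_def)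
    ultimately show ?thesis using \<open>k \<in> I\<close> by (auto simp: X_def)
  qed
  \<comment> \<open>With \<open>card I = Suc m\<close> there are at most \<open>m\<close> functions;
    missing ones are padded with the odd function 0.\<close>
  define g where "g p j = (if j < card J then f (X p) (inv_into J e' j) else 0)" for p j
  have inv: "inv_into J e' j \<in> J" if "j < card J" for j
    using e' that by (metis bij_betw_imp_surj_on inv_into_into lessThan_iff)
  have "\<exists>p\<in>l1_sphere m. \<forall>j<m. g p j = 0"
  proof (rule borsuk_ulam_l1)
    fix j
    show "continuous_on (l1_sphere m) (\<lambda>p. g p j)"
    proof (cases "j < card J")
      case True
      have "continuous_on (l1_sphere m) (\<lambda>p. f (X p) (inv_into J e' j))"
        by (rule continuous_on_compose2[OF cont[OF inv[OF True]] contX]) (use XS in blast)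
      with True show ?thesis by (simp add: g_def)
    qed (simp add: g_def)
  next
    fix p j assume "p \<in> l1_sphere m"
    then show "g (\<lambda>i. - p i) j = - g p j"
      using XS[of p] odd[OF inv, of j "X p"] by (auto simp: g_def X_minus)
  qed
  then obtain p where p: "p \<in> l1_sphere m" "\<And>j. j < m \<Longrightarrow> g p j = 0" by blast
  have "f (X p) j = 0" if "j \<in> J" for j
  proof -
    have "e' j < card J" "inv_into J e' (e' j) = j"
      using e' that by (auto simp: bij_betw_def inj_on_def)
    then show ?thesis using p(2)[of "e' j"] J m by (auto simp: g_def)
  qed
  with XS[OF p(1)] show ?thesis by (intro that[of "X p"]) simp_all
qed

text \<open>Apply Borsuk--Ulam on the boundary of a cube with one more coordinate t to the odd map interpolating
  between g x at t = 1 and - g (- x) at t = - 1.\<close>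

theorem poincare_miranda:
  fixes g :: "('i \<Rightarrow> real) \<Rightarrow> 'i \<Rightarrow> real"
  assumes I: "finite I"
    and cont: "\<And>i. i \<in> I \<Longrightarrow> continuous_on (sup_cube I) (\<lambda>x. g x i)"
    and pos: "\<And>x i. i \<in> I \<Longrightarrow> (\<forall>i. i \<notin> I \<longrightarrow> x i = 0) \<Longrightarrow> (\<forall>i\<in>I. \<bar>x i\<bar> \<le> 1) \<Longrightarrow> x i = 1 \<Longrightarrow> g x i > 0"
    and neg: "\<And>x i. i \<in> I \<Longrightarrow> (\<forall>i. i \<notin> I \<longrightarrow> x i = 0) \<Longrightarrow> (\<forall>i\<in>I. \<bar>x i\<bar> \<le> 1) \<Longrightarrow> x i = -1 \<Longrightarrow> g x i < 0"
  obtains x where "\<And>i. i \<notin> I \<Longrightarrow> x i = 0" "\<And>i. i \<in> I \<Longrightarrow> \<bar>x i\<bar> \<le> 1" "\<And>i. i \<in> I \<Longrightarrow> g x i = 0"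
proof -
  let ?C = "sup_cube I"
  let ?I = "insert None (Some ` I)"
  let ?S = "sup_sphere ?I"
  define up where "up y = (\<lambda>i. y (Some i))" for y :: "'i option \<Rightarrow> real"
  define dn where "dn y = (\<lambda>i. - y (Some i))" for y :: "'i option \<Rightarrow> real"
  define f where "f y i = (1 + y None) / 2 * g (up y) i - (1 - y None) / 2 * g (dn y) i" for y i
  have C: "up y \<in> ?C" "dn y \<in> ?C" if "y \<in> ?S" for y
    using that by (auto simp: up_def dn_def)
  have "card I < card ?I"
    using I by (simp add: card_image)
  then obtain y where y: "\<And>i. i \<notin> ?I \<Longrightarrow> y i = 0" "\<And>i. i \<in> ?I \<Longrightarrow> \<bar>y i\<bar> \<le> 1" "\<exists>i\<in>?I. \<bar>y i\<bar> = 1" "\<And>i. i \<in> I \<Longrightarrow> f y i = 0"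
  proof (rule borsuk_ulam_cube[where I = ?I and J = I and f = f, rotated 2])
    fix i assume i: "i \<in> I"
    have "continuous_on ?S (\<lambda>y. g (up y) i)"
    proof (rule continuous_on_compose2[OF cont[OF i]])
      show "continuous_on ?S up" unfolding up_def
        by (intro continuous_on_coordinatewise_then_product continuous_on_coordinate)
    qed (rule image_subsetI, rule C)
    moreover have "continuous_on ?S (\<lambda>y. g (dn y) i)"
    proof (rule continuous_on_compose2[OF cont[OF i]])
      show "continuous_on ?S dn" unfolding dn_def
        by (intro continuous_on_coordinatewise_then_product continuous_on_minus continuous_on_coordinate)
    qed (rule image_subsetI, rule C)
    ultimately show "continuous_on ?S (\<lambda>y. f y i)"
      unfolding f_def by (intro continuous_intros continuous_on_coordinate) auto
  next
    fix y i
    have "up (\<lambda>i. - y i) = dn y" "dn (\<lambda>i. - y i) = up y"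
      by (auto simp: up_def dn_def)
    then show "f (\<lambda>i. - y i) i = - f y i"
      by (simp add: f_def algebra_simps)
  qed (use I in auto)
  have y_S: "y \<in> ?S" using y(1-3) by auto
  note C' = C[OF y_S]
  have t: "\<bar>y None\<bar> \<le> 1" using y(2) by auto
  \<comment> \<open>At \<open>y None = 1\<close> or \<open>- 1\<close> only one summand of
    \<open>f\<close> is left, so \<open>up y\<close> or \<open>dn y\<close> is the zero sought. In
    between, another coordinate is extreme, \<open>up y\<close> and \<open>dn y\<close> lie on
    opposite faces, and the two summands of \<open>f\<close> are non-zero of equal sign.\<close>
  consider "y None = 1" | "y None = - 1" | "\<bar>y None\<bar> < 1" using t by linarith
  then show ?thesis
  proof cases
    case 1
    then have "g (up y) i = 0" if "i \<in> I" for i using y(4)[OF that] by (simp add: f_def)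
    then show ?thesis using C'(1) by (intro that[of "up y"]) auto
  next
    case 2
    then have "g (dn y) i = 0" if "i \<in> I" for i using y(4)[OF that] by (simp add: f_def)
    then show ?thesis using C'(2) by (intro that[of "dn y"]) auto
  next
    case 3
    then obtain i where i: "i \<in> I" "\<bar>y (Some i)\<bar> = 1" using y(3) by auto
    then consider "up y i = 1" "dn y i = - 1" | "up y i = - 1" "dn y i = 1"
      unfolding up_def dn_def by linarith
    then have "f y i \<noteq> 0"
    proof cases
      case 1
      then have "g (up y) i > 0" "g (dn y) i < 0" using C' pos[OF i(1), of "up y"] neg[OF i(1), of "dn y"] by auto
      then have "(1 + y None) / 2 * g (up y) i > 0" "(1 - y None) / 2 * g (dn y) i < 0"
        using 3 by (auto intro!: mult_pos_pos mult_pos_neg)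
      then show ?thesis unfolding f_def by linarith
    next
      case 2
      then have "g (up y) i < 0" "g (dn y) i > 0" using C' neg[OF i(1), of "up y"] pos[OF i(1), of "dn y"] by auto
      then have "(1 + y None) / 2 * g (up y) i < 0" "(1 - y None) / 2 * g (dn y) i > 0"
        using 3 by (auto intro!: mult_pos_pos mult_pos_neg)
      then show ?thesis unfolding f_def by linarith
    qed
    with y(4) i show ?thesis by blast
  qed
qed

text \<open>A linear map is odd and continuous, so Borsuk-Ulam yields a kernel vector on the
  boundary of the cube.\<close>

lemma underdetermined_system_solvable:
  fixes c :: "'e \<Rightarrow> 'i \<Rightarrow> real"
  assumes "finite I" "finite E" "card E < card I"
  obtains x where "\<exists>i\<in>I. x i \<noteq> 0" "\<And>e. e \<in> E \<Longrightarrow> (\<Sum>i\<in>I. c e i * x i) = 0"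
proof -
  obtain x :: "'i \<Rightarrow> real" where "\<exists>i\<in>I. \<bar>x i\<bar> = 1" "\<And>e. e \<in> E \<Longrightarrow> (\<Sum>i\<in>I. c e i * x i) = 0"
    by (rule borsuk_ulam_cube[OF assms, of "\<lambda>x e. \<Sum>i\<in>I. c e i * x i"])
       (auto simp: sum_negf intro!: continuous_intros continuous_on_coordinate)
  moreover from this(1) have "\<exists>i\<in>I. x i \<noteq> 0" by (metis abs_0 zero_neq_one)
  ultimately show ?thesis using that by blast
qed

lemma generic_point:
  fixes H :: "(('i \<Rightarrow> real) \<times> real) set"
  assumes I: "finite I" and H: "finite H" "\<And>a b. (a, b) \<in> H \<Longrightarrow> \<exists>i\<in>I. a i \<noteq> 0"
  obtains \<delta> where "\<And>i. i \<in> I \<Longrightarrow> \<bar>\<delta> i\<bar> < 1" "\<And>a b. (a, b) \<in> H \<Longrightarrow> (\<Sum>i\<in>I. a i * \<delta> i) \<noteq> b"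
proof -
  obtain e :: "'i \<Rightarrow> nat" where e: "inj_on e I"
    using finite_imp_inj_to_nat_seg[OF I] by blast
  define P where "P = (\<lambda>(a, b). (\<Sum>i\<in>I. Polynomial.monom (a i) (Suc (e i))) - [:b:] :: real poly)"
  \<comment> \<open>The exponents start at 1 and are distinct, so \<open>b\<close> occupies the
    constant term only and a non-zero \<open>a i\<close> survives as a coefficient.\<close>
  have "P h \<noteq> 0" if "h \<in> H" for h
  proof -
    obtain a b where h: "h = (a, b)" by (cases h)
    with H(2) that obtain i where i: "i \<in> I" "a i \<noteq> 0" by blast
    have "poly.coeff (P h) (Suc (e i)) = (\<Sum>k\<in>I. if k = i then a i else 0)"
      using e i by (auto simp: h P_def coeff_sum inj_on_def intro!: sum.cong)
    also have "\<dots> = a i" using I i by simp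
    finally show ?thesis using i by auto
  qed
  \<comment> \<open>the curve t, t^2, t^3, ... meets every hyperplane in finitely many points\<close>
  then have "finite (\<Union>h\<in>H. {t. poly (P h) t = 0})"
    using H(1) by (auto intro: poly_roots_finite)
  moreover have "infinite {0<..<1::real}"
    by (simp add: infinite_Ioo)
  ultimately have "{0<..<1} - (\<Union>h\<in>H. {t. poly (P h) t = 0}) \<noteq> {}"
    by (metis Diff_infinite_finite finite.emptyI)
  then obtain t where t: "0 < t" "t < 1" "\<And>h. h \<in> H \<Longrightarrow> poly (P h) t \<noteq> 0"
    by fastforce
  show ?thesis
  proof (rule that[of "\<lambda>i. t ^ Suc (e i)"])
    show "\<bar>t ^ Suc (e i)\<bar> < 1" for i
      using t by (simp add: power_Suc_less_one abs_mult power_less_one_iff del: power_Suc)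
    show "(\<Sum>i\<in>I. a i * t ^ Suc (e i)) \<noteq> b" if "(a, b) \<in> H" for a b
      using t(3)[OF that] by (simp add: P_def poly_sum poly_monom)
  qed
qed

section \<open>Invariant measures as limits of empirical measures\<close>

text \<open>For \<open>r = 1/2\<close> these are binary expansions, which reach all of [0,1]; for
  \<open>r = 1/3\<close> the values form a Cantor set from which the digits can be read off.\<close>

definition digit_sum :: "real \<Rightarrow> (nat \<Rightarrow> bool) \<Rightarrow> real" where
  "digit_sum r b = suminf (\<lambda>i. of_bool (b i) * r ^ Suc i)"

lemma summable_digit_sum:
  fixes r :: real
  assumes "0 \<le> r" "r < 1"
  shows "summable (\<lambda>i. of_bool (b i) * r ^ Suc i)"
proof (rule summable_comparison_test')
  show "summable (\<lambda>i. r ^ Suc i)" using assms by (subst summable_Suc_iff) (simp add: summable_geometric)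
  show "norm (of_bool (b i) * r ^ Suc i) \<le> r ^ Suc i" for i using assms by auto
qed

lemma digit_sum_unfold:
  assumes "0 \<le> r" "r < 1"
  shows "digit_sum r b = r * (of_bool (b 0) + digit_sum r (b \<circ> Suc))"
proof -
  have "digit_sum r b = of_bool (b 0) * r + suminf (\<lambda>i. of_bool (b (Suc i)) * r ^ Suc (Suc i))"
    unfolding digit_sum_def using suminf_split_head[OF summable_digit_sum[OF assms, of b]] by simp
  also have "suminf (\<lambda>i. of_bool (b (Suc i)) * r ^ Suc (Suc i)) = suminf (\<lambda>i. r * (of_bool ((b \<circ> Suc) i) * r ^ Suc i))"
    by (simp add: algebra_simps)
  also have "\<dots> = r * digit_sum r (b \<circ> Suc)"
    unfolding digit_sum_def by (rule suminf_mult[OF summable_digit_sum[OF assms]])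
  finally show ?thesis by (simp add: algebra_simps)
qed

lemma digit_sum_bounds:
  assumes "0 \<le> r" "r < 1"
  shows "0 \<le> digit_sum r b" "digit_sum r b \<le> r / (1 - r)"
proof -
  show "0 \<le> digit_sum r b"
    unfolding digit_sum_def by (rule suminf_nonneg[OF summable_digit_sum[OF assms]]) (use assms in auto)
  have s: "summable (\<lambda>i. r ^ Suc i)" using assms by (subst summable_Suc_iff) (simp add: summable_geometric)
  have "digit_sum r b \<le> suminf (\<lambda>i. r ^ Suc i)"
    unfolding digit_sum_def by (rule suminf_le[OF _ summable_digit_sum[OF assms] s]) (use assms in auto)
  also have "\<dots> = r / (1 - r)"
    using assms suminf_mult[of "\<lambda>i. r ^ i" r] by (simp add: summable_geometric suminf_geometric)
  finally show "digit_sum r b \<le> r / (1 - r)" .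
qed

lemma continuous_on_digit_sum:
  assumes "0 \<le> r" "r < 1"
  shows "continuous_on UNIV (digit_sum r)"
proof -
  have "uniform_limit UNIV (\<lambda>n b. \<Sum>i<n. of_bool (b i) * r ^ Suc i) (\<lambda>b. suminf (\<lambda>i. of_bool (b i) * r ^ Suc i)) sequentially"
  proof (rule Weierstrass_m_test)
    show "norm (of_bool (b i) * r ^ Suc i) \<le> r ^ Suc i" for i b using assms by auto
    show "summable (\<lambda>i. r ^ Suc i)" using assms by (subst summable_Suc_iff) (simp add: summable_geometric)
  qed
  moreover have "continuous_on UNIV (\<lambda>b :: nat \<Rightarrow> bool. (\<Sum>i<n. of_bool (b i) * r ^ Suc i))" for n
  proof -
    have "continuous_on UNIV (\<lambda>b :: nat \<Rightarrow> bool. of_bool (b i) :: real)" for i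
      by (rule continuous_on_compose2[OF _ continuous_on_product_coordinates]) (auto intro: continuous_on_discrete)
    then show ?thesis by (intro continuous_intros)
  qed
  ultimately show ?thesis
    unfolding digit_sum_def by (intro uniform_limit_theorem) auto
qed

text \<open>A tail is at most \<open>(1/3) / (1 - 1/3) = 1/2\<close>, less than one unit of the
  first digit, so the first digit is determined; then shift.\<close>

lemma inj_digit_sum: "inj (digit_sum (1/3))"
proof (rule injI)
  fix b c assume eq: "digit_sum (1/3) b = digit_sum (1/3) c"
  have step: "b 0 = c 0 \<and> digit_sum (1/3) (b \<circ> Suc) = digit_sum (1/3) (c \<circ> Suc)"
    if "digit_sum (1/3) b = digit_sum (1/3) c" for b c
    using that digit_sum_unfold[of "1/3" b] digit_sum_unfold[of "1/3" c]
      digit_sum_bounds[of "1/3" "b \<circ> Suc"] digit_sum_bounds[of "1/3" "c \<circ> Suc"]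
    by (cases "b 0"; cases "c 0") auto
  have "digit_sum (1/3) (\<lambda>i. b (n + i)) = digit_sum (1/3) (\<lambda>i. c (n + i))" for n
  proof (induction n)
    case (Suc n)
    then show ?case using step[OF Suc] by (simp add: o_def)
  qed (use eq in simp)
  then have "b n = c n" for n using step[of "\<lambda>i. b (n + i)" "\<lambda>i. c (n + i)"] by simp
  then show "b = c" by blast
qed

lemma digit_sum_surj:
  assumes "0 \<le> y" "y \<le> 1"
  obtains b where "digit_sum (1/2) b = y"
proof -
  \<comment> \<open>Greedy binary expansion: \<open>r n\<close> is the remainder after
    \<open>n\<close> digits, scaled up by \<open>2 ^ n\<close>, and stays in [0,1].\<close>
  define r where "r = rec_nat y (\<lambda>_ r. 2 * r - of_bool (r \<ge> 1/2))"
  have r_Suc: "r (Suc n) = 2 * r n - of_bool (r n \<ge> 1/2)" and r0: "r 0 = y" for n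
    by (simp_all add: r_def)
  have r01: "0 \<le> r n \<and> r n \<le> 1" for n
    by (induction n) (use assms in \<open>auto simp: r_Suc r0\<close>)
  define b where "b n \<longleftrightarrow> r n \<ge> 1/2" for n
  have part: "(\<Sum>i<n. of_bool (b i) * (1/2) ^ Suc i) = y - r n * (1/2) ^ n" for n
    by (induction n) (auto simp: r0 r_Suc b_def algebra_simps)
  have "(\<lambda>n. r n * (1/2) ^ n) \<longlonglongrightarrow> 0"
  proof (rule Lim_null_comparison)
    show "\<forall>\<^sub>F n in sequentially. norm (r n * (1/2) ^ n) \<le> (1/2) ^ n"
      using r01 by (auto simp: abs_mult intro!: always_eventually mult_left_le_one_le)
    show "(\<lambda>n. (1/2) ^ n :: real) \<longlonglongrightarrow> 0" by (simp add: LIMSEQ_realpow_zero)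
  qed
  then have "(\<lambda>n. y - r n * (1/2) ^ n) \<longlonglongrightarrow> y - 0"
    by (intro tendsto_intros)
  then have "(\<lambda>i. of_bool (b i) * (1/2) ^ Suc i) sums y"
    unfolding sums_def part by simp
  then show ?thesis
    by (intro that[of b]) (simp add: digit_sum_def sums_unique[symmetric])
qed

lemma compact_UNIV_bits: "compact (UNIV :: (nat \<Rightarrow> bool) set)"
proof -
  have "compact_space (product_topology (\<lambda>_::nat. euclidean :: bool topology) UNIV)"
    unfolding compact_space_product_topology
    by (auto simp: compact_space_def intro: finite_imp_compact)
  then show ?thesis
    unfolding euclidean_product_topology compact_space_def by simp
qed

text \<open>Lets Helly's selection theorem on the real line produce weak limits on K: binary digits map onto the
  Hilbert cube, ternary digits embed into the line.\<close>

lemma compact_cube_subset_image_of_real: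
  fixes K :: "(nat \<Rightarrow> real) set"
  assumes K: "compact K" "\<And>x i. x \<in> K \<Longrightarrow> 0 \<le> x i \<and> x i \<le> 1"
  obtains C :: "real set" and p where "compact C" "continuous_on C p" "p ` C = K"
proof -
  \<comment> \<open>\<open>prod_encode\<close> splits one bit sequence into countably many, one
    binary expansion for each coordinate.\<close>
  define P where "P b = (\<lambda>m. digit_sum (1/2) (\<lambda>i. b (prod_encode (m, i))))" for b
  have contP: "continuous_on UNIV P"
    unfolding P_def
    by (intro continuous_on_coordinatewise_then_product continuous_on_compose2[OF continuous_on_digit_sum]
        continuous_on_product_coordinates) auto
  define D where "D = P -` K"
  have "closed D"
    unfolding D_def using contP K(1) by (intro closed_vimage) (auto simp: compact_imp_closed continuous_on_eq_continuous_at)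
  then have D: "compact D"
    using compact_Int_closed[OF compact_UNIV_bits] by simp
  have "P ` D = K"
  proof (intro equalityI subsetI)
    fix x assume x: "x \<in> K"
    then have "\<exists>b. digit_sum (1/2) b = x m" for m
      using K(2) digit_sum_surj by metis
    then obtain b where b: "\<And>m. digit_sum (1/2) (b m) = x m" by metis
    have "P (\<lambda>n. case prod_decode n of (m, i) \<Rightarrow> b m i) = x"
      by (auto simp: P_def b)
    then show "x \<in> P ` D" using x by (auto simp: D_def)
  qed (auto simp: D_def)
  let ?E = "digit_sum (1/3)"
  have contE: "continuous_on D ?E"
    by (rule continuous_on_subset[OF continuous_on_digit_sum]) auto
  show ?thesis
  proof (rule that)
    show "compact (?E ` D)" by (rule compact_continuous_image[OF contE D])
    show "continuous_on (?E ` D) (P \<circ> inv_into UNIV ?E)"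
    proof (rule continuous_on_compose)
      show "continuous_on (?E ` D) (inv_into UNIV ?E)"
        by (rule continuous_on_inv[OF contE D]) (simp add: inj_digit_sum inv_f_f)
      show "continuous_on (inv_into UNIV ?E ` ?E ` D) P"
        by (rule continuous_on_subset[OF contP]) auto
    qed
    show "(P \<circ> inv_into UNIV ?E) ` (?E ` D) = K"
      using \<open>P ` D = K\<close> by (simp add: image_comp o_def inv_f_f[OF inj_digit_sum])
  qed
qed

section \<open>Borel probability measures on compact sets\<close>

lemma sets_borel_sigma: "sets (borel_sigma (top_of_set K)) = sets (restrict_space borel K)"
proof -
  have "sets (borel_sigma (top_of_set K)) = sigma_sets K ((\<inter>) K ` {U. open U})"
    unfolding borel_sigma_def by (subst sets_measure_of) (auto simp: openin_open image_def intro!: arg_cong2[where f=sigma_sets])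
  also have "\<dots> = {A \<inter> K |A. A \<in> sigma_sets UNIV {U. open U}}"
    using sigma_sets_vimage_commute[of id K UNIV "{U. open U}"]
    by (simp add: image_def Int_commute[of K] Setcompr_eq_image setcompr_eq_image)
  also have "\<dots> = sets (restrict_space borel K)"
    by (auto simp: sets_restrict_space borel_def)
  finally show ?thesis .
qed

lemma openin_sets_borel_sigma:
  "openin (top_of_set K) U \<Longrightarrow> U \<in> sets (borel_sigma (top_of_set K))"
  unfolding borel_sigma_def by (subst sets_measure_of) (auto dest: openin_imp_subset)

lemma space_borel_sigma: "space (borel_sigma (top_of_set K)) = K"
  unfolding borel_sigma_def by (subst space_measure_of) (auto dest: openin_imp_subset)

lemma measurable_borel_sigma:
  assumes "sets M = sets (borel_sigma (top_of_set K))" "continuous_on K f"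
  shows "f \<in> borel_measurable M"
  using borel_measurable_continuous_on_restrict[OF assms(2)] assms(1)
  by (metis measurable_cong_sets sets_borel_sigma)


text \<open>The indicator of a closed set is the bounded pointwise limit of the functions
  \<open>1 - n * infdist x A\<close>, cut off at 0. This settles closed sets, hence relatively open
  ones by complement, and these generate the sigma-algebra and are stable under
  intersection.\<close>

lemma measure_eq_if_continuous_integrals_eq:
  fixes K :: "'a::metric_space set"
  assumes K: "compact K"
    and M: "prob_space M" "sets M = sets (borel_sigma (top_of_set K))"
    and N: "prob_space N" "sets N = sets (borel_sigma (top_of_set K))"
    and eq: "\<And>g :: 'a \<Rightarrow> real. continuous_on K g \<Longrightarrow> (\<integral>x. g x \<partial>M) = (\<integral>x. g x \<partial>N)"
  shows "M = N"
proof -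
  interpret M: prob_space M by fact
  interpret N: prob_space N by fact
  have sp: "space M = K" "space N = K"
    using sets_eq_imp_space_eq[OF M(2)] sets_eq_imp_space_eq[OF N(2)] space_borel_sigma by auto
  have closed_eq: "measure M A = measure N A" if A: "closed A" "A \<subseteq> K" for A
  proof (cases "A = {}")
    case False
    define g where "g n x = max 0 (1 - real n * infdist x A)" for n and x :: 'a
    have cont: "continuous_on K (g n)" for n
      unfolding g_def by (intro continuous_intros)
    have Aset: "A \<in> sets (borel_sigma (top_of_set K))"
      unfolding sets_borel_sigma sets_restrict_space using A by (intro image_eqI[of _ _ A]) auto
    have lim: "(\<lambda>n. g n x) \<longlonglongrightarrow> indicator A x" for x
    proof (cases "x \<in> A")
      case True
      then show ?thesis using False by (simp add: g_def)
    next
      case out: False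
      then have pos: "infdist x A > 0"
        using in_closed_iff_infdist_zero[OF A(1) False] infdist_nonneg[of x A] by (metis less_eq_real_def)
      obtain n0 :: nat where n0: "1 < real n0 * infdist x A"
        using reals_Archimedean3[OF pos] by blast
      have "\<forall>\<^sub>F n in sequentially. g n x = indicator A x"
        unfolding eventually_sequentially
      proof (intro exI allI impI)
        fix n assume "n0 \<le> n"
        then have "real n0 * infdist x A \<le> real n * infdist x A"
          using pos by (intro mult_right_mono) auto
        with n0 out show "g n x = indicator A x" by (simp add: g_def)
      qed
      then show ?thesis by (rule tendsto_eventually)
    qed
    have lim_meas: "(\<lambda>n. \<integral>x. g n x \<partial>P) \<longlonglongrightarrow> measure P A"
      if P: "prob_space P" "sets P = sets (borel_sigma (top_of_set K))" for P
    proof -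
      interpret P: prob_space P by fact
      have "(\<lambda>n. \<integral>x. g n x \<partial>P) \<longlonglongrightarrow> (\<integral>x. indicator A x \<partial>P)"
      proof (rule integral_dominated_convergence[where w = "\<lambda>_. 1"])
        show "(\<lambda>x. indicator A x :: real) \<in> borel_measurable P" using Aset P(2) by simp
        show "g n \<in> borel_measurable P" for n by (rule measurable_borel_sigma[OF P(2) cont])
        show "AE x in P. norm (g n x) \<le> 1" for n
          by (auto simp: g_def infdist_nonneg)
      qed (use lim in auto)
      then show ?thesis using Aset P(2) by simp
    qed
    show ?thesis
      using LIMSEQ_unique[OF lim_meas[OF M] lim_meas[OF N, folded eq[OF cont]]] .
  qed simp
  show "M = N"
  proof (rule measure_eqI_generator_eq[where \<Omega> = K and E = "{U. openin (top_of_set K) U}" and A = "\<lambda>_. K"])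
    show "Int_stable {U. openin (top_of_set K) U}"
      by (auto simp: Int_stable_def)
    show "sets M = sigma_sets K {U. openin (top_of_set K) U}" "sets N = sigma_sets K {U. openin (top_of_set K) U}"
      unfolding M N borel_sigma_def by (subst sets_measure_of; auto dest: openin_imp_subset)+
    fix U assume U: "U \<in> {U. openin (top_of_set K) U}"
    then have Us: "U \<in> sets M" "U \<in> sets N"
      unfolding M N borel_sigma_def by (subst sets_measure_of; auto dest: openin_imp_subset intro: sigma_sets.Basic)+
    have "closedin (top_of_set K) (K - U)"
      using U by (simp add: closedin_diff)
    then have "closed (K - U)"
      using K closedin_closed_trans compact_imp_closed by blast
    then have "measure M (K - U) = measure N (K - U)"
      by (intro closed_eq) auto
    then have "measure M U = measure N U"
      using M.prob_compl[OF Us(1)] N.prob_compl[OF Us(2)] sp by simp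
    then show "emeasure M U = emeasure N U"
      by (simp add: M.emeasure_eq_measure N.emeasure_eq_measure)
  qed (auto dest: openin_imp_subset)
qed

lemma measurable_continuous_self:
  assumes "sets M = sets (borel_sigma (top_of_set K))" "continuous_on K T" "T ` K \<subseteq> K"
  shows "T \<in> measurable M M"
proof -
  have sp: "space M = K" using sets_eq_imp_space_eq[OF assms(1)] space_borel_sigma by auto
  have "T \<in> measurable M (borel_sigma (top_of_set K))"
    unfolding borel_sigma_def
  proof (rule measurable_measure_of)
    fix U assume "U \<in> {U. openin (top_of_set K) U}"
    then have "openin (top_of_set K) (K \<inter> T -` U)"
      using continuous_openin_preimage[OF assms(2)] assms(3) by blast
    then show "T -` U \<inter> space M \<in> sets M"
      unfolding sp assms(1) Int_commute[of _ K] by (rule openin_sets_borel_sigma)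
  qed (use assms(3) in \<open>auto simp: sp dest: openin_imp_subset\<close>)
  then show ?thesis using measurable_cong_sets[OF refl assms(1)] by blast
qed

text \<open>Empirical measures of the orbit segments are lifted along \<open>p\<close> to the line,
  where boundedness of \<open>C\<close> gives tightness and Helly's theorem a weak limit
  \<open>M\<close>; \<open>\<mu>\<close> is its image under \<open>p\<close>. Invariance: replacing
  \<open>f\<close> by \<open>f \<circ> T\<close> changes an average over \<open>N j\<close> terms by
  at most \<open>2 * B / N j\<close>.\<close>

theorem krylov_bogoliubov:
  fixes K :: "(nat \<Rightarrow> real) set" and T :: "(nat \<Rightarrow> real) \<Rightarrow> nat \<Rightarrow> real"
  assumes K: "compact K" "\<And>x i. x \<in> K \<Longrightarrow> 0 \<le> x i \<and> x i \<le> 1"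
    and T: "continuous_on K T" "T ` K \<subseteq> K"
    and x: "\<And>j. x j \<in> K"
    and N: "filterlim N at_top sequentially"
    and h: "continuous_on K h" "\<And>j. (\<Sum>k<N j. h ((T ^^ k) (x j))) \<ge> c * real (N j)"
  obtains \<mu> where "\<mu> \<in> invariant_probs (top_of_set K) T" "integrable \<mu> h" "(\<integral>x. h x \<partial>\<mu>) \<ge> c"
proof -
  let ?B = "borel_sigma (top_of_set K)"
  have orbit: "(T ^^ k) (x j) \<in> K" for k j
    by (induction k) (use x T(2) in auto)
  obtain C :: "real set" and p where C: "compact C" "continuous_on C p" "p ` C = K"
    by (rule compact_cube_subset_image_of_real[of K]) (use K in blast)+
  have "\<exists>t\<in>C. p t = (T ^^ k) (x j)" for k j
    using orbit C(3) by (metis imageE)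
  then have ex: "\<exists>s. s \<in> C \<and> p s = (T ^^ k) (x j)" for k j by blast
  define t where "t j k = (SOME s. s \<in> C \<and> p s = (T ^^ k) (x j))" for j k
  have t: "t j k \<in> C" "p (t j k) = (T ^^ k) (x j)" for j k
    using someI_ex[OF ex[of k j]] by (auto simp: t_def)
  \<comment> \<open>Early indices are dropped because a uniform distribution needs a non-empty orbit
    segment.\<close>
  obtain j0 where j0: "\<And>j. j \<ge> j0 \<Longrightarrow> N j \<ge> 1"
    using N unfolding filterlim_at_top eventually_sequentially by blast
  define \<nu> where "\<nu> j = distr (measure_pmf (pmf_of_set {..<N (j0 + j)})) borel (t (j0 + j))" for j
  have Npos: "{..<N (j0 + j)} \<noteq> {}" for j
    using j0[of "j0 + j"] by (metis One_nat_def Suc_le_lessD empty_iff le_add1 lessThan_iff)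
  have \<nu>: "real_distribution (\<nu> j)" for j
    unfolding \<nu>_def real_distribution_def real_distribution_axioms_def
    by (auto intro!: prob_space.prob_space_distr measure_pmf.prob_space_axioms)
  have int_\<nu>: "(\<integral>s. F s \<partial>\<nu> j) = (\<Sum>k<N (j0 + j). F (t (j0 + j) k)) / real (N (j0 + j))"
    if "continuous_on UNIV F" for F :: "real \<Rightarrow> real" and j
  proof -
    have "F \<in> borel_measurable borel" using that by (rule borel_measurable_continuous_onI)
    then show ?thesis
      unfolding \<nu>_def by (subst integral_distr) (auto simp: integral_pmf_of_set Npos)
  qed
  obtain R where R: "R > 0" "\<And>s. s \<in> C \<Longrightarrow> \<bar>s\<bar> < R"
    using compact_imp_bounded[OF C(1)] unfolding bounded_pos_less by (metis real_norm_def)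
  have "tight \<nu>"
    unfolding tight_def
  proof (intro conjI allI impI \<nu>)
    fix e :: real assume "e > 0"
    have "measure (\<nu> j) {-R<..R} = 1" for j
    proof -
      have "- R < t (j0 + j) k \<and> t (j0 + j) k \<le> R" for k
        using R(2)[OF t(1)[of "j0 + j" k]] by linarith
      then have "t (j0 + j) -` {-R<..R} = UNIV" by auto
      then show ?thesis
        unfolding \<nu>_def by (simp add: measure_distr)
    qed
    then show "\<exists>a b. a < b \<and> (\<forall>n. 1 - e < measure (\<nu> n) {a<..b})"
      using R(1) \<open>e > 0\<close> by (intro exI[of _ "-R"] exI[of _ R]) auto
  qed
  from tight_imp_convergent_subsubsequence[OF this strict_mono_id]
  obtain r M where r: "strict_mono r" and M: "real_distribution M" and conv: "weak_conv_m (\<nu> \<circ> id \<circ> r) M"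
    by blast
  interpret M: real_distribution M by fact
  define avg where "avg f j = (\<Sum>k<N (j0 + r j). f ((T ^^ k) (x (j0 + r j)))) / real (N (j0 + r j))" for f and j
  have lim0: "(\<lambda>j. \<integral>s. F s \<partial>\<nu> (r j)) \<longlonglongrightarrow> (\<integral>s. F s \<partial>M)"
    if "continuous_on UNIV F" "\<And>s. \<bar>F s\<bar> \<le> B" for F :: "real \<Rightarrow> real" and B
  proof -
    have "(\<lambda>j. \<integral>s. F s \<partial>(\<nu> \<circ> id \<circ> r) j) \<longlonglongrightarrow> (\<integral>s. F s \<partial>M)"
      by (rule weak_conv_imp_integral_bdd_continuous_conv[where B = B])
         (use that \<nu> M conv in \<open>auto simp: continuous_on_eq_continuous_at o_def\<close>)
    then show ?thesis by simp
  qed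
  have "C \<noteq> {}" using t(1) by auto
  have "AE s in M. s \<in> C"
  proof -
    \<comment> \<open>All lifted points lie in \<open>C\<close>, where this bounded continuous
      function vanishes; so does its integral in the limit, and the closed set \<open>C\<close>
      carries \<open>M\<close>.\<close>
    define F where "F s = min 1 (infdist s C)" for s :: real
    have F: "continuous_on UNIV F" "\<bar>F s\<bar> \<le> 1" "F s \<ge> 0" for s
      unfolding F_def by (intro continuous_intros) (auto simp: infdist_nonneg)
    have "(\<lambda>j. \<integral>s. F s \<partial>\<nu> (r j)) = (\<lambda>j. 0)"
      by (subst int_\<nu>[OF F(1)]) (auto simp: F_def t)
    with lim0[OF F(1,2)] have "(\<integral>s. F s \<partial>M) = 0"
      by (metis LIMSEQ_unique tendsto_const)
    moreover have "F \<in> borel_measurable M"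
      using borel_measurable_continuous_onI[OF F(1)] by simp
    moreover from this have "integrable M F"
      by (intro M.integrable_const_bound[where B = 1]) (use F(2) in auto)
    ultimately have "AE s in M. F s = 0"
      using F(3) by (subst integral_nonneg_eq_0_iff_AE[symmetric]) auto
    then show ?thesis
    proof (rule AE_mp, intro AE_I2 impI)
      fix s assume "F s = 0"
      then have "infdist s C = 0" unfolding F_def by linarith
      then show "s \<in> C"
        using in_closed_iff_infdist_zero[OF compact_imp_closed[OF C(1)] \<open>C \<noteq> {}\<close>] by simp
    qed
  qed
  \<comment> \<open>The value \<open>x 0\<close> off \<open>C\<close> makes the map total with
    values in \<open>K\<close>; it is taken only on a null set of \<open>M\<close>.\<close>
  define p' where "p' s = (if s \<in> C then p s else x 0)" for s
  have meas: "p' \<in> measurable M ?B"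
    unfolding borel_sigma_def
  proof (rule measurable_measure_of)
    fix U assume "U \<in> {U. openin (top_of_set K) U}"
    then have "openin (top_of_set C) (C \<inter> p -` U)"
      using continuous_openin_preimage_gen C(2,3) by (metis (no_types) continuous_openin_preimage image_subset_iff_funcset mem_Collect_eq order_refl)
    then have "C \<inter> p -` U \<in> sets borel"
      using C(1) by (auto simp: openin_open compact_imp_closed)
    moreover have "p' -` U = (C \<inter> p -` U) \<union> (if x 0 \<in> U then - C else {})"
      by (auto simp: p'_def split: if_splits)
    ultimately show "p' -` U \<inter> space M \<in> sets M"
      using C(1) compact_imp_closed[of C] by auto
  qed (use x C(3) in \<open>auto simp: p'_def dest: openin_imp_subset\<close>)
  define \<mu> where "\<mu> = distr M ?B p'"
  have sets\<mu>: "sets \<mu> = sets ?B" by (simp add: \<mu>_def)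
  have prob: "prob_space \<mu>" unfolding \<mu>_def by (rule M.prob_space_distr[OF meas])
  interpret \<mu>: prob_space \<mu> by (rule prob)
  have sp: "space \<mu> = K" using sets_eq_imp_space_eq[OF sets\<mu>] space_borel_sigma by auto
  have bound: "\<exists>B. \<forall>y\<in>K. \<bar>f y\<bar> \<le> B" if "continuous_on K f" for f :: "(nat \<Rightarrow> real) \<Rightarrow> real"
    using compact_imp_bounded[OF compact_continuous_image[OF that K(1)]] by (auto simp: bounded_iff)
  have int: "integrable \<mu> f" if f: "continuous_on K f" for f :: "(nat \<Rightarrow> real) \<Rightarrow> real"
  proof -
    obtain B where "\<forall>y\<in>K. \<bar>f y\<bar> \<le> B" using bound[OF f] by blast
    then show ?thesis
      using measurable_borel_sigma[OF sets\<mu> f] by (intro \<mu>.integrable_const_bound[where B = B]) (auto simp: sp)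
  qed
  have lim: "avg f \<longlonglongrightarrow> (\<integral>y. f y \<partial>\<mu>)" if f: "continuous_on K f" for f
  proof -
    obtain B where B: "\<forall>y\<in>K. \<bar>f y\<bar> \<le> B" using bound[OF f] by blast
    \<comment> \<open>Weak convergence tests functions on the whole line, whereas
      \<open>f \<circ> p\<close> is given on \<open>C\<close> only; Tietze extends it with the same
      bound.\<close>
    have "continuous_on C (\<lambda>s. f (p s))"
      by (rule continuous_on_compose2[OF f C(2)]) (simp add: C(3))
    moreover have "closedin (top_of_set UNIV) C" using C(1) compact_imp_closed by simp
    moreover have "0 \<le> B" using B x[of 0] by force
    moreover have "norm (f (p s)) \<le> B" if "s \<in> C" for s using B C(3) that by auto
    ultimately obtain F where F: "continuous_on UNIV F" "\<And>s. s \<in> C \<Longrightarrow> F s = f (p s)" "\<And>s. \<bar>F s\<bar> \<le> B"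
      by (rule Tietze) auto
    have "avg f = (\<lambda>j. \<integral>s. F s \<partial>\<nu> (r j))"
      unfolding avg_def by (subst int_\<nu>[OF F(1)]) (simp add: F(2) t)
    moreover have "(\<integral>y. f y \<partial>\<mu>) = (\<integral>s. F s \<partial>M)"
    proof -
      have "(\<integral>y. f y \<partial>\<mu>) = (\<integral>s. f (p' s) \<partial>M)"
        unfolding \<mu>_def using measurable_borel_sigma[OF refl f] by (rule integral_distr[OF meas])
      also have "\<dots> = (\<integral>s. F s \<partial>M)"
      proof (rule integral_cong_AE)
        show "(\<lambda>s. f (p' s)) \<in> borel_measurable M"
          using measurable_compose[OF meas measurable_borel_sigma[OF refl f]] .
        show "F \<in> borel_measurable M" using borel_measurable_continuous_onI[OF F(1)] by simp
        show "AE s in M. f (p' s) = F s"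
          using \<open>AE s in M. s \<in> C\<close> by eventually_elim (simp add: p'_def F(2))
      qed
      finally show ?thesis .
    qed
    ultimately show ?thesis using lim0[OF F(1,3)] by simp
  qed
  note measT = measurable_continuous_self[OF sets\<mu> T]
  have Ninf: "filterlim (\<lambda>j. real (N (j0 + r j))) at_top sequentially"
  proof -
    have "filterlim (\<lambda>j. j0 + r j) sequentially sequentially"
      by (rule filterlim_subseq) (use r in \<open>auto simp: strict_mono_def\<close>)
    from filterlim_compose[OF N this] show ?thesis
      by (rule filterlim_compose[OF filterlim_real_sequentially])
  qed
  have inv: "(\<integral>y. f (T y) \<partial>\<mu>) = (\<integral>y. f y \<partial>\<mu>)" if f: "continuous_on K f" for f :: "(nat \<Rightarrow> real) \<Rightarrow> real"
  proof -
    obtain B where B: "\<And>y. y \<in> K \<Longrightarrow> \<bar>f y\<bar> \<le> B" using bound[OF f] by blast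
    have fT: "continuous_on K (\<lambda>y. f (T y))"
      by (rule continuous_on_compose2[OF f T])
    have diff: "avg (\<lambda>y. f (T y)) j - avg f j
        = (f ((T ^^ N (j0 + r j)) (x (j0 + r j))) - f (x (j0 + r j))) / real (N (j0 + r j))" for j
    proof -
      have "(\<Sum>k<n. f (T ((T ^^ k) y))) - (\<Sum>k<n. f ((T ^^ k) y)) = f ((T ^^ n) y) - f y" for n y
        by (induction n) auto
      then show ?thesis by (simp add: avg_def flip: diff_divide_distrib)
    qed
    have "(\<lambda>j. avg (\<lambda>y. f (T y)) j - avg f j) \<longlonglongrightarrow> 0"
    proof (rule Lim_null_comparison)
      show "\<forall>\<^sub>F j in sequentially. norm (avg (\<lambda>y. f (T y)) j - avg f j) \<le> (2 * B) / real (N (j0 + r j))"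
      proof (intro always_eventually allI)
        fix j
        have "\<bar>f ((T ^^ N (j0 + r j)) (x (j0 + r j))) - f (x (j0 + r j))\<bar> \<le> 2 * B"
          using B[OF orbit[of "N (j0 + r j)" "j0 + r j"]] B[OF x[of "j0 + r j"]] by linarith
        then show "norm (avg (\<lambda>y. f (T y)) j - avg f j) \<le> (2 * B) / real (N (j0 + r j))"
          unfolding diff by (simp add: abs_divide divide_right_mono)
      qed
      show "(\<lambda>j. (2 * B) / real (N (j0 + r j))) \<longlonglongrightarrow> 0"
        by (rule tendsto_divide_0[OF tendsto_const filterlim_at_top_imp_at_infinity[OF Ninf]])
    qed
    moreover have "(\<lambda>j. avg (\<lambda>y. f (T y)) j - avg f j) \<longlonglongrightarrow> (\<integral>y. f (T y) \<partial>\<mu>) - (\<integral>y. f y \<partial>\<mu>)"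
      by (intro tendsto_diff lim f fT)
    ultimately show ?thesis using LIMSEQ_unique by fastforce
  qed
  have "distr \<mu> \<mu> T = \<mu>"
  proof (rule measure_eq_if_continuous_integrals_eq[OF K(1)])
    show "prob_space (distr \<mu> \<mu> T)" by (rule \<mu>.prob_space_distr[OF measT])
    fix g :: "(nat \<Rightarrow> real) \<Rightarrow> real" assume g: "continuous_on K g"
    have "(\<integral>y. g y \<partial>distr \<mu> \<mu> T) = (\<integral>y. g (T y) \<partial>\<mu>)"
      using measurable_borel_sigma[OF sets\<mu> g] by (rule integral_distr[OF measT])
    then show "(\<integral>y. g y \<partial>distr \<mu> \<mu> T) = (\<integral>y. g y \<partial>\<mu>)" using inv[OF g] by simp
  qed (use prob sets\<mu> in simp_all)
  then have "\<mu> \<in> invariant_probs (top_of_set K) T"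
    unfolding invariant_probs_def using prob sets\<mu> by blast
  moreover have "c \<le> (\<integral>y. h y \<partial>\<mu>)"
  proof (rule LIMSEQ_le_const[OF lim[OF h(1)]], intro exI allI impI)
    fix j
    have "N (j0 + r j) > 0" using j0[of "j0 + r j"] by simp
    then show "c \<le> avg h j"
      using h(2)[of "j0 + r j"] by (simp add: avg_def pos_le_divide_eq)
  qed
  ultimately show ?thesis using that int[OF h(1)] by blast
qed

section \<open>Covers of small order\<close>

text \<open>The sets of layer s consist of points having exactly s coordinates within a s of an integer and no
  coordinate at distance exactly a s. Sets of one layer are disjoint. As the thresholds a s increase,
  the least s such that at most s coordinates are within a s of an integer is the layer of a point.\<close>

lemma layered_cover:
  fixes u :: "'p \<Rightarrow> 'a::topological_space \<Rightarrow> real"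
  assumes P: "finite P" and cont: "\<And>p. p \<in> P \<Longrightarrow> continuous_on K (u p)"
    and bound: "\<And>p x. p \<in> P \<Longrightarrow> x \<in> K \<Longrightarrow> \<bar>u p x\<bar> \<le> B"
    and r: "0 < r"
  obtains \<V> where "finite \<V>" "\<And>V. V \<in> \<V> \<Longrightarrow> openin (top_of_set K) V" "\<Union>\<V> = K"
    "\<And>V x y p. V \<in> \<V> \<Longrightarrow> x \<in> V \<Longrightarrow> y \<in> V \<Longrightarrow> p \<in> P \<Longrightarrow> \<bar>u p x - u p y\<bar> < 1"
    "\<And>x. x \<in> K \<Longrightarrow> card {V \<in> \<V>. x \<in> V} \<le> Suc (card {p \<in> P. \<exists>m::int. \<bar>u p x - of_int m\<bar> < r})"
proof -
  define M where "M = card P"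
  \<comment> \<open>Positive, strictly increasing in \<open>s\<close>, and below both
    \<open>r\<close> and \<open>1/2\<close> for \<open>s \<le> M\<close>. Below \<open>1/2\<close>,
    at most one integer lies within distance \<open>a s\<close> of a number.\<close>
  define a where "a s = min r 1 * (real s + 1) / (2 * (real M + 2))" for s
  have a_mono: "a s < a t" if "s < t" for s t
    unfolding a_def using r that by (intro divide_strict_right_mono mult_strict_left_mono) auto
  have a_pos: "0 < a s" for s
    unfolding a_def using r by (intro divide_pos_pos mult_pos_pos) auto
  have a_less: "a s < r" "a s < 1/2" if "s \<le> M" for s
  proof -
    have "(real s + 1) / (2 * (real M + 2)) < 1 / 2"
      using that by (simp add: divide_simps)
    then have "min r 1 * ((real s + 1) / (2 * (real M + 2))) < min r 1 * (1 / 2)"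
      using r by (intro mult_strict_left_mono) auto
    then have "a s < min r 1 / 2" unfolding a_def by simp
    then show "a s < r" "a s < 1/2" using r by (auto simp: min_def split: if_splits)
  qed
  define near where "near s x = {p \<in> P. \<exists>m::int. \<bar>u p x - of_int m\<bar> < a s}" for s x
  define near' where "near' s x = {p \<in> P. \<exists>m::int. \<bar>u p x - of_int m\<bar> \<le> a s}" for s x
  \<comment> \<open>A label holds the floors of \<open>u p x + a s\<close> and
    \<open>u p x - a s\<close>. They differ exactly when an integer is near, and the strict
    inequalities make the set open and the label a function of \<open>s\<close> and
    \<open>x\<close>.\<close>
  define V where "V = (\<lambda>(s, l). {x \<in> K. \<forall>p\<in>P. of_int (fst (l p)) < u p x + a s \<and> u p x + a s < of_int (fst (l p)) + 1 \<and>
      of_int (snd (l p)) < u p x - a s \<and> u p x - a s < of_int (snd (l p)) + 1})"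
  let ?A = "{- \<lceil>\<bar>B\<bar>\<rceil> - 2 .. \<lceil>\<bar>B\<bar>\<rceil> + 2}"
  define L where "L = {l :: 'p \<Rightarrow> int \<times> int. \<forall>p. (p \<in> P \<longrightarrow> l p \<in> ?A \<times> ?A) \<and> (p \<notin> P \<longrightarrow> l p = (0, 0))}"
  define I where "I = {(s, l). s \<le> M \<and> l \<in> L \<and> s = card {p \<in> P. fst (l p) \<noteq> snd (l p)}}"
  have "finite L" unfolding L_def by (intro finite_set_of_finite_funs P finite_cartesian_product) auto
  then have "finite I" by (rule_tac finite_subset[of _ "{..M} \<times> L"]) (auto simp: I_def)
  show ?thesis
  proof (rule that[of "V ` I"])
    show "finite (V ` I)" using \<open>finite I\<close> by simp
    show "openin (top_of_set K) W" if "W \<in> V ` I" for W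
    proof -
      from that obtain i where "W = V i" by blast
      then obtain s l where W: "W = V (s, l)" by (cases i) blast
      let ?J = "\<lambda>p. {of_int (fst (l p)) - a s <..< of_int (fst (l p)) + 1 - a s} \<inter>
          {of_int (snd (l p)) + a s <..< of_int (snd (l p)) + 1 + a s}"
      have "openin (top_of_set K) (K \<inter> (\<Inter>p\<in>P. {x \<in> K. u p x \<in> ?J p}))"
      proof (cases "P = {}")
        case False
        have "openin (top_of_set K) (K \<inter> u p -` ?J p)" if "p \<in> P" for p
          using cont[OF that] by (intro continuous_openin_preimage_gen) auto
        then show ?thesis
          by (intro openin_Int openin_INT2 P False) (auto simp: vimage_def Int_def)
      qed auto
      also have "K \<inter> (\<Inter>p\<in>P. {x \<in> K. u p x \<in> ?J p}) = W"
        unfolding W V_def by (auto simp: algebra_simps)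
      finally show ?thesis .
    qed
    show "\<Union> (V ` I) = K"
    proof (intro equalityI subsetI)
      fix x assume x: "x \<in> K"
      \<comment> \<open>Minimality gives more than \<open>s - 1\<close> coordinates within the
        previous threshold, all of them strictly within \<open>a s\<close>, while at most
        \<open>s\<close> are weakly within \<open>a s\<close>. So \<open>near s x\<close> and
        \<open>near' s x\<close> coincide: exactly \<open>s\<close> coordinates are near and none is
        at distance exactly \<open>a s\<close>.\<close>
      define s where "s = (LEAST s. card (near' s x) \<le> s)"
      have "card (near' M x) \<le> M"
        unfolding near'_def M_def by (intro card_mono P) auto
      then have s: "card (near' s x) \<le> s" "s \<le> M"
        unfolding s_def by (auto intro: LeastI Least_le)
      have sub: "near s x \<subseteq> near' s x"
        unfolding near_def near'_def by (auto intro: less_imp_le)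
      have fin: "finite (near t x)" "finite (near' t x)" for t
        unfolding near_def near'_def using P by auto
      have "s \<le> card (near s x)"
      proof (cases s)
        case (Suc t)
        have "\<not> card (near' t x) \<le> t"
          using not_less_Least[of t "\<lambda>s. card (near' s x) \<le> s"] Suc s_def by simp
        moreover have "near' t x \<subseteq> near s x"
        proof -
          have "a t < a s" using a_mono[of t s] Suc by simp
          then show ?thesis unfolding near_def near'_def by (auto intro: le_less_trans)
        qed
        then have "card (near' t x) \<le> card (near s x)" by (intro card_mono fin)
        ultimately show ?thesis using Suc by simp
      qed simp
      then have eq: "near s x = near' s x" and card: "card (near s x) = s"
        using card_seteq[OF fin(2) sub] s(1) card_mono[OF fin(2) sub] by auto
      define l where "l p = (if p \<in> P then (\<lfloor>u p x + a s\<rfloor>, \<lfloor>u p x - a s\<rfloor>) else (0, 0))" for p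
      have noedge: "\<bar>u p x - of_int m\<bar> \<noteq> a s" if "p \<in> P" for p m
      proof
        assume e: "\<bar>u p x - of_int m\<bar> = a s"
        then have "p \<in> near' s x" using that by (auto simp: near'_def intro!: exI[of _ m])
        then obtain m' :: int where m': "\<bar>u p x - of_int m'\<bar> < a s"
          unfolding eq[symmetric] near_def by auto
        then have "\<bar>of_int m - of_int m' :: real\<bar> < 1" using e a_less(2)[OF s(2)] by linarith
        then have "m = m'" by linarith
        with e m' show False by simp
      qed
      have xV: "x \<in> V (s, l)"
      proof -
        have "of_int \<lfloor>u p x + a s\<rfloor> \<noteq> u p x + a s" "of_int \<lfloor>u p x - a s\<rfloor> \<noteq> u p x - a s" if "p \<in> P" for p
          using noedge[OF that, of "\<lfloor>u p x + a s\<rfloor>"] noedge[OF that, of "\<lfloor>u p x - a s\<rfloor>"] a_pos[of s] by auto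
        moreover have "of_int \<lfloor>z\<rfloor> \<le> z" "z < of_int \<lfloor>z\<rfloor> + 1" for z :: real
          by linarith+
        ultimately show ?thesis unfolding V_def using x by (auto simp: l_def less_le)
      qed
      have "{p \<in> P. fst (l p) \<noteq> snd (l p)} = near s x"
      proof (intro equalityI subsetI)
        fix p assume "p \<in> {p \<in> P. fst (l p) \<noteq> snd (l p)}"
        then have p: "p \<in> P" "\<lfloor>u p x + a s\<rfloor> \<noteq> \<lfloor>u p x - a s\<rfloor>" by (auto simp: l_def)
        moreover have "\<lfloor>u p x - a s\<rfloor> \<le> \<lfloor>u p x + a s\<rfloor>" using a_pos[of s] by (intro floor_mono) auto
        ultimately have "\<lfloor>u p x - a s\<rfloor> + 1 \<le> \<lfloor>u p x + a s\<rfloor>" by linarith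
        then have "\<bar>u p x - of_int \<lfloor>u p x + a s\<rfloor>\<bar> \<le> a s" by linarith
        then have "p \<in> near' s x" using p(1) unfolding near'_def by blast
        then show "p \<in> near s x" using eq by simp
      next
        fix p assume "p \<in> near s x"
        then obtain m :: int where "p \<in> P" "\<bar>u p x - of_int m\<bar> < a s" by (auto simp: near_def)
        moreover from this have "\<lfloor>u p x - a s\<rfloor> < m" "m \<le> \<lfloor>u p x + a s\<rfloor>" by linarith+
        ultimately show "p \<in> {p \<in> P. fst (l p) \<noteq> snd (l p)}" by (auto simp: l_def)
      qed
      moreover have "l \<in> L"
      proof -
        have "\<lfloor>u p x + a s\<rfloor> \<in> ?A \<and> \<lfloor>u p x - a s\<rfloor> \<in> ?A" if "p \<in> P" for p
          using bound[OF that x] a_less(2)[OF s(2)] a_pos[of s] unfolding atLeastAtMost_iff by linarith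
        then show ?thesis by (auto simp: L_def l_def)
      qed
      ultimately have "(s, l) \<in> I" using s card by (auto simp: I_def)
      with xV show "x \<in> \<Union> (V ` I)" by blast
    qed (auto simp: V_def)
    show "\<bar>u p x - u p y\<bar> < 1" if "W \<in> V ` I" "x \<in> W" "y \<in> W" "p \<in> P" for W x y p
    proof -
      from that(1) obtain i where "W = V i" by blast
      then obtain s l where W: "W = V (s, l)" by (cases i) blast
      from that(2-4) show ?thesis unfolding W V_def by (auto dest!: bspec[of P _ p])
    qed
    show "card {W \<in> V ` I. x \<in> W} \<le> Suc (card {p \<in> P. \<exists>m::int. \<bar>u p x - of_int m\<bar> < r})" if x: "x \<in> K" for x
    proof -
      let ?m = "card {p \<in> P. \<exists>m::int. \<bar>u p x - of_int m\<bar> < r}"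
      define lab where "lab s p = (if p \<in> P then (\<lfloor>u p x + a s\<rfloor>, \<lfloor>u p x - a s\<rfloor>) else (0, 0))" for s p
      \<comment> \<open>A layer contributes at most one set, as \<open>x\<close> and
        \<open>s\<close> fix the label, and layer \<open>s\<close> requires \<open>s\<close>
        coordinates within \<open>a s < r\<close> of an integer. So the possible layers are 0 to
        \<open>?m\<close>.\<close>
      have "{W \<in> V ` I. x \<in> W} \<subseteq> (\<lambda>s. V (s, lab s)) ` {..?m}"
      proof
        fix W assume "W \<in> {W \<in> V ` I. x \<in> W}"
        then obtain s l where W: "W = V (s, l)" "x \<in> V (s, l)" and sl: "s \<le> M" "l \<in> L" "s = card {p \<in> P. fst (l p) \<noteq> snd (l p)}"
          by (auto simp: I_def)
        have xl: "of_int (fst (l p)) < u p x + a s" "u p x + a s < of_int (fst (l p)) + 1"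
           "of_int (snd (l p)) < u p x - a s" "u p x - a s < of_int (snd (l p)) + 1" if "p \<in> P" for p
          using W(2) that unfolding V_def by auto
        have "l p = lab s p" for p
        proof (cases "p \<in> P")
          case True
          have "\<lfloor>u p x + a s\<rfloor> = fst (l p)" "\<lfloor>u p x - a s\<rfloor> = snd (l p)"
            using xl[OF True] by linarith+
          then show ?thesis using True by (simp add: lab_def)
        qed (use sl in \<open>auto simp: L_def lab_def\<close>)
        then have "l = lab s" by blast
        moreover have "s \<le> ?m"
          unfolding sl(3)
        proof (rule card_mono)
          show "{p \<in> P. fst (l p) \<noteq> snd (l p)} \<subseteq> {p \<in> P. \<exists>m::int. \<bar>u p x - of_int m\<bar> < r}"
          proof safe
            fix p assume p: "p \<in> P" "fst (l p) \<noteq> snd (l p)"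
            then have "snd (l p) + 1 \<le> fst (l p)"
              using xl[OF p(1)] a_pos[of s] by linarith
            then have "\<bar>u p x - of_int (fst (l p))\<bar> < a s"
              using xl[OF p(1)] by linarith
            then show "\<exists>m::int. \<bar>u p x - of_int m\<bar> < r"
              using a_less(1)[OF sl(1)] by (intro exI[of _ "fst (l p)"]) linarith
          qed
        qed (use P in auto)
        ultimately show "W \<in> (\<lambda>s. V (s, lab s)) ` {..?m}" using W by auto
      qed
      then have "card {W \<in> V ` I. x \<in> W} \<le> card ((\<lambda>s. V (s, lab s)) ` {..?m})"
        by (intro card_mono) auto
      also have "\<dots> \<le> card {..?m}" by (rule card_image_le) simp
      finally show ?thesis by simp
    qed
  qed
qed

section \<open>Periodic skeletons\<close>

text \<open>The cone over a discrete set, its legs laid along the coordinate axes; the system reads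
  the three legs \<open>l < 3\<close>.\<close>

definition triod :: "(nat \<Rightarrow> real) \<Rightarrow> bool" where
  "triod y \<longleftrightarrow> (\<forall>l. 0 \<le> y l \<and> y l \<le> 1) \<and> (\<forall>l m. l \<noteq> m \<longrightarrow> y l = 0 \<or> y m = 0)"

abbreviation free_block :: "(int \<Rightarrow> nat \<Rightarrow> bool) \<Rightarrow> nat \<Rightarrow> (int \<times> nat) set" where
  "free_block F N \<equiv> {(k, i). 0 \<le> k \<and> k < int N \<and> F k i}"

text \<open>\<open>F k i\<close> says that coordinate \<open>i\<close> at time \<open>k\<close> is
  still free; otherwise it is frozen to \<open>\<sigma> k i\<close>. The last clause is the excess
  that will defeat an embedding.\<close>

definition skeleton :: "nat \<Rightarrow> nat \<Rightarrow> nat \<Rightarrow> (int \<Rightarrow> nat \<Rightarrow> bool) \<Rightarrow> (int \<Rightarrow> nat \<Rightarrow> nat \<Rightarrow> real) \<Rightarrow> bool" where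
  "skeleton n j N F \<sigma> \<longleftrightarrow> 0 < N \<and>
     (\<forall>k i. F k i \<longrightarrow> i < n) \<and>
     (\<forall>k i. F k i = F (k mod int N) i) \<and>
     (\<forall>k i. \<sigma> k i = \<sigma> (k mod int N) i) \<and>
     (\<forall>k i. triod (\<sigma> k i)) \<and>
     n * N + j + 1 \<le> 2 * card (free_block F N)"

text \<open>Words have length 2 N because a short window may straddle two consecutive blocks of length N.\<close>

abbreviation word_at :: "nat \<Rightarrow> nat \<Rightarrow> (int \<Rightarrow> nat \<Rightarrow> bool) \<Rightarrow> (int \<Rightarrow> nat \<Rightarrow> bool) \<Rightarrow>
    (int \<Rightarrow> nat \<Rightarrow> nat \<Rightarrow> real) \<Rightarrow> (int \<Rightarrow> nat \<Rightarrow> nat \<Rightarrow> real) \<Rightarrow> int \<Rightarrow> bool" where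
  "word_at j N F F' \<sigma>' w t \<equiv> int N dvd t \<and> (\<forall>k i. 0 \<le> k \<longrightarrow> k < 2 * int N \<longrightarrow> F k i \<longrightarrow>
        \<not> F' (k + t) i \<and> (\<forall>l<3. \<bar>\<sigma>' (k + t) i l - w k i l\<bar> \<le> 1 / real (Suc j)))"

text \<open>Keeping the first block intact protects its free positions at all later levels. The last
  clause bounds the density of free positions by \<open>n / 2 + 1 / (2 * (j + 1))\<close>. Words are
  inserted at multiples of \<open>N\<close>, so their frozen entries match the old skeleton.\<close>

definition skeleton_step :: "nat \<Rightarrow> nat \<Rightarrow> nat \<Rightarrow> (int \<Rightarrow> nat \<Rightarrow> bool) \<Rightarrow> (int \<Rightarrow> nat \<Rightarrow> nat \<Rightarrow> real) \<Rightarrow>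
    nat \<Rightarrow> (int \<Rightarrow> nat \<Rightarrow> bool) \<Rightarrow> (int \<Rightarrow> nat \<Rightarrow> nat \<Rightarrow> real) \<Rightarrow> bool" where
  "skeleton_step n j N F \<sigma> N' F' \<sigma>' \<longleftrightarrow> N dvd N' \<and> 2 * N \<le> N' \<and>
     (\<forall>k i. F' k i \<longrightarrow> F k i) \<and>
     (\<forall>k i. 0 \<le> k \<longrightarrow> k < int N \<longrightarrow> F' k i = F k i) \<and>
     (\<forall>k i. \<not> F k i \<longrightarrow> \<sigma>' k i = \<sigma> k i) \<and>
     (\<forall>w. (\<forall>k i. triod (w k i)) \<longrightarrow> (\<exists>t. word_at j N F F' \<sigma>' w t)) \<and>
     2 * card (free_block F' N') * Suc j \<le> (n * Suc j + 1) * N'"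

lemma finite_free_positions:
  fixes a b :: int
  assumes "\<And>k i. F k i \<Longrightarrow> i < n"
  shows "finite {(k, i). a \<le> k \<and> k < b \<and> F k (i::nat)}"
  by (rule finite_subset[of _ "{a..<b} \<times> {..<n}"]) (use assms in auto)

lemma card_free_positions_blocks:
  fixes F :: "int \<Rightarrow> nat \<Rightarrow> bool"
  assumes "0 < N" and F: "\<And>k i. F k i \<Longrightarrow> i < n" and per: "\<And>k i. F k i = F (k mod int N) i"
  shows "card (free_block F (m * N)) = m * card (free_block F N)"
proof (induction m)
  case 0
  have "{(k, i). 0 \<le> k \<and> k < int (0 * N) \<and> F k i} = {}" by auto
  then show ?case by (simp only: card.empty mult_0)
next
  case (Suc m)
  let ?S = "\<lambda>m. free_block F (m * N)"
  let ?C = "free_block F N"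
  let ?g = "\<lambda>(k, i). (k + int (m * N), i :: nat)"
  have shift: "F (k + int (m * N)) i = F k i" for k i
    using per[of "k + int (m * N)" i] per[of k i] by (simp add: mod_simps)
  have split: "?S (Suc m) = ?S m \<union> ?g ` ?C"
  proof (intro equalityI subsetI)
    fix x assume "x \<in> ?S (Suc m)"
    then obtain k i where x: "x = (k, i)" "0 \<le> k" "k < int (Suc m * N)" "F k i" by auto
    show "x \<in> ?S m \<union> ?g ` ?C"
    proof (cases "k < int (m * N)")
      case False
      have "x = ?g (k - int (m * N), i)" using x by simp
      moreover have "(k - int (m * N), i) \<in> ?C"
        using x False shift[of "k - int (m * N)" i] by (auto simp: algebra_simps)
      ultimately show ?thesis by blast
    qed (use x in auto)
  next
    fix x assume "x \<in> ?S m \<union> ?g ` ?C"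
    then show "x \<in> ?S (Suc m)"
      using shift by (auto simp: algebra_simps intro: less_le_trans)
  qed
  have "card (?S (Suc m)) = card (?S m) + card (?g ` ?C)"
    unfolding split by (intro card_Un_disjoint finite_free_positions finite_imageI) (use F in auto)
  also have "card (?g ` ?C) = card ?C"
    by (intro card_image) (auto simp: inj_on_def)
  finally show ?case using Suc by simp
qed

text \<open>Round every entry on \<open>B\<close> down to a multiple of \<open>1 / q\<close> and put
  0 elsewhere. Rounding down keeps zeros, so triod points stay triod points, and only finitely many
  words result.\<close>

lemma finite_word_net:
  fixes B :: "(int \<times> nat \<times> nat) set"
  assumes "finite B" "0 < q"
  obtains ws :: "nat \<Rightarrow> int \<Rightarrow> nat \<Rightarrow> nat \<Rightarrow> real" and R where "\<And>u k i. triod (ws u k i)"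
    "\<And>w. (\<forall>k i. triod (w k i)) \<Longrightarrow> \<exists>u<R. \<forall>k i l. (k, i, l) \<in> B \<longrightarrow> \<bar>ws u k i l - w k i l\<bar> \<le> 1 / real q"
proof -
  define quant where "quant w = (\<lambda>k i l. if (k, i, l) \<in> B then real_of_int \<lfloor>real q * w k i l\<rfloor> / real q else 0)"
    for w :: "int \<Rightarrow> nat \<Rightarrow> nat \<Rightarrow> real"
  define W where "W = quant ` {w. \<forall>k i. triod (w k i)}"
  have tri: "triod (quant w k i)" if "\<forall>k i. triod (w k i)" for w k i
  proof -
    have "0 \<le> w k i l" "w k i l \<le> 1" for l using that by (auto simp: triod_def)
    then have fl: "0 \<le> \<lfloor>real q * w k i l\<rfloor>" "real_of_int \<lfloor>real q * w k i l\<rfloor> \<le> real q" for l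
      using mult_left_mono[of "w k i l" 1 "real q"] of_int_floor_le[of "real q * w k i l"]
      by (simp_all add: order_trans[OF of_int_floor_le])
    have zero: "w k i l = 0 \<Longrightarrow> quant w k i l = 0" for l by (simp add: quant_def)
    show ?thesis
      unfolding triod_def
    proof (intro conjI allI impI)
      fix l
      show "0 \<le> quant w k i l" using fl(1)[of l] by (simp add: quant_def)
      show "quant w k i l \<le> 1" using fl(2)[of l] \<open>0 < q\<close> by (simp add: quant_def divide_le_eq_1)
    next
      fix l m :: nat assume "l \<noteq> m"
      then have "w k i l = 0 \<or> w k i m = 0" using that by (auto simp: triod_def)
      then show "quant w k i l = 0 \<or> quant w k i m = 0" using zero by blast
    qed
  qed
  have close: "\<bar>quant w k i l - w k i l\<bar> \<le> 1 / real q" if "(k, i, l) \<in> B" for w k i l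
  proof -
    have "\<bar>real_of_int \<lfloor>real q * w k i l\<rfloor> - real q * w k i l\<bar> \<le> 1" by linarith
    then have "\<bar>real_of_int \<lfloor>real q * w k i l\<rfloor> - real q * w k i l\<bar> / real q \<le> 1 / real q"
      by (intro divide_right_mono) auto
    also have "\<bar>real_of_int \<lfloor>real q * w k i l\<rfloor> - real q * w k i l\<bar> / real q = \<bar>quant w k i l - w k i l\<bar>"
      using \<open>0 < q\<close> that by (simp add: quant_def abs_if field_simps)
    finally show ?thesis .
  qed
  let ?G = "{g :: int \<times> nat \<times> nat \<Rightarrow> real. \<forall>p. (p \<in> B \<longrightarrow> g p \<in> (\<lambda>z. real_of_int z / real q) ` {0..int q}) \<and> (p \<notin> B \<longrightarrow> g p = 0)}"
  have "finite ?G" by (intro finite_set_of_finite_funs assms) auto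
  moreover have "W \<subseteq> (\<lambda>g k i l. g (k, i, l)) ` ?G"
  proof
    fix v assume "v \<in> W"
    then obtain w where w: "v = quant w" "\<forall>k i. triod (w k i)" by (auto simp: W_def)
    have "(case p of (k, i, l) \<Rightarrow> quant w k i l) \<in> (\<lambda>z. real_of_int z / real q) ` {0..int q}" if pB: "p \<in> B" for p
    proof -
      obtain k i l where p: "p = (k, i, l)" by (cases p)
      have "0 \<le> w k i l" "w k i l \<le> 1" using w by (auto simp: triod_def)
      then have "\<lfloor>real q * w k i l\<rfloor> \<in> {0..int q}"
        using floor_mono[of "real q * w k i l" "real q"] mult_left_mono[of "w k i l" 1 "real q"] by auto
      then show ?thesis using pB by (auto simp: p quant_def)
    qed
    then have "(\<lambda>(k, i, l). quant w k i l) \<in> ?G" by (auto simp: quant_def)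
    then show "v \<in> (\<lambda>g k i l. g (k, i, l)) ` ?G"
      by (rule rev_image_eqI) (auto simp: w)
  qed
  ultimately have "finite W" by (rule finite_surj)
  then obtain ws0 :: "nat \<Rightarrow> int \<Rightarrow> nat \<Rightarrow> nat \<Rightarrow> real" where ws0: "bij_betw ws0 {0..<card W} W"
    using ex_bij_betw_nat_finite by blast
  define ws where "ws u = (if u < card W then ws0 u else (\<lambda>_ _ _. 0))" for u
  show ?thesis
  proof (rule that[of ws "card W"])
    show "triod (ws u k i)" for u k i
    proof (cases "u < card W")
      case True
      then have "ws0 u \<in> W" using ws0 by (auto simp: bij_betw_def)
      then show ?thesis using True tri by (auto simp: ws_def W_def)
    qed (simp add: ws_def triod_def)
    fix w :: "int \<Rightarrow> nat \<Rightarrow> nat \<Rightarrow> real" assume w: "\<forall>k i. triod (w k i)"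
    then have "quant w \<in> W" by (auto simp: W_def)
    then obtain u where "u < card W" "ws0 u = quant w"
      using ws0 by (metis atLeastLessThan_iff bij_betw_imp_surj_on imageE)
    then show "\<exists>u<card W. \<forall>k i l. (k, i, l) \<in> B \<longrightarrow> \<bar>ws u k i l - w k i l\<bar> \<le> 1 / real q"
      using close by (intro exI[of _ u]) (auto simp: ws_def)
  qed
qed

lemma skeleton_step_exists:
  assumes "skeleton n j N F \<sigma>"
  shows "\<exists>N' F' \<sigma>'. skeleton n (Suc j) N' F' \<sigma>' \<and> skeleton_step n j N F \<sigma> N' F' \<sigma>'"
proof -
  have N: "0 < N" and Fn: "\<And>k i. F k i \<Longrightarrow> i < n" and perF: "\<And>k i. F k i = F (k mod int N) i"
    and per\<sigma>: "\<And>k i. \<sigma> k i = \<sigma> (k mod int N) i" and tri: "\<And>k i. triod (\<sigma> k i)"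
    using assms unfolding skeleton_def by blast+
  define c where "c = card (free_block F N)"
  have c: "n * N + j + 1 \<le> 2 * c"
    using assms unfolding skeleton_def c_def by blast
  have fin: "finite ({0..<2 * int N} \<times> {..<n} \<times> {..<3::nat})" by simp
  obtain ws :: "nat \<Rightarrow> int \<Rightarrow> nat \<Rightarrow> nat \<Rightarrow> real" and R where ws: "\<And>u k i. triod (ws u k i)"
    "\<And>w. (\<forall>k i. triod (w k i)) \<Longrightarrow> \<exists>u<R. \<forall>k i l. (k, i, l) \<in> {0..<2 * int N} \<times> {..<n} \<times> {..<3} \<longrightarrow> \<bar>ws u k i l - w k i l\<bar> \<le> 1 / real (Suc j)"
    by (rule finite_word_net[OF fin zero_less_Suc[of j]], rule that, assumption+)
  define e where "e = 2 * c - n * N"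
  have e: "j + 1 \<le> e" "2 * c = e + n * N" using c by (auto simp: e_def)
  \<comment> \<open>The first product makes the remaining excess at most the fraction
    \<open>1 / (j + 1)\<close> of the period, 2 ensures \<open>2 * N \<le> N'\<close>, and
    \<open>(j + 2) + 4 * c * R\<close> leaves excess \<open>j + 2\<close> after freezing
    \<open>2 * R\<close> blocks, two for each word of the net.\<close>
  define M where "M = (j + 2 + 2 * c) * (j + 1) + 2 + (j + 2) + 4 * c * R"
  \<comment> \<open>N' = M * N, and the last s of the M blocks are frozen: the most that leaves an excess of j + 2\<close>
  define s where "s = (M * e - (j + 2)) div (2 * c)"
  have "0 < c" using c by simp
  have Me: "M * 1 \<le> M * e" using e by (intro mult_le_mono2) auto
  moreover have "j + 2 + 4 * c * R \<le> M" unfolding M_def by simp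
  ultimately have Me': "j + 2 + 4 * c * R \<le> M * e" by linarith
  have sc: "2 * c * s \<le> M * e - (j + 2)" "M * e - (j + 2) < 2 * c * s + 2 * c"
    using dividend_less_times_div[of "2 * c" "M * e - (j + 2)"] \<open>0 < c\<close> unfolding s_def
    by (simp, linarith)
  have e': "2 * c * s + j + 2 \<le> M * e" "M * e < 2 * c * s + 2 * c + (j + 2)"
    using sc Me' by linarith+
  have "2 * R \<le> s"
  proof -
    have "2 * c * (2 * R) \<le> M * e - (j + 2)" using Me' by (simp add: algebra_simps)
    then have "(2 * c * (2 * R)) div (2 * c) \<le> s" unfolding s_def by (rule div_le_mono)
    then show ?thesis using \<open>0 < c\<close> by simp
  qed
  have "s < M"
  proof -
    have "2 * c * s < M * e" using e' by linarith
    also have "\<dots> \<le> M * (2 * c)" using e by (intro mult_le_mono2) auto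
    finally show ?thesis by (simp add: mult.commute)
  qed
  define N' where "N' = M * N"
  define Q where "Q = int ((M - s) * N)"
  define F' where "F' k i \<longleftrightarrow> F k i \<and> k mod int N' < Q" for k i
  define \<sigma>' where "\<sigma>' k i = (if F k i \<and> \<not> F' k i then ws (nat ((k mod int N' - Q) div (2 * int N))) ((k mod int N' - Q) mod (2 * int N)) i else \<sigma> k i)"
    for k i
  have M2: "2 \<le> M" unfolding M_def by simp
  have N': "0 < N'" "N dvd N'" "2 * N \<le> N'" "int N dvd int N'" using N M2 by (auto simp: N'_def)
  have QN: "int N \<le> Q" "Q \<le> int N'" "int N dvd Q" "Q + int (s * N) = int N'"
  proof -
    have "1 * N \<le> (M - s) * N" using \<open>s < M\<close> by (intro mult_le_mono1) auto
    then show "int N \<le> Q" unfolding Q_def by (simp only: of_nat_le_iff mult_1)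
    show "Q \<le> int N'" unfolding Q_def N'_def of_nat_le_iff by (rule mult_le_mono1) simp
    show "int N dvd Q" unfolding Q_def by simp
    show "Q + int (s * N) = int N'"
      unfolding Q_def N'_def using \<open>s < M\<close> by (simp add: of_nat_diff algebra_simps)
  qed
  have mm: "(k mod int N') mod int N = k mod int N" for k
    using N'(4) by (rule mod_mod_cancel)
  have perF': "F' k i = F' (k mod int N') i" for k i
    using perF[of k i] perF[of "k mod int N'" i] by (simp add: F'_def mm)
  have Fmod: "F (k mod int N') i = F k i" for k i
    using perF[of k i] perF[of "k mod int N'" i] by (simp add: mm)
  have card': "card (free_block F' N') = (M - s) * c"
  proof -
    have "free_block F' N' = {(k, i). 0 \<le> k \<and> k < Q \<and> F k i}"
      using QN(2) by (auto simp: F'_def)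
    then show ?thesis
      using card_free_positions_blocks[where F = F and N = N and n = n and m = "M - s", OF N Fn perF, folded Q_def c_def] by simp
  qed
  have card_eq: "2 * ((M - s) * c) + 2 * c * s = M * e + n * N'"
  proof -
    have "2 * ((M - s) * c) + 2 * c * s = M * (2 * c)"
      using \<open>s < M\<close> by (simp add: diff_mult_distrib algebra_simps)
    then show ?thesis unfolding e(2) N'_def by (simp add: algebra_simps)
  qed
  have "skeleton n (Suc j) N' F' \<sigma>'"
    unfolding skeleton_def
  proof (intro conjI allI impI)
    show "F' k i \<Longrightarrow> i < n" for k i using Fn by (auto simp: F'_def)
    show "F' k i = F' (k mod int N') i" for k i by (rule perF')
    have "\<sigma> k i = \<sigma> (k mod int N') i" for k i
      using per\<sigma>[of k i] per\<sigma>[of "k mod int N'" i] by (simp add: mm)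
    then show "\<sigma>' k i = \<sigma>' (k mod int N') i" for k i
      using perF'[of k i] by (simp add: \<sigma>'_def Fmod)
    show "triod (\<sigma>' k i)" for k i using ws(1) tri by (simp add: \<sigma>'_def)
    show "n * N' + Suc j + 1 \<le> 2 * card (free_block F' N')"
      unfolding card' using card_eq e' by linarith
  qed (rule N')
  moreover have "skeleton_step n j N F \<sigma> N' F' \<sigma>'"
    unfolding skeleton_step_def
  proof (intro conjI)
    show "\<forall>k i. 0 \<le> k \<longrightarrow> k < int N \<longrightarrow> F' k i = F k i"
      using QN(1,2) by (auto simp: F'_def)
    show "\<forall>k i. \<not> F k i \<longrightarrow> \<sigma>' k i = \<sigma> k i" by (simp add: \<sigma>'_def)
    show "\<forall>w. (\<forall>k i. triod (w k i)) \<longrightarrow> (\<exists>t. word_at j N F F' \<sigma>' w t)"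
    proof (intro allI impI)
      fix w :: "int \<Rightarrow> nat \<Rightarrow> nat \<Rightarrow> real" assume "\<forall>k i. triod (w k i)"
      from ws(2)[OF this] obtain u where u: "u < R"
        "\<And>k i l. 0 \<le> k \<Longrightarrow> k < 2 * int N \<Longrightarrow> i < n \<Longrightarrow> l < 3 \<Longrightarrow> \<bar>ws u k i l - w k i l\<bar> \<le> 1 / real (Suc j)"
        by auto
      define t where "t = Q + 2 * int N * int u"
      have "int N dvd t" unfolding t_def using QN(3) by simp
      have t_bound: "t + 2 * int N \<le> int N'"
      proof -
        have "2 * int N * int u + 2 * int N = int (2 * (u + 1) * N)" by (simp add: algebra_simps)
        also have "2 * (u + 1) \<le> s" using u(1) \<open>2 * R \<le> s\<close> by simp
        then have "int (2 * (u + 1) * N) \<le> int (s * N)" unfolding of_nat_le_iff by (rule mult_le_mono1)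
        finally show ?thesis unfolding t_def using QN(4) by linarith
      qed
      have "\<not> F' (k + t) i \<and> (\<forall>l<3. \<bar>\<sigma>' (k + t) i l - w k i l\<bar> \<le> 1 / real (Suc j))"
        if k: "0 \<le> k" "k < 2 * int N" and Fk: "F k i" for k i
      proof -
        have t0: "Q \<le> t" unfolding t_def by simp
        have m: "(k + t) mod int N' = k + t"
          using k t0 t_bound QN(1) by (intro mod_pos_pos_trivial) linarith+
        have "F (k + t) i"
          using perF[of "k + t" i] perF[of k i] Fk \<open>int N dvd t\<close> by (metis mod_add_right_eq dvd_imp_mod_0 add.right_neutral)
        moreover have nF: "\<not> F' (k + t) i" using m t0 k by (simp add: F'_def)
        moreover have kt: "k + t - Q = k + int u * (2 * int N)" unfolding t_def by simp
        have "(k + t - Q) div (2 * int N) = int u" "(k + t - Q) mod (2 * int N) = k"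
          unfolding kt using k N by simp_all
        ultimately have "\<sigma>' (k + t) i = ws u k i"
          unfolding \<sigma>'_def m by simp
        then show ?thesis using nF u(2)[OF k Fn[OF Fk]] by simp
      qed
      with \<open>int N dvd t\<close> show "\<exists>t. word_at j N F F' \<sigma>' w t" by blast
    qed
    show "2 * card (free_block F' N') * Suc j \<le> (n * Suc j + 1) * N'"
    proof -
      have "2 * ((M - s) * c) \<le> (2 * c + (j + 2)) + n * N'" using card_eq e' by linarith
      then have "2 * ((M - s) * c) * Suc j \<le> ((2 * c + (j + 2)) + n * N') * Suc j" by (rule mult_le_mono1)
      also have "\<dots> = (j + 2 + 2 * c) * (j + 1) + n * Suc j * N'" by (simp add: algebra_simps)
      also have "(j + 2 + 2 * c) * (j + 1) \<le> M" unfolding M_def by simp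
      also have "M \<le> N'" unfolding N'_def using N by simp
      finally show ?thesis unfolding card' by (simp add: algebra_simps)
    qed
  qed (use N' in \<open>auto simp: F'_def\<close>)
  ultimately show ?thesis by blast
qed

text \<open>Dependent choice. The start has period 1 and all \<open>n\<close> coordinates free, with
  excess \<open>2 * n - n \<ge> 1\<close>.\<close>

theorem skeleton_sequence_exists:
  assumes "1 \<le> n"
  obtains N F \<sigma> where "\<And>j. skeleton n j (N j) (F j) (\<sigma> j)"
    "\<And>j. skeleton_step n j (N j) (F j) (\<sigma> j) (N (Suc j)) (F (Suc j)) (\<sigma> (Suc j))"
proof -
  let ?P = "\<lambda>j (N, F, \<sigma>). skeleton n j N F \<sigma>"
  let ?Q = "\<lambda>j (N, F, \<sigma>) (N', F', \<sigma>'). skeleton_step n j N F \<sigma> N' F' \<sigma>'"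
  have "\<exists>f. \<forall>j. ?P j (f j) \<and> ?Q j (f j) (f (Suc j))"
  proof (rule dependent_nat_choice)
    have "{(k :: int, i). 0 \<le> k \<and> k < int 1 \<and> i < n} = {0} \<times> {..<n}" by auto
    then have "skeleton n 0 1 (\<lambda>_ i. i < n) (\<lambda>_ _ _. 0)"
      using assms by (auto simp: skeleton_def triod_def card_cartesian_product)
    then show "\<exists>x. ?P 0 x" by auto
    fix x j assume "?P j x"
    then show "\<exists>y. ?P (Suc j) y \<and> ?Q j x y"
      using skeleton_step_exists[of n j "fst x" "fst (snd x)" "snd (snd x)"] by (auto split: prod.splits)
  qed
  then obtain f where f: "\<forall>j. ?P j (f j) \<and> ?Q j (f j) (f (Suc j))" ..
  have fP: "?P j (f j)" for j using spec[OF f, of j] by (rule conjunct1)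
  have fQ: "?Q j (f j) (f (Suc j))" for j using spec[OF f, of j] by (rule conjunct2)
  show ?thesis
    by (rule that[of "\<lambda>j. fst (f j)" "\<lambda>j. fst (snd (f j))" "\<lambda>j. snd (snd (f j))"])
       (use fP fQ in \<open>simp_all add: case_prod_beta\<close>)
qed

section \<open>The minimal system\<close>

text \<open>Two-sided sequences with countably many tracks are coded as points of the Hilbert cube
  over \<open>nat\<close>, the setting of \<open>krylov_bogoliubov\<close>; \<open>k\<close> is the
  time and \<open>c\<close> the track.\<close>

definition crd :: "(nat \<Rightarrow> real) \<Rightarrow> int \<Rightarrow> nat \<Rightarrow> real" where
  "crd x k c = x (prod_encode (int_encode k, c))"

definition shift_by :: "int \<Rightarrow> (nat \<Rightarrow> real) \<Rightarrow> nat \<Rightarrow> real" where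
  "shift_by p x = (\<lambda>m. case prod_decode m of (a, c) \<Rightarrow> crd x (int_decode a + p) c)"

lemma crd_shift_by [simp]: "crd (shift_by p x) k c = crd x (k + p) c"
  by (simp add: crd_def shift_by_def)

lemma crd_eqI: "(\<And>k c. crd x k c = crd y k c) \<Longrightarrow> x = y"
proof
  fix m assume "\<And>k c. crd x k c = crd y k c"
  from this[of "int_decode (fst (prod_decode m))" "snd (prod_decode m)"] show "x m = y m"
    by (simp add: crd_def)
qed

lemma shift_by_0 [simp]: "shift_by 0 x = x"
  by (rule crd_eqI) simp

lemma shift_by_add: "shift_by p (shift_by q x) = shift_by (p + q) x"
  by (rule crd_eqI) (simp add: algebra_simps)

lemma shift_by_funpow: "(shift_by 1 ^^ k) x = shift_by (int k) x"
  by (induction k) (simp_all add: shift_by_add)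

lemma continuous_on_crd [continuous_intros]: "continuous_on S (\<lambda>x. crd x k c)"
  unfolding crd_def by (rule continuous_on_subset[OF continuous_on_product_coordinates]) simp

lemma continuous_on_shift_by: "continuous_on S (shift_by p)"
proof (rule continuous_on_coordinatewise_then_product)
  fix m
  obtain a c where m: "prod_decode m = (a, c)" by (cases "prod_decode m")
  show "continuous_on S (\<lambda>x. shift_by p x m)"
    by (simp add: shift_by_def m continuous_on_crd)
qed

definition point_of :: "(int \<Rightarrow> nat \<Rightarrow> real) \<Rightarrow> nat \<Rightarrow> real" where
  "point_of z = (\<lambda>m. case prod_decode m of (a, c) \<Rightarrow> z (int_decode a) c)"

lemma crd_point_of [simp]: "crd (point_of z) k c = z k c"
  by (simp add: crd_def point_of_def)

lemma all_coordinates_iff: "(\<forall>m. P (x m)) \<longleftrightarrow> (\<forall>k c. P (crd x k c))"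
proof
  assume r: "\<forall>k c. P (crd x k c)"
  show "\<forall>m. P (x m)"
  proof
    fix m
    from r have "P (crd x (int_decode (fst (prod_decode m))) (snd (prod_decode m)))" by blast
    then show "P (x m)" by (simp add: crd_def)
  qed
qed (simp add: crd_def)

text \<open>The metric is at most twice the largest difference among the first coordinates plus a
  geometric tail: here less than \<open>2 * (e / 4) + e / 2\<close>. A single \<open>L\<close>
  bounds both times and tracks.\<close>

lemma dist_less_if_window_close:
  assumes "0 < (e::real)"
  shows "\<exists>(L::nat) \<delta>. 0 < \<delta> \<and> (\<forall>x y. (\<forall>k c. \<bar>k\<bar> \<le> int L \<longrightarrow> c < L \<longrightarrow> \<bar>crd x k c - crd y k c\<bar> \<le> \<delta>) \<longrightarrow> dist x y < e)"
proof -
  obtain M :: nat where M: "(1/2) ^ M < e / 2"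
    using real_arch_pow_inv[of "e / 2" "1 / 2"] assms by auto
  define ix where "ix m = (int_decode (fst (prod_decode (from_nat m :: nat))), snd (prod_decode (from_nat m :: nat)))" for m
  have crd_ix: "crd x (fst (ix m)) (snd (ix m)) = x (from_nat m)" for x m
    by (simp add: ix_def crd_def)
  define L where "L = Suc (Max ((\<lambda>m. nat \<bar>fst (ix m)\<bar> + snd (ix m)) ` {..M}))"
  have L: "\<bar>fst (ix m)\<bar> \<le> int L" "snd (ix m) < L" if "m \<le> M" for m
  proof -
    have "nat \<bar>fst (ix m)\<bar> + snd (ix m) \<le> Max ((\<lambda>m. nat \<bar>fst (ix m)\<bar> + snd (ix m)) ` {..M})"
      using that by (intro Max_ge) auto
    then show "\<bar>fst (ix m)\<bar> \<le> int L" "snd (ix m) < L" unfolding L_def by linarith+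
  qed
  show ?thesis
  proof (intro exI[of _ L] exI[of _ "e / 4"] conjI allI impI)
    fix x y assume "\<forall>k c. \<bar>k\<bar> \<le> int L \<longrightarrow> c < L \<longrightarrow> \<bar>crd x k c - crd y k c\<bar> \<le> e / 4"
    then have c: "\<bar>k\<bar> \<le> int L \<Longrightarrow> c < L \<Longrightarrow> \<bar>crd x k c - crd y k c\<bar> \<le> e / 4" for k c by blast
    let ?S = "{dist (x (from_nat m)) (y (from_nat m)) |m. m \<le> M}"
    have "?S = (\<lambda>m. dist (x (from_nat m)) (y (from_nat m))) ` {..M}" by auto
    then have fin: "finite ?S" "?S \<noteq> {}" by auto
    have "Max ?S \<le> e / 4"
    proof (subst Max_le_iff[OF fin], safe)
      fix m assume "m \<le> M"
      from c[OF L[OF this]] show "dist (x (from_nat m)) (y (from_nat m)) \<le> e / 4"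
        unfolding crd_ix dist_real_def .
    qed
    then show "dist x y < e"
      using dist_fun_le_dist_first_terms[of x y M] M by linarith
  qed (use assms in simp)
qed

locale triod_system =
  fixes n :: nat and N :: "nat \<Rightarrow> nat" and F :: "nat \<Rightarrow> int \<Rightarrow> nat \<Rightarrow> bool"
    and \<sigma> :: "nat \<Rightarrow> int \<Rightarrow> nat \<Rightarrow> nat \<Rightarrow> real"
  assumes n: "1 \<le> n"
    and skel: "\<And>j. skeleton n j (N j) (F j) (\<sigma> j)"
    and step: "\<And>j. skeleton_step n j (N j) (F j) (\<sigma> j) (N (Suc j)) (F (Suc j)) (\<sigma> (Suc j))"
begin

lemma N_pos: "0 < N j"
  and F_less: "F j k i \<Longrightarrow> i < n"
  and F_mod: "F j k i = F j (k mod int (N j)) i"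
  and \<sigma>_mod: "\<sigma> j k i = \<sigma> j (k mod int (N j)) i"
  and \<sigma>_triod: "triod (\<sigma> j k i)"
  and card_free_ge: "n * N j + j + 1 \<le> 2 * card (free_block (F j) (N j))"
  using skel[of j] unfolding skeleton_def by blast+

lemma N_dvd_Suc: "N j dvd N (Suc j)"
  and N_double: "2 * N j \<le> N (Suc j)"
  and F_SucD: "F (Suc j) k i \<Longrightarrow> F j k i"
  and F_Suc_block: "0 \<le> k \<Longrightarrow> k < int (N j) \<Longrightarrow> F (Suc j) k i = F j k i"
  and \<sigma>_Suc: "\<not> F j k i \<Longrightarrow> \<sigma> (Suc j) k i = \<sigma> j k i"
  and words_occur: "(\<And>k i. triod (w k i)) \<Longrightarrow> \<exists>t. word_at j (N j) (F j) (F (Suc j)) (\<sigma> (Suc j)) w t"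
  and card_free_Suc_le: "2 * card (free_block (F (Suc j)) (N (Suc j))) * Suc j \<le> (n * Suc j + 1) * N (Suc j)"
  using step[of j] unfolding skeleton_step_def by blast+

lemma N_dvd: "i \<le> j \<Longrightarrow> N i dvd N j"
proof (induction rule: dec_induct)
  case (step m)
  then show ?case using dvd_trans[OF _ N_dvd_Suc] by blast
qed simp

lemma N_ge: "j < N j"
proof (induction j)
  case (Suc j)
  then show ?case using N_double[of j] by linarith
qed (rule N_pos)

lemma F_antimono: "i \<le> j \<Longrightarrow> F j k c \<Longrightarrow> F i k c"
proof (induction rule: dec_induct)
  case (step m)
  then show ?case using F_SucD[of m k c] by blast
qed simp

lemma F_add_period: "int (N j) dvd t \<Longrightarrow> F j (k + t) i = F j k i"
  using F_mod[of j "k + t" i] F_mod[of j k i] by (metis add.right_neutral dvd_imp_mod_0 mod_add_right_eq)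

lemma \<sigma>_add_period: "int (N j) dvd t \<Longrightarrow> \<sigma> j (k + t) i = \<sigma> j k i"
  using \<sigma>_mod[of j "k + t" i] \<sigma>_mod[of j k i] by (metis add.right_neutral dvd_imp_mod_0 mod_add_right_eq)

lemma F_block: "i \<le> j \<Longrightarrow> 0 \<le> k \<Longrightarrow> k < int (N i) \<Longrightarrow> F j k c = F i k c"
proof (induction rule: dec_induct)
  case (step m)
  have "N i \<le> N m" using N_dvd[OF step(1)] N_pos[of m] by (rule dvd_imp_le)
  then have "k < int (N m)" using step(5) by linarith
  then show ?case using F_Suc_block[of k m c] step by simp
qed simp

lemma \<sigma>_eq: "i \<le> j \<Longrightarrow> \<not> F i k c \<Longrightarrow> \<sigma> j k c = \<sigma> i k c"
proof (induction rule: dec_induct)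
  case (step m)
  then have "\<not> F m k c" using F_antimono by blast
  then show ?case using \<sigma>_Suc step by simp
qed simp

abbreviation leg :: "(nat \<Rightarrow> real) \<Rightarrow> int \<Rightarrow> nat \<Rightarrow> nat \<Rightarrow> real" where
  "leg x k i l \<equiv> crd x k (3 * i + l)"

abbreviation marker :: "(nat \<Rightarrow> real) \<Rightarrow> int \<Rightarrow> nat \<Rightarrow> real" where
  "marker x k j \<equiv> crd x k (3 * n + j)"

text \<open>A j a contains the sequences of level j and phase a. Tracks 3 i + l (i < n, l < 3) carry the three
  coordinates of the i-th triod, track 3 n + j marks the multiples of N j. The markers make the phase a
  continuous function of the sequence.\<close>

definition A :: "nat \<Rightarrow> int \<Rightarrow> (nat \<Rightarrow> real) set" where
  "A j a = {x. (\<forall>m. 0 \<le> x m \<and> x m \<le> 1) \<and>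
     (\<forall>k. \<forall>i<n. \<forall>l<3. \<forall>l'<3. l \<noteq> l' \<longrightarrow> leg x k i l = 0 \<or> leg x k i l' = 0) \<and>
     (\<forall>j'\<le>j. \<forall>k. marker x k j' = of_bool (int (N j') dvd k + a)) \<and>
     (\<forall>k. \<forall>i<n. \<not> F j (k + a) i \<longrightarrow> (\<forall>l<3. leg x k i l = \<sigma> j (k + a) i l))}"

text \<open>The phase may vary with the level. It matters only modulo \<open>N j\<close>, so each
  union is finite and closed.\<close>

definition K :: "(nat \<Rightarrow> real) set" where
  "K = (\<Inter>j. \<Union>a\<in>{0..<int (N j)}. A j a)"

lemma A_bounds: "x \<in> A j a \<Longrightarrow> 0 \<le> x m \<and> x m \<le> 1"
  by (simp add: A_def)

lemma A_crd_bounds: "x \<in> A j a \<Longrightarrow> 0 \<le> crd x k c \<and> crd x k c \<le> 1"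
  unfolding crd_def by (rule A_bounds)

lemma A_triod: "x \<in> A j a \<Longrightarrow> i < n \<Longrightarrow> l < 3 \<Longrightarrow> l' < 3 \<Longrightarrow> l \<noteq> l' \<Longrightarrow> leg x k i l = 0 \<or> leg x k i l' = 0"
  by (simp add: A_def)

lemma A_marker: "x \<in> A j a \<Longrightarrow> j' \<le> j \<Longrightarrow> marker x k j' = of_bool (int (N j') dvd k + a)"
  by (simp add: A_def)

lemma A_frozen: "x \<in> A j a \<Longrightarrow> i < n \<Longrightarrow> \<not> F j (k + a) i \<Longrightarrow> l < 3 \<Longrightarrow> leg x k i l = \<sigma> j (k + a) i l"
  by (simp add: A_def)

lemma A_Suc_subset: "A (Suc j) a \<subseteq> A j a"
proof
  fix x assume x: "x \<in> A (Suc j) a"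
  have "leg x k i l = \<sigma> j (k + a) i l" if "i < n" "\<not> F j (k + a) i" "l < 3" for k i l
    using A_frozen[OF x that(1) _ that(3)] that F_SucD \<sigma>_Suc by metis
  then show "x \<in> A j a" using x unfolding A_def by auto
qed

lemma A_add_period_subset:
  assumes "int (N j) dvd t" shows "A j a \<subseteq> A j (a + t)"
proof
  fix x assume x: "x \<in> A j a"
  have "int (N j') dvd k + (a + t) \<longleftrightarrow> int (N j') dvd k + a" if "j' \<le> j" for j' k
  proof -
    have "int (N j') dvd t" using N_dvd[OF that] assms by (meson dvd_trans of_nat_dvd_iff)
    then show ?thesis by (metis add.assoc dvd_add_left_iff)
  qed
  moreover have "F j (k + (a + t)) i = F j (k + a) i" "\<sigma> j (k + (a + t)) i = \<sigma> j (k + a) i" for k i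
    using F_add_period[OF assms, of "k + a"] \<sigma>_add_period[OF assms, of "k + a"] by (simp_all add: add.assoc)
  ultimately show "x \<in> A j (a + t)" using x unfolding A_def by auto
qed

lemma A_mod: "A j a = A j (a mod int (N j))"
proof -
  have "int (N j) dvd a mod int (N j) - a" by (simp add: mod_eq_dvd_iff[symmetric])
  from A_add_period_subset[OF this, of a] have "A j a \<subseteq> A j (a mod int (N j))" by simp
  moreover have "int (N j) dvd a - a mod int (N j)" by simp
  from A_add_period_subset[OF this, of "a mod int (N j)"] have "A j (a mod int (N j)) \<subseteq> A j a" by simp
  ultimately show ?thesis by blast
qed

lemma A_phase_unique:
  assumes "x \<in> A j a" "x \<in> A j b" shows "int (N j) dvd a - b"
proof -
  have "of_bool (int (N j) dvd - b + a) = (of_bool (int (N j) dvd - b + b) :: real)"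
    using A_marker[OF assms(1) order_refl, of "- b"] A_marker[OF assms(2) order_refl, of "- b"] by simp
  then show ?thesis by (simp split: if_splits)
qed

lemma K_iff: "x \<in> K \<longleftrightarrow> (\<forall>j. \<exists>a. x \<in> A j a)"
proof
  assume r: "\<forall>j. \<exists>a. x \<in> A j a"
  show "x \<in> K" unfolding K_def
  proof
    fix j
    obtain a where "x \<in> A j a" using r by blast
    then have "x \<in> A j (a mod int (N j))" using A_mod by blast
    moreover have "a mod int (N j) \<in> {0..<int (N j)}" using N_pos[of j] by auto
    ultimately show "x \<in> (\<Union>a\<in>{0..<int (N j)}. A j a)" by blast
  qed
qed (auto simp: K_def)

lemma shift_by_A: "x \<in> A j a \<Longrightarrow> shift_by p x \<in> A j (a + p)"
proof -
  assume x: "x \<in> A j a"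
  have "\<forall>m. 0 \<le> shift_by p x m \<and> shift_by p x m \<le> 1"
    using A_crd_bounds[OF x] by (intro iffD2[OF all_coordinates_iff[of "\<lambda>r. 0 \<le> r \<and> r \<le> 1"]]) simp
  then show ?thesis
    using x unfolding A_def by (simp add: algebra_simps)
qed

lemma shift_by_K: "x \<in> K \<Longrightarrow> shift_by p x \<in> K"
  unfolding K_iff using shift_by_A by blast

lemma K_bounds: "x \<in> K \<Longrightarrow> 0 \<le> x m \<and> x m \<le> 1"
  using A_bounds unfolding K_iff by blast

lemma K_crd_bounds: "x \<in> K \<Longrightarrow> 0 \<le> crd x k c \<and> crd x k c \<le> 1"
  unfolding crd_def by (rule K_bounds)

lemma closed_A: "closed (A j a)"
proof -
  have c1: "closed {x :: nat \<Rightarrow> real. f x = c}" if "continuous_on UNIV f" for f and c :: real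
    using that by (intro closed_Collect_eq continuous_on_const)
  have c2: "closed {x :: nat \<Rightarrow> real. f x \<le> g x}" if "continuous_on UNIV f" "continuous_on UNIV g" for f g :: "(nat \<Rightarrow> real) \<Rightarrow> real"
    using that by (rule closed_Collect_le)
  show ?thesis
    unfolding A_def
    by (intro closed_Collect_conj closed_Collect_all closed_Collect_imp closed_Collect_disj c1 c2 open_Collect_const
        continuous_on_crd continuous_on_product_coordinates continuous_on_const)
qed

lemma compact_K: "compact K"
proof -
  have "compact (UNIV \<rightarrow>\<^sub>E {0..1} :: (nat \<Rightarrow> real) set)"
  proof -
    have "compactin (product_topology (\<lambda>_. euclidean) UNIV) (UNIV \<rightarrow>\<^sub>E {0..1} :: (nat \<Rightarrow> real) set)"
      by (subst compactin_PiE) auto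
    then show ?thesis by (simp add: euclidean_product_topology)
  qed
  moreover have "closed K"
    unfolding K_def by (intro closed_INT ballI closed_UN closed_A) auto
  moreover have "K \<subseteq> UNIV \<rightarrow>\<^sub>E {0..1}"
    using K_bounds by (auto simp: PiE_def)
  ultimately show ?thesis by (metis compact_Int_closed inf.absorb_iff2)
qed

section \<open>Families of points with free coordinates\<close>

definition never_frozen :: "int \<Rightarrow> nat \<Rightarrow> bool" where
  "never_frozen k i \<longleftrightarrow> (\<forall>j. F j k i)"

text \<open>A cube of independent triods inside the system, at phase 0. The choice of
  \<open>LEAST j\<close> is harmless: frozen values persist, so every level at which the position is
  frozen gives the same value.\<close>

definition family :: "(int \<Rightarrow> nat \<Rightarrow> nat \<Rightarrow> real) \<Rightarrow> nat \<Rightarrow> real" where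
  "family w = point_of (\<lambda>k c. if c < 3 * n then
       (let i = c div 3; l = c mod 3 in
         if never_frozen k i then w k i l else \<sigma> (LEAST j. \<not> F j k i) k i l)
     else of_bool (int (N (c - 3 * n)) dvd k))"

lemma leg_family:
  assumes "i < n" "l < 3"
  shows "leg (family w) k i l = (if never_frozen k i then w k i l else \<sigma> (LEAST j. \<not> F j k i) k i l)"
  using assms by (simp add: family_def Let_def)

lemma leg_family_frozen:
  assumes "i < n" "l < 3" "\<not> F j k i"
  shows "leg (family w) k i l = \<sigma> j k i l"
proof -
  have "\<not> F (LEAST j. \<not> F j k i) k i" "(LEAST j. \<not> F j k i) \<le> j"
    using assms(3) by (rule LeastI, rule Least_le)
  from \<sigma>_eq[OF this(2,1)] show ?thesis
    using assms leg_family by (auto simp: never_frozen_def)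
qed

lemma family_A:
  assumes "\<And>k i. triod (w k i)"
  shows "family w \<in> A j 0"
proof -
  have tri: "triod (\<lambda>l. if never_frozen k i then w k i l else \<sigma> (LEAST j. \<not> F j k i) k i l)" for k i
    using assms \<sigma>_triod by (cases "never_frozen k i") auto
  have "0 \<le> crd (family w) k c \<and> crd (family w) k c \<le> 1" for k c
    using tri[of k "c div 3"] by (auto simp: family_def Let_def triod_def)
  then have "\<forall>m. 0 \<le> family w m \<and> family w m \<le> 1"
    by (intro iffD2[OF all_coordinates_iff[of "\<lambda>r. 0 \<le> r \<and> r \<le> 1"]]) blast
  moreover have "leg (family w) k i l = 0 \<or> leg (family w) k i l' = 0" if "i < n" "l < 3" "l' < 3" "l \<noteq> l'" for k i l l'
    using tri[of k i] that(4) unfolding triod_def leg_family[OF that(1,2)] leg_family[OF that(1,3)] by blast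
  moreover have "marker (family w) k j' = of_bool (int (N j') dvd k)" for k j'
    by (simp add: family_def)
  ultimately show ?thesis
    unfolding A_def using leg_family_frozen by simp
qed

lemma family_K: "(\<And>k i. triod (w k i)) \<Longrightarrow> family w \<in> K"
  unfolding K_iff using family_A by blast

lemma K_nonempty: "K \<noteq> {}"
proof -
  have "family (\<lambda>_ _ _. 0) \<in> K" by (rule family_K) (simp add: triod_def)
  then show ?thesis by blast
qed

text \<open>\<open>F_block\<close> keeps such a position free at higher levels,
  \<open>F_antimono\<close> at lower ones. So all free positions of one period vary independently in
  \<open>family\<close>.\<close>

lemma never_frozen_block: "0 \<le> k \<Longrightarrow> k < int (N j) \<Longrightarrow> F j k i \<Longrightarrow> never_frozen k i"
  unfolding never_frozen_def using F_block F_antimono by (metis nle_le)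

lemma continuous_on_family:
  assumes "\<And>k i l. continuous_on S (\<lambda>z. w z k i l)"
  shows "continuous_on S (\<lambda>z. family (w z))"
proof (rule continuous_on_coordinatewise_then_product)
  fix m
  obtain a c where m: "prod_decode m = (a, c)" by (cases "prod_decode m")
  show "continuous_on S (\<lambda>z. family (w z) m)"
    unfolding family_def point_of_def Let_def
    using assms by (cases "c < 3 * n"; cases "never_frozen (int_decode a) (c div 3)") (auto simp: m)
qed

text \<open>Every point of the system contains, frozen at level \<open>j + 1\<close>, an
  approximation of the word that \<open>y\<close> shows around time 0. Entries already frozen at
  level \<open>j\<close>, and the markers, agree exactly because the two points are compared at
  positions congruent modulo \<open>N j\<close>.\<close>

lemma orbit_approximates:
  assumes x: "x \<in> K" and y: "y \<in> K" and e: "0 < e"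
  shows "\<exists>p. dist (shift_by p x) y < e"
proof -
  obtain L :: nat and \<delta> :: real where \<delta>: "0 < \<delta>"
    and close: "\<And>x y. (\<And>k c. \<bar>k\<bar> \<le> int L \<Longrightarrow> c < L \<Longrightarrow> \<bar>crd x k c - crd y k c\<bar> \<le> \<delta>) \<Longrightarrow> dist x y < e"
    using dist_less_if_window_close[OF e] by blast
  obtain j0 :: nat where j0: "1 / real (Suc j0) < \<delta>"
    using nat_approx_posE[OF \<delta>] by blast
  define j where "j = max j0 (2 * L + 1)"
  have "1 / real (Suc j) \<le> 1 / real (Suc j0)" unfolding j_def by (intro divide_left_mono) auto
  then have j: "1 / real (Suc j) \<le> \<delta>" "2 * int L + 1 \<le> int (N j)" "L \<le> j"
    using j0 N_ge[of j] unfolding j_def by auto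
  obtain a where a: "y \<in> A j a" using y unfolding K_iff by blast
  obtain b where b: "x \<in> A (Suc j) b" using x unfolding K_iff by blast
  then have b': "x \<in> A j b" using A_Suc_subset by blast
  \<comment> \<open>The last start of a level \<open>j\<close> block not after \<open>a - L\<close>.
    In skeleton coordinates the window of \<open>y\<close> runs from \<open>a - L\<close> to
    \<open>a + L\<close>, hence stays inside the two blocks from \<open>q\<close> on.\<close>
  define q where "q = (a - int L) div int (N j) * int (N j)"
  have "q = a - int L - (a - int L) mod int (N j)"
    unfolding q_def by (simp add: minus_mod_eq_div_mult)
  moreover have "0 \<le> (a - int L) mod int (N j)" "(a - int L) mod int (N j) < int (N j)"
    using N_pos[of j] by simp_all
  ultimately have q: "int (N j) dvd q" "q \<le> a - int L" "a - int L < q + int (N j)"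
    unfolding q_def by simp_all
  define w where "w k i l = (if i < n \<and> l < 3 then leg y (k + q - a) i l else 0)" for k i l
  have "triod (w k i)" for k i
    unfolding triod_def w_def using A_crd_bounds[OF a] A_triod[OF a] by simp
  from words_occur[OF this, of j] obtain t where t0: "word_at j (N j) (F j) (F (Suc j)) (\<sigma> (Suc j)) w t" ..
  then have t: "int (N j) dvd t" by (rule conjunct1)
  have occ: "\<not> F (Suc j) (k + t) i" "l < 3 \<Longrightarrow> \<bar>\<sigma> (Suc j) (k + t) i l - w k i l\<bar> \<le> 1 / real (Suc j)"
    if "0 \<le> k" "k < 2 * int (N j)" "F j k i" for k i l
    using t0 that by simp_all
  \<comment> \<open>Time \<open>k\<close> of the shifted \<open>x\<close> becomes skeleton position
    \<open>\<kappa> + t\<close>, where the word is frozen, while time \<open>k\<close> of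
    \<open>y\<close> is position \<open>\<kappa> + q\<close>.\<close>
  define p where "p = a - q + t - b"
  have "dist (shift_by p x) y < e"
  proof (rule close)
    fix k and c :: nat assume k: "\<bar>k\<bar> \<le> int L" and c: "c < L"
    define \<kappa> where "\<kappa> = k + a - q"
    have \<kappa>: "0 \<le> \<kappa>" "\<kappa> < 2 * int (N j)" "k + p + b = \<kappa> + t" "\<kappa> + q - a = k" "k + a = \<kappa> + q"
      using k q j(2) unfolding \<kappa>_def p_def by auto
    show "\<bar>crd (shift_by p x) k c - crd y k c\<bar> \<le> \<delta>"
    proof (cases "c < 3 * n")
      case True
      define i l where "i = c div 3" and "l = c mod 3"
      have c': "c = 3 * i + l" "i < n" "l < 3" using True by (auto simp: i_def l_def)
      show ?thesis
      proof (cases "F j \<kappa> i")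
        case True
        note o = occ(1)[OF \<kappa>(1,2) True] occ(2)[OF \<kappa>(1,2) True c'(3)]
        have "leg x (k + p) i l = \<sigma> (Suc j) (\<kappa> + t) i l"
          using A_frozen[OF b c'(2), of "k + p" l] o c'(3) \<kappa>(3) by simp
        then show ?thesis
          using o c' j(1) \<kappa>(4) by (simp add: w_def)
      next
        case False
        have "leg x (k + p) i l = \<sigma> j (\<kappa> + t) i l"
          using A_frozen[OF b' c'(2), of "k + p" l] False F_add_period[OF t] c'(3) \<kappa>(3) by simp
        also have "\<dots> = \<sigma> j (\<kappa> + q) i l" using \<sigma>_add_period[OF t] \<sigma>_add_period[OF q(1)] by simp
        also have "\<dots> = leg y k i l"
          using A_frozen[OF a c'(2), of k l] False F_add_period[OF q(1)] c'(3) \<kappa>(5) by simp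
        finally show ?thesis using \<delta> c' by simp
      qed
    next
      case False
      define j' where "j' = c - 3 * n"
      have j': "c = 3 * n + j'" "j' \<le> j" using False c j(3) by (auto simp: j'_def)
      have "int (N j') dvd t" "int (N j') dvd q"
        using N_dvd[OF j'(2)] t q(1) by (meson dvd_trans of_nat_dvd_iff)+
      then have "int (N j') dvd k + p + b \<longleftrightarrow> int (N j') dvd k + a"
        unfolding \<kappa>(3,5) by (simp add: dvd_add_left_iff)
      then show ?thesis
        using A_marker[OF b' j'(2), of "k + p"] A_marker[OF a j'(2), of k] \<delta> j'(1) by simp
    qed
  qed
  then show ?thesis by blast
qed

lemma homeomorphic_shift: "homeomorphic_map (top_of_set K) (top_of_set K) (shift_by 1)"
proof -
  have "homeomorphic_maps (top_of_set K) (top_of_set K) (shift_by 1) (shift_by (-1))"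
    unfolding homeomorphic_maps_def
    using shift_by_K by (auto simp: continuous_on_shift_by shift_by_add)
  then show ?thesis by (rule homeomorphic_maps_imp_map)
qed

lemma int_iterate_shift:
  assumes "x \<in> K"
  shows "int_iterate (top_of_set K) (shift_by 1) p x = shift_by p x"
proof (cases "0 \<le> p")
  case True
  then show ?thesis by (simp add: int_iterate_def shift_by_funpow)
next
  case False
  have inj: "inj_on (shift_by 1) K"
    by (rule inj_on_inverseI[where g = "shift_by (-1)"]) (simp add: shift_by_add)
  have inv: "inv_into K (shift_by 1) z = shift_by (-1) z" if "z \<in> K" for z
    using inv_into_f_f[OF inj shift_by_K[OF that, of "-1"]] by (simp add: shift_by_add)
  have "(inv_into K (shift_by 1) ^^ m) x = shift_by (- int m) x" for m
    by (induction m) (simp_all add: inv shift_by_K assms shift_by_add)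
  with False show ?thesis by (simp add: int_iterate_def)
qed

lemma minimal_shift: "minimal_system (top_of_set K) (shift_by 1)"
  unfolding minimal_system_def top_dyn_system_def
proof (intro conjI ballI)
  show "compact_space (top_of_set K)" using compact_K by (simp add: compact_space_subtopology)
  show "metrizable_space (top_of_set K)" by (simp add: metrizable_space_euclidean metrizable_space_subtopology)
  fix x assume "x \<in> topspace (top_of_set K)"
  then have x: "x \<in> K" by simp
  let ?O = "range (\<lambda>k. int_iterate (top_of_set K) (shift_by 1) k x)"
  have orb: "?O = range (\<lambda>p. shift_by p x)" using int_iterate_shift[OF x] by simp
  show "top_of_set K closure_of ?O = topspace (top_of_set K)"
  proof (intro equalityI closure_of_subset_topspace subsetI)
    fix y assume "y \<in> topspace (top_of_set K)"
    then have y: "y \<in> K" by simp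
    show "y \<in> top_of_set K closure_of ?O"
      unfolding in_closure_of
    proof (intro conjI allI impI)
      fix U assume "y \<in> U \<and> openin (top_of_set K) U"
      then obtain e where e: "0 < e" "ball y e \<inter> K \<subseteq> U" by (metis openin_contains_ball)
      obtain p where "dist (shift_by p x) y < e" using orbit_approximates[OF x y e(1)] by blast
      then have "shift_by p x \<in> U" using e(2) shift_by_K[OF x, of p] by (auto simp: dist_commute)
      then show "\<exists>z. z \<in> ?O \<and> z \<in> U" unfolding orb by blast
    qed (use y in simp)
  qed
qed (use K_nonempty homeomorphic_shift in auto)

end

section \<open>No equivariant embedding\<close>

text \<open>Subtracting the median from (a, b, 0) leaves at most one positive and one negative entry; the positive
  part and the negative part are two points of a triod, exchanged by (a, b) to (- a, - b).\<close>

definition hexagon :: "real \<Rightarrow> real \<Rightarrow> nat \<Rightarrow> real" where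
  "hexagon a b l = (if l = 0 then a else if l = 1 then b else 0) -
     (a + b - max a (max b 0) - min a (min b 0))"

lemma hexagon_minus: "hexagon (- a) (- b) l = - hexagon a b l"
  by (auto simp: hexagon_def max_def min_def)

lemma hexagon_le: "\<bar>a\<bar> \<le> 1 \<Longrightarrow> \<bar>b\<bar> \<le> 1 \<Longrightarrow> hexagon a b l \<le> 1"
  by (auto simp: hexagon_def max_def min_def)

lemma hexagon_one_positive:
  assumes "l < 3" "m < 3" "l \<noteq> m" shows "hexagon a b l \<le> 0 \<or> hexagon a b m \<le> 0"
proof -
  have "l \<in> {0, 1, 2}" "m \<in> {0, 1, 2}" using assms by auto
  with assms(3) show ?thesis by (auto simp: hexagon_def max_def min_def)
qed

text \<open>Entry 2 corresponds to the 0 in (a, b, 0), so \<open>a\<close> and \<open>b\<close> are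
  differences of entries; three entries below \<open>1/2\<close> would force both below 1 in
  absolute value.\<close>

lemma hexagon_far:
  assumes "\<bar>a\<bar> = 1 \<or> \<bar>b\<bar> = 1" shows "\<exists>l<3. 1 / 2 \<le> \<bar>hexagon a b l\<bar>"
proof (rule ccontr)
  assume "\<not> ?thesis"
  then have "\<bar>hexagon a b 0\<bar> < 1 / 2" "\<bar>hexagon a b 1\<bar> < 1 / 2" "\<bar>hexagon a b 2\<bar> < 1 / 2"
    by (auto simp: not_le)
  moreover have "a = hexagon a b 0 - hexagon a b 2" "b = hexagon a b 1 - hexagon a b 2"
    by (simp_all add: hexagon_def)
  ultimately have "\<bar>a\<bar> < 1" "\<bar>b\<bar> < 1" by linarith+
  with assms show False by auto
qed

definition hexagon_leg :: "real \<Rightarrow> real \<Rightarrow> nat \<Rightarrow> real" where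
  "hexagon_leg a b l = (if l < 3 then max (hexagon a b l) 0 else 0)"

lemma triod_hexagon_leg: "\<bar>a\<bar> \<le> 1 \<Longrightarrow> \<bar>b\<bar> \<le> 1 \<Longrightarrow> triod (hexagon_leg a b)"
  using hexagon_le[of a b] hexagon_one_positive[of _ _ a b] unfolding triod_def hexagon_leg_def
  by (auto simp: max_def)

lemma hexagon_leg_diff: "l < 3 \<Longrightarrow> hexagon_leg a b l - hexagon_leg (- a) (- b) l = hexagon a b l"
  by (simp add: hexagon_leg_def hexagon_minus max_def)

lemma continuous_on_hexagon_leg:
  assumes "continuous_on S f" "continuous_on S g"
  shows "continuous_on S (\<lambda>z. hexagon_leg (f z) (g z) l)"
proof (cases "l < 3")
  case True
  have "continuous_on S (\<lambda>z. hexagon (f z) (g z) l)"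
    unfolding hexagon_def using assms by (cases "l = 0"; cases "l = 1") (auto intro!: continuous_intros)
  then show ?thesis using True unfolding hexagon_leg_def by (auto intro!: continuous_intros)
qed (simp add: hexagon_leg_def)

section \<open>Separating functions against Borsuk-Ulam\<close>

context triod_system
begin

text \<open>Take the coordinates at time 0: equivariance recovers \<open>G x k\<close> as the time 0
  value at \<open>shift_by k x\<close>. For negative times the forward formula is applied to the
  shifted point.\<close>

lemma equivariant_embedding_coordinates:
  assumes emb: "equivariant_embedding (top_of_set K) (shift_by 1) (cube_shift_space n) seq_shift G"
  obtains \<phi> :: "nat \<Rightarrow> (nat \<Rightarrow> real) \<Rightarrow> real" where "\<And>i. i < n \<Longrightarrow> continuous_on K (\<phi> i)"
    "\<And>x y. x \<in> K \<Longrightarrow> y \<in> K \<Longrightarrow> (\<And>k i. i < n \<Longrightarrow> \<phi> i (shift_by k x) = \<phi> i (shift_by k y)) \<Longrightarrow> x = y"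
proof (rule that[of "\<lambda>i x. G x 0 i"])
  have em: "embedding_map (top_of_set K) (cube_shift_space n) G"
    and eq: "\<And>x. x \<in> K \<Longrightarrow> G (shift_by 1 x) = seq_shift (G x)"
    using emb unfolding equivariant_embedding_def by auto
  have inj: "inj_on G K"
    using em unfolding embedding_map_def by (auto dest: homeomorphic_imp_injective_map)
  have cont: "continuous_map (top_of_set K) (cube_shift_space n) G"
    using em unfolding embedding_map_def by (auto dest: homeomorphic_imp_continuous_map simp: continuous_map_in_subtopology)
  show "continuous_on K (\<lambda>x. G x 0 i)" if "i < n" for i
  proof -
    have "continuous_map (top_of_set K) (product_topology (\<lambda>_. top_of_set {0..1}) {..<n}) (\<lambda>x. G x 0)"
      using cont unfolding cube_shift_space_def continuous_map_componentwise by auto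
    then have "continuous_map (top_of_set K) (top_of_set {0..1}) (\<lambda>x. G x 0 i)"
      using that unfolding continuous_map_componentwise by auto
    then show ?thesis using continuous_map_in_subtopology by (metis continuous_map_iff_continuous)
  qed
  have Gshift: "G (shift_by (int m) x) = (\<lambda>k. G x (k + int m))" if "x \<in> K" for m x
  proof (induction m)
    case (Suc m)
    have "G (shift_by (int (Suc m)) x) = G (shift_by 1 (shift_by (int m) x))"
      by (simp add: shift_by_add)
    also have "\<dots> = seq_shift (G (shift_by (int m) x))" by (rule eq[OF shift_by_K[OF that]])
    finally show ?case unfolding Suc by (simp add: seq_shift_def algebra_simps)
  qed simp
  have G0: "G (shift_by p x) 0 = G x p" if "x \<in> K" for p x
  proof (cases "0 \<le> p")
    case True
    then show ?thesis using Gshift[OF that, of "nat p"] by simp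
  next
    case False
    have "G (shift_by (int (nat (- p))) (shift_by p x)) = (\<lambda>k. G (shift_by p x) (k + int (nat (- p))))"
      by (rule Gshift[OF shift_by_K[OF that]])
    with False have "G x = (\<lambda>k. G (shift_by p x) (k - p))" by (simp add: shift_by_add)
    then have "G x p = G (shift_by p x) (p - p)" by (rule fun_cong)
    then show ?thesis by simp
  qed
  show "x = y" if xy: "x \<in> K" "y \<in> K" and e: "\<And>k i. i < n \<Longrightarrow> G (shift_by k x) 0 i = G (shift_by k y) 0 i" for x y
  proof -
    \<comment> \<open>Cube points are \<open>undefined\<close> outside \<open>{..<n}\<close>, so
      agreement for \<open>i < n\<close> gives equality.\<close>
    have ext: "G z k \<in> extensional {..<n}" if "z \<in> K" for z k
      using continuous_map_image_subset_topspace[OF cont] that unfolding cube_shift_space_def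
      by (auto simp: PiE_def Pi_iff image_subset_iff)
    have "G x k = G y k" for k
    proof (rule extensionalityI[OF ext[OF xy(1)] ext[OF xy(2)]])
      fix i assume "i \<in> {..<n}"
      then show "G x k i = G y k i" using e[of i k] xy by (simp add: G0)
    qed
    then have "G x = G y" by blast
    with inj xy show ?thesis by (simp add: inj_on_eq_iff)
  qed
qed

text \<open>Compactness: the pairs that are far apart at time 0 but agree on window \<open>L\<close>
  form decreasing compact sets. A pair common to all of them would be distinct with identical
  coordinates along the whole orbit.\<close>

lemma finite_window_separates:
  fixes \<phi> :: "nat \<Rightarrow> (nat \<Rightarrow> real) \<Rightarrow> real"
  assumes cont: "\<And>i. i < n \<Longrightarrow> continuous_on K (\<phi> i)"
    and inj: "\<And>x y. x \<in> K \<Longrightarrow> y \<in> K \<Longrightarrow> (\<And>k i. i < n \<Longrightarrow> \<phi> i (shift_by k x) = \<phi> i (shift_by k y)) \<Longrightarrow> x = y"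
  shows "\<exists>L::nat. \<forall>x\<in>K. \<forall>y\<in>K. (\<forall>k i. \<bar>k\<bar> \<le> int L \<longrightarrow> i < n \<longrightarrow> \<phi> i (shift_by k x) = \<phi> i (shift_by k y)) \<longrightarrow>
     (\<forall>i<n. \<forall>l<3. \<bar>leg x 0 i l - leg y 0 i l\<bar> < 1 / 2)"
proof (rule ccontr)
  assume contr: "\<not> ?thesis"
  define far where "far p = Max ((\<lambda>(i, l). \<bar>leg (fst p) 0 i l - leg (snd p) 0 i l\<bar>) ` ({..<n} \<times> {..<3::nat}))" for p :: "(nat \<Rightarrow> real) \<times> (nat \<Rightarrow> real)"
  define E where "E L p = (\<Sum>k\<in>{- int L..int L}. \<Sum>i<n. \<bar>\<phi> i (shift_by k (fst p)) - \<phi> i (shift_by k (snd p))\<bar>)"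
    for L :: nat and p
  define C where "C L = {p \<in> K \<times> K. E L p = 0} \<inter> ((K \<times> K) \<inter> far -` {1/2..})" for L
  have "(0, 0) \<in> {..<n} \<times> {..<3::nat}" using n by simp
  then have ne: "{..<n} \<times> {..<3::nat} \<noteq> {}" by blast
  have cont_far: "continuous_on (K \<times> K) far"
    unfolding far_def case_prod_beta
    by (intro continuous_on_Max_image ne finite_cartesian_product finite_lessThan continuous_on_rabs continuous_on_diff
        continuous_on_compose2[OF continuous_on_crd[of UNIV]] continuous_on_fst continuous_on_snd continuous_on_id) auto
  have cont_\<phi>: "continuous_on (K \<times> K) (\<lambda>p. \<phi> i (shift_by k (fst p)))" "continuous_on (K \<times> K) (\<lambda>p. \<phi> i (shift_by k (snd p)))"
    if "i < n" for i k
    by (rule continuous_on_compose2[OF cont[OF that]],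
        intro continuous_on_compose2[OF continuous_on_shift_by[of UNIV]] continuous_on_fst continuous_on_snd continuous_on_id,
        use shift_by_K in auto)+
  have cont_E: "continuous_on (K \<times> K) (E L)" for L
    unfolding E_def by (intro continuous_on_sum continuous_on_rabs continuous_on_diff cont_\<phi>) auto
  have comp: "compact (K \<times> K)" by (intro compact_Times compact_K)
  have C: "compact (C L)" for L
  proof (rule closedin_compact[OF comp])
    show "closedin (top_of_set (K \<times> K)) (C L)"
      unfolding C_def
      by (intro closedin_Int continuous_closedin_preimage_constant continuous_closedin_preimage cont_E cont_far closed_atLeast)
  qed
  have E0: "E L p = 0 \<longleftrightarrow> (\<forall>k i. \<bar>k\<bar> \<le> int L \<longrightarrow> i < n \<longrightarrow> \<phi> i (shift_by k (fst p)) = \<phi> i (shift_by k (snd p)))" for L p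
    unfolding E_def by (subst sum_nonneg_eq_0_iff; (subst sum_nonneg_eq_0_iff)?) (auto intro!: sum_nonneg simp: abs_le_iff)
  have far_iff: "far p \<ge> 1/2 \<longleftrightarrow> (\<exists>i<n. \<exists>l<3. 1/2 \<le> \<bar>leg (fst p) 0 i l - leg (snd p) 0 i l\<bar>)" for p
    unfolding far_def using ne by (subst Max_ge_iff) auto
  have ne_C: "C L \<noteq> {}" for L
  proof -
    obtain x y where "x \<in> K" "y \<in> K" "\<forall>k i. \<bar>k\<bar> \<le> int L \<longrightarrow> i < n \<longrightarrow> \<phi> i (shift_by k x) = \<phi> i (shift_by k y)"
      "\<exists>i<n. \<exists>l<3. 1/2 \<le> \<bar>leg x 0 i l - leg y 0 i l\<bar>"
      using contr by (meson not_less)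
    then have "(x, y) \<in> C L" unfolding C_def using E0[of L "(x, y)"] far_iff[of "(x, y)"] by simp
    then show ?thesis by blast
  qed
  have mono: "C m \<subseteq> C L" if "L \<le> m" for L m
    unfolding C_def E0 using that by (auto intro: order_trans)
  have "(K \<times> K) \<inter> (\<Inter>L. C L) \<noteq> {}"
  proof (rule compact_imp_fip_image[OF comp])
    show "closed (C L)" for L by (rule compact_imp_closed[OF C])
    fix I :: "nat set" assume "finite I"
    then have "C (Max (insert 0 I)) \<subseteq> (\<Inter>L\<in>I. C L)"
      by (intro INT_greatest mono Max_ge) auto
    moreover have "C (Max (insert 0 I)) \<subseteq> K \<times> K" unfolding C_def by auto
    ultimately show "(K \<times> K) \<inter> (\<Inter>L\<in>I. C L) \<noteq> {}" using ne_C[of "Max (insert 0 I)"] by blast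
  qed
  then obtain p where p: "p \<in> (\<Inter>L. C L)" by blast
  then have pK: "fst p \<in> K" "snd p \<in> K" and far: "far p \<ge> 1/2" unfolding C_def by auto
  have "fst p = snd p"
  proof (rule inj[OF pK])
    fix k i assume "i < n"
    have "E (nat \<bar>k\<bar>) p = 0" using p unfolding C_def by blast
    then show "\<phi> i (shift_by k (fst p)) = \<phi> i (shift_by k (snd p))" unfolding E0 using \<open>i < n\<close> by simp
  qed
  with far show False unfolding far_iff by simp
qed

theorem no_equivariant_embedding:
  "\<not> (\<exists>G. equivariant_embedding (top_of_set K) (shift_by 1) (cube_shift_space n) seq_shift G)"
proof
  assume "\<exists>G. equivariant_embedding (top_of_set K) (shift_by 1) (cube_shift_space n) seq_shift G"
  then obtain G where "equivariant_embedding (top_of_set K) (shift_by 1) (cube_shift_space n) seq_shift G" ..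
  from equivariant_embedding_coordinates[OF this] obtain \<phi> :: "nat \<Rightarrow> (nat \<Rightarrow> real) \<Rightarrow> real" where
    cont: "\<And>i. i < n \<Longrightarrow> continuous_on K (\<phi> i)"
    and inj: "\<And>x y. x \<in> K \<Longrightarrow> y \<in> K \<Longrightarrow> (\<And>k i. i < n \<Longrightarrow> \<phi> i (shift_by k x) = \<phi> i (shift_by k y)) \<Longrightarrow> x = y"
    by metis
  from finite_window_separates[of \<phi>, OF cont inj] obtain L :: nat where
    L: "\<And>x y i l. x \<in> K \<Longrightarrow> y \<in> K \<Longrightarrow> (\<And>k i. \<bar>k\<bar> \<le> int L \<Longrightarrow> i < n \<Longrightarrow> \<phi> i (shift_by k x) = \<phi> i (shift_by k y)) \<Longrightarrow>
      i < n \<Longrightarrow> l < 3 \<Longrightarrow> \<bar>leg x 0 i l - leg y 0 i l\<bar> < 1 / 2"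
    by metis
  \<comment> \<open>At this level the excess \<open>j + 1\<close> exceeds the loss
    \<open>n * 2 * L\<close> at the two ends of the time interval.\<close>
  define j where "j = 2 * n * L"
  define Fr where "Fr = free_block (F j) (N j)"
  have fin: "finite Fr" unfolding Fr_def by (rule finite_free_positions[OF F_less])
  let ?I = "Fr \<times> (UNIV :: bool set)"
  \<comment> \<open>A free position in \<open>[0, N j)\<close> is seen through its window of radius
    \<open>L\<close>, so the functions are used at these times only.\<close>
  let ?J = "{- int L..<int (N j) + int L} \<times> {..<n}"
  let ?S = "sup_sphere ?I"
  have card: "card ?J < card ?I"
  proof -
    have "nat (int (N j) + int L - - int L) = N j + 2 * L" by simp
    then have "card ?J = (N j + 2 * L) * n" by (simp only: card_cartesian_product card_atLeastLessThan_int card_lessThan)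
    also have "\<dots> < n * N j + j + 1" unfolding j_def by (simp add: algebra_simps)
    also have "\<dots> \<le> 2 * card Fr" using card_free_ge[of j] unfolding Fr_def .
    also have "\<dots> = card ?I" by (simp add: card_cartesian_product)
    finally show ?thesis .
  qed
  define w where "w z = (\<lambda>k i. if (k, i) \<in> Fr then hexagon_leg (z ((k, i), True)) (z ((k, i), False)) else (\<lambda>_. 0))"
    for z :: "(int \<times> nat) \<times> bool \<Rightarrow> real"
  have wK: "family (w z) \<in> K" if "\<forall>q\<in>?I. \<bar>z q\<bar> \<le> 1" for z
  proof (rule family_K)
    fix k i
    show "triod (w z k i)"
    proof (cases "(k, i) \<in> Fr")
      case True
      then show ?thesis using that by (auto simp: w_def intro!: triod_hexagon_leg)
    qed (auto simp: w_def triod_def)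
  qed
  have contw: "continuous_on ?S (\<lambda>z. family (w z))" "continuous_on ?S (\<lambda>z. family (w (\<lambda>q. - z q)))"
  proof -
    have c: "continuous_on ?S (\<lambda>z. w (\<lambda>q. s * z q) k i l)" for s k i l
    proof (cases "(k, i) \<in> Fr")
      case True
      have "continuous_on ?S (\<lambda>z. hexagon_leg (s * z ((k, i), True)) (s * z ((k, i), False)) l)"
        by (intro continuous_on_hexagon_leg continuous_on_mult_left continuous_on_coordinate)
      then show ?thesis using True by (simp add: w_def)
    qed (simp add: w_def)
    show "continuous_on ?S (\<lambda>z. family (w z))"
      by (rule continuous_on_family) (use c[of 1] in simp)
    show "continuous_on ?S (\<lambda>z. family (w (\<lambda>q. - z q)))"
      by (rule continuous_on_family) (use c[of "-1"] in simp)
  qed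
  define f where "f z = (\<lambda>(k, i). \<phi> i (shift_by k (family (w z))) - \<phi> i (shift_by k (family (w (\<lambda>q. - z q)))))" for z
  obtain z where z: "\<And>q. q \<in> ?I \<Longrightarrow> \<bar>z q\<bar> \<le> 1" "\<exists>q\<in>?I. \<bar>z q\<bar> = 1" "\<And>q. q \<in> ?J \<Longrightarrow> f z q = 0"
  proof (rule borsuk_ulam_cube[of ?I ?J f])
    fix q assume "q \<in> ?J"
    then obtain k i where q: "q = (k, i)" "i < n" by auto
    have "continuous_on ?S (\<lambda>z. \<phi> i (shift_by k (family (w z))))"
      by (rule continuous_on_compose2[OF cont[OF q(2)] continuous_on_compose2[OF continuous_on_shift_by[of UNIV] contw(1)]])
         (use wK shift_by_K in auto)
    moreover have "continuous_on ?S (\<lambda>z. \<phi> i (shift_by k (family (w (\<lambda>q. - z q)))))"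
      by (rule continuous_on_compose2[OF cont[OF q(2)] continuous_on_compose2[OF continuous_on_shift_by[of UNIV] contw(2)]])
         (use wK shift_by_K in auto)
    ultimately show "continuous_on ?S (\<lambda>z. f z q)"
      unfolding f_def q by (auto intro!: continuous_on_diff)
  next
    fix z q
    show "f (\<lambda>q. - z q) q = - f z q" by (simp add: f_def case_prod_beta)
  qed (use fin card in auto)
  \<comment> \<open>The triod containing the extreme coordinate is where the two points are far
    apart, although all functions in its window agree.\<close>
  obtain k i b where kib: "(k, i) \<in> Fr" "\<bar>z ((k, i), b)\<bar> = 1" using z(2) by auto
  then have "\<bar>z ((k, i), True)\<bar> = 1 \<or> \<bar>z ((k, i), False)\<bar> = 1" by (cases b) auto
  from hexagon_far[OF this] obtain l where l: "l < 3" "1 / 2 \<le> \<bar>hexagon (z ((k, i), True)) (z ((k, i), False)) l\<bar>" by blast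
  let ?x = "family (w z)" and ?y = "family (w (\<lambda>q. - z q))"
  have xy: "?x \<in> K" "?y \<in> K" using wK[of z] wK[of "\<lambda>q. - z q"] z(1) by auto
  have k: "0 \<le> k" "k < int (N j)" "F j k i" and "i < n" using kib F_less unfolding Fr_def by auto
  have "\<bar>leg (shift_by k ?x) 0 i l - leg (shift_by k ?y) 0 i l\<bar> < 1 / 2"
  proof (rule L)
    fix p i' assume "\<bar>p\<bar> \<le> int L" "i' < n"
    then have "(p + k, i') \<in> ?J" using k by auto
    from z(3)[OF this] show "\<phi> i' (shift_by p (shift_by k ?x)) = \<phi> i' (shift_by p (shift_by k ?y))"
      by (simp add: f_def shift_by_add)
  qed (use xy shift_by_K l \<open>i < n\<close> in auto)
  moreover have "leg ?x k i l - leg ?y k i l = hexagon (z ((k, i), True)) (z ((k, i), False)) l"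
    using leg_family[OF \<open>i < n\<close> l(1)] never_frozen_block[OF k] kib(1) hexagon_leg_diff[OF l(1)] by (simp add: w_def)
  ultimately show False using l(2) by simp
qed

end

section \<open>Upper bound for the dynamical dimension\<close>

lemma measurable_ord_at:
  assumes M: "sets M = sets (borel_sigma (top_of_set K))" and V: "\<V> \<in> open_covers (top_of_set K)"
  shows "(\<lambda>x. of_nat (ord_at \<V> x) :: ennreal) \<in> borel_measurable M"
proof -
  have fin: "finite \<V>" and op: "\<And>V. V \<in> \<V> \<Longrightarrow> V \<in> sets M"
    using V openin_sets_borel_sigma unfolding open_covers_def M by blast+
  have "(of_nat (m - 1) :: ennreal) = of_nat m - 1" for m
    by (cases m) simp_all
  moreover have "(of_nat (card {V \<in> \<V>. x \<in> V}) :: ennreal) = (\<Sum>V\<in>\<V>. indicator V x)" for x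
    using fin by (simp add: indicator_def of_bool_def sum.If_cases Int_def)
  ultimately have "(\<lambda>x. of_nat (ord_at \<V> x) :: ennreal) = (\<lambda>x. (\<Sum>V\<in>\<V>. indicator V x) - 1)"
    unfolding ord_at_def by simp
  then show ?thesis
    using op by simp
qed

text \<open>By invariance the integral of the order equals the integral of its average along
  \<open>M\<close> iterates, which is bounded pointwise.\<close>

lemma ord_cover_le_average:
  fixes C :: nat
  assumes T: "continuous_on K T" "T ` K \<subseteq> K" and V: "\<V> \<in> open_covers (top_of_set K)"
    and M: "0 < M" and sum: "\<And>x. x \<in> K \<Longrightarrow> (\<Sum>a<M. ord_at \<V> ((T ^^ a) x)) \<le> C"
  shows "ord_cover (top_of_set K) T \<V> \<le> ennreal (real C / real M)"
  unfolding ord_cover_def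
proof (rule SUP_least)
  fix \<mu> assume "\<mu> \<in> invariant_probs (top_of_set K) T"
  then have s: "sets \<mu> = sets (borel_sigma (top_of_set K))" and p: "prob_space \<mu>" and inv: "distr \<mu> \<mu> T = \<mu>"
    by (auto simp: invariant_probs_def)
  interpret prob_space \<mu> by fact
  have sp: "space \<mu> = K" using sets_eq_imp_space_eq[OF s] space_borel_sigma by auto
  note measT = measurable_continuous_self[OF s T]
  have iter: "T ^^ a \<in> measurable \<mu> \<mu>" for a
    by (induction a) (use measurable_comp[OF _ measT] in \<open>auto simp: o_def id_def\<close>)
  define f where "f x = (of_nat (ord_at \<V> x) :: ennreal)" for x
  have f: "f \<in> borel_measurable \<mu>" unfolding f_def by (rule measurable_ord_at[OF s V])
  have int_eq: "(\<integral>\<^sup>+x. f ((T ^^ a) x) \<partial>\<mu>) = (\<integral>\<^sup>+x. f x \<partial>\<mu>)" for a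
  proof (induction a)
    case (Suc a)
    have "(\<integral>\<^sup>+x. f ((T ^^ a) x) \<partial>\<mu>) = (\<integral>\<^sup>+x. f ((T ^^ a) x) \<partial>distr \<mu> \<mu> T)" using inv by simp
    also have "\<dots> = (\<integral>\<^sup>+x. f ((T ^^ a) (T x)) \<partial>\<mu>)"
      using measurable_compose[OF iter f] by (subst nn_integral_distr[OF measT]) auto
    finally show ?case using Suc by (simp add: funpow_swap1)
  qed simp
  have "of_nat M * (\<integral>\<^sup>+x. f x \<partial>\<mu>) = (\<Sum>a<M. \<integral>\<^sup>+x. f ((T ^^ a) x) \<partial>\<mu>)"
    by (simp add: int_eq)
  also have "\<dots> = (\<integral>\<^sup>+x. (\<Sum>a<M. f ((T ^^ a) x)) \<partial>\<mu>)"
    using measurable_compose[OF iter f] by (intro nn_integral_sum[symmetric])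
  also have "\<dots> \<le> (\<integral>\<^sup>+x. of_nat C \<partial>\<mu>)"
  proof (rule nn_integral_mono)
    fix x assume "x \<in> space \<mu>"
    then have "of_nat (\<Sum>a<M. ord_at \<V> ((T ^^ a) x)) \<le> (of_nat C :: ennreal)" using sum sp by (intro of_nat_mono) auto
    then show "(\<Sum>a<M. f ((T ^^ a) x)) \<le> of_nat C" by (simp add: f_def)
  qed
  also have "\<dots> = of_nat C" by (simp add: emeasure_space_1)
  finally have le: "of_nat M * (\<integral>\<^sup>+x. f x \<partial>\<mu>) \<le> of_nat C" .
  then have "(\<integral>\<^sup>+x. f x \<partial>\<mu>) \<noteq> Orderings.top" using M by (auto simp: ennreal_mult_top top_unique)
  then obtain r where r: "0 \<le> r" "(\<integral>\<^sup>+x. f x \<partial>\<mu>) = ennreal r" by (cases "\<integral>\<^sup>+x. f x \<partial>\<mu>") auto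
  have "ennreal (real M * r) \<le> ennreal (real C)"
    using le r by (simp add: ennreal_mult ennreal_of_nat_eq_real_of_nat)
  then have "r \<le> real C / real M" using M by (simp add: ennreal_le_iff field_simps)
  then show "(\<integral>\<^sup>+x. of_nat (ord_at \<V> x) \<partial>\<mu>) \<le> ennreal (real C / real M)"
    using r(2) unfolding f_def by (simp add: ennreal_leI)
qed

section \<open>Walls that move with the phase\<close>

context triod_system
begin

text \<open>On \<open>K\<close> the marker at time \<open>- a\<close> takes only the values 0 and 1,
  so having phase \<open>a\<close> is the open condition that it exceeds \<open>1/2\<close>.\<close>

lemma openin_phase: "openin (top_of_set K) (K \<inter> A j a)"
proof -
  have "K \<inter> A j a = K \<inter> (\<lambda>x. marker x (- a) j) -` {1/2<..}"
  proof (intro equalityI subsetI)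
    fix x assume x: "x \<in> K \<inter> A j a"
    then have "marker x (- a) j = 1" using A_marker[of x j a j "- a"] by simp
    with x show "x \<in> K \<inter> (\<lambda>x. marker x (- a) j) -` {1/2<..}" by simp
  next
    fix x assume x: "x \<in> K \<inter> (\<lambda>x. marker x (- a) j) -` {1/2<..}"
    then have "x \<in> K" by simp
    then obtain b where b: "x \<in> A j b" unfolding K_iff by blast
    have "int (N j) dvd - a + b"
      using A_marker[OF b order_refl, of "- a"] x by (cases "int (N j) dvd b - a") simp_all
    then have "int (N j) dvd a - b" by (metis dvd_minus_iff minus_add_distrib minus_minus uminus_add_conv_diff add.commute)
    then have "x \<in> A j (b + (a - b))" using A_add_period_subset b by blast
    with x show "x \<in> K \<inter> A j a" by simp
  qed
  then show ?thesis
    using continuous_openin_preimage_gen[OF continuous_on_crd open_greaterThan] by metis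
qed

text \<open>Equivalently Q y - (a + 1/2) / M is within 1 / (2 M) of an integer: at phase a the walls are the
  points y = (m + (a + 1/2) / M) / Q.\<close>

definition wall_hit :: "nat \<Rightarrow> nat \<Rightarrow> int \<Rightarrow> real \<Rightarrow> bool" where
  "wall_hit M Q a y \<longleftrightarrow> (\<exists>m::int. of_int (int M * m + a) < real M * real Q * y \<and> real M * real Q * y < of_int (int M * m + a) + 1)"

text \<open>A hit at phase \<open>a\<close> makes the floor of \<open>M * Q * y\<close> congruent to
  \<open>a\<close> modulo \<open>M\<close>. Thus the wall neighbourhoods of different phases are
  disjoint, and a fixed value meets walls at one phase at most.\<close>

lemma wall_hit_phase:
  assumes "wall_hit M Q a y" "wall_hit M Q b y" shows "int M dvd a - b"
proof -
  have "\<exists>m. \<lfloor>real M * real Q * y\<rfloor> = int M * m + c" if "wall_hit M Q c y" for c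
    using that unfolding wall_hit_def by (metis floor_unique less_imp_le of_int_add of_int_1)
  from this[OF assms(1)] this[OF assms(2)] obtain m m' where "int M * m + a = int M * m' + b" by metis
  then have "a - b = int M * (m' - m)" by (simp add: algebra_simps)
  then show ?thesis by simp
qed

text \<open>Wall neighbourhoods are open intervals between consecutive integers in the scale of
  \<open>M * Q * y\<close>, so the centre of the triod is avoided. Hence at most one leg can
  hit.\<close>

lemma not_wall_hit_0: "\<not> wall_hit M Q a 0"
proof
  assume "wall_hit M Q a 0"
  then obtain z :: int where "of_int z < (0::real)" "(0::real) < of_int z + 1"
    unfolding wall_hit_def mult_zero_right by blast
  moreover from this(2) have "(0::real) < of_int (z + 1)" by simp
  ultimately have "z < 0" "0 < z + 1" by (simp_all only: of_int_less_0_iff of_int_0_less_iff)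
  then show False by linarith
qed

abbreviation hits :: "nat \<Rightarrow> nat \<Rightarrow> nat \<Rightarrow> int \<Rightarrow> (nat \<Rightarrow> real) \<Rightarrow> (int \<times> nat \<times> nat) set" where
  "hits L Q j a x \<equiv> {(k, i, l). \<bar>k\<bar> \<le> int L \<and> l < 3 \<and> F j (k + a) i \<and> wall_hit (N j) Q a (leg x k i l)}"

definition phase_cover :: "nat \<Rightarrow> nat \<Rightarrow> nat \<Rightarrow> int \<Rightarrow> (nat \<Rightarrow> real) set set \<Rightarrow> bool" where
  "phase_cover L Q j a \<V> \<longleftrightarrow> finite \<V> \<and> (\<forall>V\<in>\<V>. openin (top_of_set K) V) \<and> \<Union>\<V> = K \<inter> A j a \<and>
     (\<forall>V\<in>\<V>. \<forall>x\<in>V. \<forall>y\<in>V. \<forall>k i l. \<bar>k\<bar> \<le> int L \<longrightarrow> i < n \<longrightarrow> l < 3 \<longrightarrow> \<bar>leg x k i l - leg y k i l\<bar> \<le> 1 / real Q) \<and>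
     (\<forall>x\<in>K \<inter> A j a. card {V \<in> \<V>. x \<in> V} \<le>
       Suc (card (hits L Q j a x)))"

lemma phase_cover_finite: "phase_cover L Q j a \<V> \<Longrightarrow> finite \<V>"
  and phase_cover_openin: "phase_cover L Q j a \<V> \<Longrightarrow> V \<in> \<V> \<Longrightarrow> openin (top_of_set K) V"
  and phase_cover_Union: "phase_cover L Q j a \<V> \<Longrightarrow> \<Union>\<V> = K \<inter> A j a"
  and phase_cover_close: "phase_cover L Q j a \<V> \<Longrightarrow> V \<in> \<V> \<Longrightarrow> x \<in> V \<Longrightarrow> y \<in> V \<Longrightarrow>
     \<bar>k\<bar> \<le> int L \<Longrightarrow> i < n \<Longrightarrow> l < 3 \<Longrightarrow> \<bar>leg x k i l - leg y k i l\<bar> \<le> 1 / real Q"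
  and phase_cover_card: "phase_cover L Q j a \<V> \<Longrightarrow> x \<in> K \<inter> A j a \<Longrightarrow> card {V \<in> \<V>. x \<in> V} \<le>
       Suc (card (hits L Q j a x))"
  unfolding phase_cover_def by simp_all

text \<open>\<open>layered_cover\<close> for the free legs in the window, rescaled so that the walls
  of phase \<open>a\<close> become the integers: variation below 1 in \<open>u\<close> is variation
  below \<open>1 / Q\<close> in the leg. Frozen legs need no control because two points of equal
  phase agree there.\<close>

lemma phase_cover_exists:
  assumes "0 < Q" "a \<in> {0..<int (N j)}"
  shows "\<exists>\<V>. phase_cover L Q j a \<V>"
proof -
  let ?P = "{(k, i, l). \<bar>k\<bar> \<le> int L \<and> l < (3::nat) \<and> F j (k + a) i}"
  let ?KA = "K \<inter> A j a"
  define u where "u = (\<lambda>(k, i, l) x. real Q * leg x k i l - (real_of_int a + 1/2) / real (N j))"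
  have fin: "finite ?P"
    by (rule finite_subset[of _ "{- int L..int L} \<times> {..<n} \<times> {..<3}"]) (use F_less in auto)
  have Np: "0 < real (N j)" using N_pos by simp
  have frac: "0 \<le> (real_of_int a + 1/2) / real (N j)" "(real_of_int a + 1/2) / real (N j) \<le> 1"
  proof -
    have "real_of_int a + 1 \<le> real (N j)" "0 \<le> real_of_int a" using assms(2) by auto
    then show "0 \<le> (real_of_int a + 1/2) / real (N j)" "(real_of_int a + 1/2) / real (N j) \<le> 1" using Np by auto
  qed
  have cont: "continuous_on ?KA (u p)" for p
    unfolding u_def by (cases p) (auto intro!: continuous_intros)
  have bound: "\<bar>u p x\<bar> \<le> real Q + 1" if "x \<in> ?KA" for p x
  proof -
    obtain k i l where p: "p = (k, i, l)" by (cases p)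
    have "0 \<le> leg x k i l" "leg x k i l \<le> 1" using that K_crd_bounds by auto
    then have "0 \<le> real Q * leg x k i l" "real Q * leg x k i l \<le> real Q"
      by (auto intro: mult_nonneg_nonneg mult_left_le)
    then show ?thesis using frac unfolding p u_def by (simp add: abs_le_iff)
  qed
  have r: "0 < 1 / (2 * real (N j))" using Np by simp
  show ?thesis
  proof (rule layered_cover[where P = ?P and K = ?KA and u = u and B = "real Q + 1" and r = "1 / (2 * real (N j))", OF fin cont bound r])
    fix \<V> assume V: "finite \<V>" "\<And>V. V \<in> \<V> \<Longrightarrow> openin (top_of_set ?KA) V" "\<Union>\<V> = ?KA"
      "\<And>V x y p. V \<in> \<V> \<Longrightarrow> x \<in> V \<Longrightarrow> y \<in> V \<Longrightarrow> p \<in> ?P \<Longrightarrow> \<bar>u p x - u p y\<bar> < 1"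
      "\<And>x. x \<in> ?KA \<Longrightarrow> card {V \<in> \<V>. x \<in> V} \<le> Suc (card {p \<in> ?P. \<exists>m::int. \<bar>u p x - of_int m\<bar> < 1 / (2 * real (N j))})"
    have "phase_cover L Q j a \<V>"
      unfolding phase_cover_def
    proof (intro conjI ballI allI impI V(1) V(3))
      show "openin (top_of_set K) V" if "V \<in> \<V>" for V
        using openin_trans[OF V(2)[OF that] openin_phase] .
      show "\<bar>leg x k i l - leg y k i l\<bar> \<le> 1 / real Q" if "V \<in> \<V>" "x \<in> V" "y \<in> V" "\<bar>k\<bar> \<le> int L" "i < n" "l < 3" for V x y k i l
      proof (cases "F j (k + a) i")
        case True
        have "\<bar>u (k, i, l) x - u (k, i, l) y\<bar> < 1" using V(4)[OF that(1-3), of "(k, i, l)"] True that(4,6) by simp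
        then have "\<bar>real Q * (leg x k i l - leg y k i l)\<bar> \<le> 1" unfolding u_def by (simp add: right_diff_distrib)
        then have "real Q * \<bar>leg x k i l - leg y k i l\<bar> \<le> 1" by (simp add: abs_mult)
        then show ?thesis using assms(1) by (simp add: pos_le_divide_eq mult.commute)
      next
        case False
        have xy: "x \<in> A j a" "y \<in> A j a" using V(3) that(1-3) by auto
        show ?thesis
          unfolding A_frozen[OF xy(1) that(5) False that(6)] A_frozen[OF xy(2) that(5) False that(6)] by simp
      qed
      show "card {V \<in> \<V>. x \<in> V} \<le>
         Suc (card (hits L Q j a x))" if x: "x \<in> ?KA" for x
      proof -
        have "{p \<in> ?P. \<exists>m::int. \<bar>u p x - of_int m\<bar> < 1 / (2 * real (N j))}
            \<subseteq> hits L Q j a x"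
        proof
          fix p assume "p \<in> {p \<in> ?P. \<exists>m::int. \<bar>u p x - of_int m\<bar> < 1 / (2 * real (N j))}"
          then obtain k i l m where p: "p = (k, i, l)" "\<bar>k\<bar> \<le> int L" "l < 3" "F j (k + a) i"
            and m: "\<bar>u p x - of_int m\<bar> < 1 / (2 * real (N j))" by auto
          have "real (N j) * \<bar>u p x - of_int m\<bar> < 1 / 2"
            using m Np by (simp add: field_simps)
          then have "\<bar>real (N j) * (u p x - of_int m)\<bar> < 1 / 2" by (simp add: abs_mult)
          moreover have "real (N j) * (u p x - of_int m) = real (N j) * real Q * leg x k i l - (of_int (int (N j) * m + a) + 1/2)"
            using Np unfolding p(1) u_def by (simp add: field_simps)
          ultimately have "wall_hit (N j) Q a (leg x k i l)"
            unfolding wall_hit_def by (intro exI[of _ m]) linarith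
          with p show "p \<in> hits L Q j a x" by simp
        qed
        moreover have "finite (hits L Q j a x)"
          by (rule finite_subset[OF _ fin]) auto
        ultimately have "card {p \<in> ?P. \<exists>m::int. \<bar>u p x - of_int m\<bar> < 1 / (2 * real (N j))}
            \<le> card (hits L Q j a x)"
          by (rule card_mono[rotated])
        with V(5)[OF x] show ?thesis by linarith
      qed
    qed
    then show ?thesis ..
  qed
qed

text \<open>A hit seen at time \<open>a\<close> at offset \<open>k\<close> is charged to the
  position \<open>(k + int a, i)\<close>. The charge is injective: the two previous lemmas determine
  the leg and then the phase, hence \<open>a\<close>. The charged positions are the free ones of a
  full period and at most \<open>n\<close> for each of the \<open>2 * L\<close> times beyond its
  ends.\<close>

lemma sum_wall_hits_le:
  assumes x: "x \<in> A j \<theta>"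
  shows "(\<Sum>a<N j. card {(k, i, l). \<bar>k\<bar> \<le> int L \<and> l < 3 \<and> F j (k + (\<theta> + int a)) i \<and>
       wall_hit (N j) Q ((\<theta> + int a) mod int (N j)) (leg x (k + int a) i l)})
     \<le> card (free_block (F j) (N j)) + 2 * L * n"
proof -
  define S where "S a = {(k, i, l). \<bar>k\<bar> \<le> int L \<and> l < (3::nat) \<and> F j (k + (\<theta> + int a)) i \<and>
       wall_hit (N j) Q ((\<theta> + int a) mod int (N j)) (leg x (k + int a) i l)}" for a
  have fin: "finite (S a)" for a
    unfolding S_def by (rule finite_subset[of _ "{- int L..int L} \<times> {..<n} \<times> {..<3}"]) (use F_less in auto)
  let ?D = "SIGMA a:{..<N j}. S a"
  let ?g = "\<lambda>(a, k, i, l :: nat). (k + int a, i)"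
  let ?mid = "{(q, i). 0 \<le> q \<and> q < int (N j) \<and> F j (q + \<theta>) i}"
  let ?edge = "({- int L..<0} \<union> {int (N j)..<int (N j) + int L}) \<times> {..<n}"
  have finmid: "finite ?mid"
    by (rule finite_free_positions[where F = "\<lambda>q. F j (q + \<theta>)"]) (use F_less in auto)
  have inj: "inj_on ?g ?D"
  proof (rule inj_onI)
    fix d d' assume d: "d \<in> ?D" "d' \<in> ?D" "?g d = ?g d'"
    obtain a k i l where d1: "d = (a, k, i, l)" by (cases d)
    obtain a' k' i' l' where d2: "d' = (a', k', i', l')" by (cases d')
    let ?q = "k + int a"
    have e: "k' + int a' = ?q" "i' = i" using d(3) unfolding d1 d2 by auto
    have h: "a < N j" "l < 3" "F j (k + (\<theta> + int a)) i" "wall_hit (N j) Q ((\<theta> + int a) mod int (N j)) (leg x ?q i l)"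
      using d(1) unfolding d1 S_def by auto
    have h': "a' < N j" "l' < 3" "wall_hit (N j) Q ((\<theta> + int a') mod int (N j)) (leg x ?q i l')"
      using d(2) e unfolding d2 S_def by auto
    have "leg x ?q i l \<noteq> 0" "leg x ?q i l' \<noteq> 0"
      using h(4) h'(3) not_wall_hit_0 by metis+
    then have l: "l = l'" using A_triod[OF x F_less[OF h(3)] h(2) h'(2)] by blast
    have "int (N j) dvd (\<theta> + int a) mod int (N j) - (\<theta> + int a') mod int (N j)"
      using wall_hit_phase[OF h(4)] h'(3) l by blast
    then have "(\<theta> + int a) mod int (N j) = (\<theta> + int a') mod int (N j)"
      by (simp flip: mod_eq_dvd_iff)
    then have "int (N j) dvd int a - int a'" by (simp add: mod_eq_dvd_iff)
    moreover have "\<bar>int a - int a'\<bar> < int (N j)" using h(1) h'(1) by linarith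
    ultimately have "a = a'" using dvd_imp_le_int[of "int a - int a'" "int (N j)"] by fastforce
    then show "d = d'" using e l unfolding d1 d2 by simp
  qed
  have img: "?g ` ?D \<subseteq> ?mid \<union> ?edge"
  proof
    fix r assume "r \<in> ?g ` ?D"
    then obtain a k i l where r: "r = (k + int a, i)" "a < N j" "\<bar>k\<bar> \<le> int L" "F j (k + (\<theta> + int a)) i"
      unfolding S_def by auto
    have "F j ((k + int a) + \<theta>) i" using r(4) by (simp add: algebra_simps)
    then show "r \<in> ?mid \<union> ?edge" using r F_less[OF r(4)] by auto
  qed
  have "(\<Sum>a<N j. card (S a)) = card ?D" using fin by simp
  also have "\<dots> = card (?g ` ?D)" by (rule card_image[OF inj, symmetric])
  also have "\<dots> \<le> card (?mid \<union> ?edge)" by (rule card_mono[OF _ img]) (use finmid in auto)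
  also have "\<dots> \<le> card ?mid + card ?edge" by (rule card_Un_le)
  also have "card ?edge = 2 * L * n"
  proof -
    have "card ({- int L..<0} \<union> {int (N j)..<int (N j) + int L}) = 2 * L"
      by (subst card_Un_disjoint) auto
    then show ?thesis by (simp only: card_cartesian_product card_lessThan)
  qed
  also have "card ?mid \<le> card (free_block (F j) (N j))"
  proof (rule card_inj_on_le)
    show "inj_on (\<lambda>(q, i). ((q + \<theta>) mod int (N j), i)) ?mid"
    proof (rule inj_onI)
      fix r r' assume r: "r \<in> ?mid" "r' \<in> ?mid"
        and e: "(\<lambda>(q, i). ((q + \<theta>) mod int (N j), i)) r = (\<lambda>(q, i). ((q + \<theta>) mod int (N j), i)) r'"
      obtain q i q' i' where rr: "r = (q, i)" "r' = (q', i')" by (cases r, cases r')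
      have "(q + \<theta>) mod int (N j) = (q' + \<theta>) mod int (N j)" and i: "i = i'"
        using e unfolding rr by auto
      then have "q mod int (N j) = q' mod int (N j)" by (simp add: mod_eq_dvd_iff)
      then show "r = r'" using r i unfolding rr by simp
    qed
    show "(\<lambda>(q, i). ((q + \<theta>) mod int (N j), i)) ` ?mid \<subseteq> free_block (F j) (N j)"
      using N_pos[of j] F_mod[of j] by auto
    show "finite (free_block (F j) (N j))"
      by (rule finite_free_positions[OF F_less])
  qed
  finally show ?thesis unfolding S_def by simp
qed

text \<open>A Lebesgue number turns refinement into closeness on a finite window of times and
  tracks. Covers of the individual phases are glued; since phases are disjoint, a point is covered
  only by sets of its own phase. The condition \<open>L \<le> j\<close> makes the phase fix every
  marker in the window.\<close>

lemma fine_cover: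
  assumes U: "\<U> \<in> open_covers (top_of_set K)"
  obtains L :: nat where "\<And>j. L \<le> j \<Longrightarrow> \<exists>\<V>\<in>open_covers (top_of_set K). refines \<V> \<U> \<and>
      ord_cover (top_of_set K) (shift_by 1) \<V> \<le>
        ennreal (real (card (free_block (F j) (N j)) + 2 * L * n) / real (N j))"
proof -
  have "\<forall>W\<in>\<U>. \<exists>B. open B \<and> W = K \<inter> B" using U by (auto simp: open_covers_def openin_open)
  then obtain B where B: "\<And>W. W \<in> \<U> \<Longrightarrow> open (B W) \<and> W = K \<inter> B W" by metis
  have "K \<subseteq> \<Union>(B ` \<U>)"
  proof
    fix x assume "x \<in> K"
    then obtain W where "W \<in> \<U>" "x \<in> W" using U by (auto simp: open_covers_def)
    then show "x \<in> \<Union>(B ` \<U>)" using B[of W] by blast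
  qed
  then obtain e where e: "0 < e" "\<And>x. x \<in> K \<Longrightarrow> \<exists>G\<in>B ` \<U>. ball x e \<subseteq> G"
    using Heine_Borel_lemma[OF compact_K] B by (metis (no_types, lifting) imageE)
  obtain L :: nat and \<delta> :: real where \<delta>: "0 < \<delta>"
    and close: "\<And>x y. (\<forall>k c. \<bar>k\<bar> \<le> int L \<longrightarrow> c < L \<longrightarrow> \<bar>crd x k c - crd y k c\<bar> \<le> \<delta>) \<Longrightarrow> dist x y < e"
    using dist_less_if_window_close[OF e(1)] by blast
  obtain q :: nat where q: "1 / real (Suc q) < \<delta>" using nat_approx_posE[OF \<delta>] by blast
  define Q where "Q = Suc q"
  have Q: "0 < Q" "1 / real Q \<le> \<delta>" using q by (auto simp: Q_def)
  show ?thesis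
  proof (rule that[of L])
    fix j assume j: "L \<le> j"
    have "\<forall>a. \<exists>\<V>. a \<in> {0..<int (N j)} \<longrightarrow> phase_cover L Q j a \<V>"
      using phase_cover_exists[OF Q(1)] by blast
    from choice[OF this] obtain W where W: "\<And>a. a \<in> {0..<int (N j)} \<Longrightarrow> phase_cover L Q j a (W a)" by blast
    define \<V> where "\<V> = (\<Union>a\<in>{0..<int (N j)}. W a)"
    have V: "\<V> \<in> open_covers (top_of_set K)"
      unfolding open_covers_def
    proof (intro CollectI conjI ballI)
      show "finite \<V>" unfolding \<V>_def using phase_cover_finite[OF W] by blast
      show "openin (top_of_set K) V" if "V \<in> \<V>" for V
      proof -
        from that obtain a where "a \<in> {0..<int (N j)}" "V \<in> W a" unfolding \<V>_def by blast
        then show ?thesis using phase_cover_openin[OF W] by blast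
      qed
      have "\<Union>\<V> = (\<Union>a\<in>{0..<int (N j)}. \<Union>(W a))" unfolding \<V>_def by blast
      also have "\<dots> = (\<Union>a\<in>{0..<int (N j)}. K \<inter> A j a)" using phase_cover_Union[OF W] by simp
      also have "\<dots> = K" unfolding K_def by blast
      finally show "\<Union>\<V> = topspace (top_of_set K)" by simp
    qed
    have ref: "refines \<V> \<U>"
      unfolding refines_def
    proof
      fix V assume "V \<in> \<V>"
      then obtain a where a: "a \<in> {0..<int (N j)}" "V \<in> W a" unfolding \<V>_def by blast
      note g = W[OF a(1)]
      have VA: "V \<subseteq> K \<inter> A j a" using phase_cover_Union[OF g] a(2) by blast
      show "\<exists>U\<in>\<U>. V \<subseteq> U"
      proof (cases "V = {}")
        case True
        have "\<U> \<noteq> {}" using U K_nonempty by (auto simp: open_covers_def)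
        with True show ?thesis by blast
      next
        case False
        then obtain x where x: "x \<in> V" by blast
        have "dist x y < e" if y: "y \<in> V" for y
        proof (rule close, intro allI impI)
          fix k and c :: nat assume k: "\<bar>k\<bar> \<le> int L" and c: "c < L"
          show "\<bar>crd x k c - crd y k c\<bar> \<le> \<delta>"
          proof (cases "c < 3 * n")
            case True
            have "\<bar>leg x k (c div 3) (c mod 3) - leg y k (c div 3) (c mod 3)\<bar> \<le> 1 / real Q"
              by (rule phase_cover_close[OF g a(2) x y k]) (use True in auto)
            then show ?thesis using Q(2) by simp
          next
            case False
            have "x \<in> A j a" "y \<in> A j a" using VA x y by auto
            from this[THEN A_marker, of "c - 3 * n" k] False c j \<delta> show ?thesis by simp
          qed
        qed
        then have "V \<subseteq> K \<inter> ball x e" using VA by auto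
        moreover obtain U where "U \<in> \<U>" "ball x e \<subseteq> B U" using e(2)[of x] VA x by blast
        ultimately show ?thesis using B by blast
      qed
    qed
    have "ord_cover (top_of_set K) (shift_by 1) \<V> \<le>
        ennreal (real (card (free_block (F j) (N j)) + 2 * L * n) / real (N j))"
    proof (rule ord_cover_le_average[OF continuous_on_shift_by _ V N_pos])
      fix x assume x: "x \<in> K"
      then obtain \<theta> where \<theta>: "x \<in> A j \<theta>" unfolding K_iff by blast
      have "ord_at \<V> ((shift_by 1 ^^ a) x) \<le> card {(k, i, l). \<bar>k\<bar> \<le> int L \<and> l < 3 \<and> F j (k + (\<theta> + int a)) i \<and>
         wall_hit (N j) Q ((\<theta> + int a) mod int (N j)) (leg x (k + int a) i l)}" for a
      proof -
        let ?y = "shift_by (int a) x" and ?b = "(\<theta> + int a) mod int (N j)"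
        have y: "?y \<in> K \<inter> A j ?b" using shift_by_K[OF x] shift_by_A[OF \<theta>, of "int a"] A_mod by blast
        have b: "?b \<in> {0..<int (N j)}" using N_pos[of j] by simp
        note g = W[OF b]
        have "{V \<in> \<V>. ?y \<in> V} = {V \<in> W ?b. ?y \<in> V}"
        proof (intro equalityI subsetI)
          fix V assume "V \<in> {V \<in> \<V>. ?y \<in> V}"
          then obtain b' where b': "b' \<in> {0..<int (N j)}" "V \<in> W b'" "?y \<in> V" unfolding \<V>_def by blast
          then have "?y \<in> A j b'" using phase_cover_Union[OF W[OF b'(1)]] by blast
          then have "int (N j) dvd b' - ?b" using A_phase_unique y by blast
          then have "b' mod int (N j) = ?b mod int (N j)" by (simp only: mod_eq_dvd_iff)
          then have "b' = ?b" using b' b by simp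
          with b' show "V \<in> {V \<in> W ?b. ?y \<in> V}" by blast
        qed (use b in \<open>auto simp: \<V>_def\<close>)
        then have "card {V \<in> \<V>. ?y \<in> V} \<le> Suc (card {(k, i, l). \<bar>k\<bar> \<le> int L \<and> l < 3 \<and> F j (k + ?b) i \<and> wall_hit (N j) Q ?b (leg ?y k i l)})"
          using phase_cover_card[OF g y] by (simp only:)
        moreover have "F j (k + ?b) i = F j (k + (\<theta> + int a)) i" for k i
          using F_mod[of j "k + ?b" i] F_mod[of j "k + (\<theta> + int a)" i] by (simp add: mod_simps)
        ultimately show ?thesis
          by (simp add: ord_at_def shift_by_funpow)
      qed
      then have "(\<Sum>a<N j. ord_at \<V> ((shift_by 1 ^^ a) x)) \<le> (\<Sum>a<N j. card {(k, i, l). \<bar>k\<bar> \<le> int L \<and> l < 3 \<and> F j (k + (\<theta> + int a)) i \<and>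
         wall_hit (N j) Q ((\<theta> + int a) mod int (N j)) (leg x (k + int a) i l)})"
        by (intro sum_mono)
      also note sum_wall_hits_le[OF \<theta>]
      finally show "(\<Sum>a<N j. ord_at \<V> ((shift_by 1 ^^ a) x)) \<le> card (free_block (F j) (N j)) + 2 * L * n" .
    qed (use shift_by_K in auto)
    with V ref show "\<exists>\<V>\<in>open_covers (top_of_set K). refines \<V> \<U> \<and>
      ord_cover (top_of_set K) (shift_by 1) \<V> \<le>
        ennreal (real (card (free_block (F j) (N j)) + 2 * L * n) / real (N j))" by blast
  qed
qed

theorem dyn_dim_le: "dyn_dim (top_of_set K) (shift_by 1) \<le> ennreal (real n / 2)"
  unfolding dyn_dim_def
proof (rule SUP_least)
  fix \<U> assume U: "\<U> \<in> open_covers (top_of_set K)"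
  obtain L :: nat where L: "\<And>j. L \<le> j \<Longrightarrow> \<exists>\<V>\<in>open_covers (top_of_set K). refines \<V> \<U> \<and>
      ord_cover (top_of_set K) (shift_by 1) \<V> \<le>
        ennreal (real (card (free_block (F j) (N j)) + 2 * L * n) / real (N j))"
    by (rule fine_cover[OF U]) blast
  show "dyn_dim_cover (top_of_set K) (shift_by 1) \<U> \<le> ennreal (real n / 2)"
  proof (rule ennreal_le_epsilon)
    fix \<epsilon> :: real assume \<epsilon>: "0 < \<epsilon>"
    \<comment> \<open>The density exceeds \<open>n / 2\<close> by at most \<open>1 / Suc j\<close>,
      and the window ends cost at most \<open>2 * L * n / Suc j\<close>; their sum has to stay below
      \<open>\<epsilon>\<close>.\<close>
    obtain j0 :: nat where j0: "1 / real (Suc j0) < \<epsilon> / (1 + 2 * real L * real n)"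
      using nat_approx_posE[of "\<epsilon> / (1 + 2 * real L * real n)"] \<epsilon> by (metis add_pos_nonneg divide_pos_pos mult_nonneg_nonneg of_nat_0_le_iff zero_le_numeral zero_less_one)
    define j where "j = max j0 L"
    define c where "c = card (free_block (F (Suc j)) (N (Suc j)))"
    have j: "L \<le> Suc j" "j0 \<le> j" unfolding j_def by auto
    have Np: "0 < real (N (Suc j))" using N_pos by simp
    have Nj: "real (Suc j) \<le> real (N (Suc j))" using N_ge[of "Suc j"] by simp
    from L[OF j(1)] obtain \<V> where V: "\<V> \<in> open_covers (top_of_set K)" "refines \<V> \<U>"
      "ord_cover (top_of_set K) (shift_by 1) \<V> \<le> ennreal (real (c + 2 * L * n) / real (N (Suc j)))"
      unfolding c_def by blast
    have "real (2 * c * Suc j) \<le> real ((n * Suc j + 1) * N (Suc j))"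
      using card_free_Suc_le[of j] unfolding c_def of_nat_le_iff .
    then have "2 * real c * real (Suc j) \<le> (real n * real (Suc j) + 1) * real (N (Suc j))"
      by (simp only: of_nat_mult of_nat_add of_nat_numeral of_nat_1)
    then have "real c / real (N (Suc j)) \<le> (real n * real (Suc j) + 1) / (2 * real (Suc j))"
      using Np by (simp add: field_simps del: of_nat_Suc)
    also have "\<dots> \<le> real n / 2 + 1 / real (Suc j)"
      by (simp add: field_simps del: of_nat_Suc)
    finally have 1: "real c / real (N (Suc j)) \<le> real n / 2 + 1 / real (Suc j)" .
    have "2 * real L * real n / real (N (Suc j)) \<le> 2 * real L * real n / real (Suc j)"
      using Nj by (intro divide_left_mono) auto
    with 1 have "real (c + 2 * L * n) / real (N (Suc j)) \<le> real n / 2 + (1 + 2 * real L * real n) * (1 / real (Suc j))"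
      by (simp add: add_divide_distrib del: of_nat_Suc)
    also have "(1 + 2 * real L * real n) * (1 / real (Suc j)) \<le> (1 + 2 * real L * real n) * (\<epsilon> / (1 + 2 * real L * real n))"
    proof (rule mult_left_mono)
      have "1 / real (Suc j) \<le> 1 / real (Suc j0)" using j(2) by (intro divide_left_mono) auto
      with j0 show "1 / real (Suc j) \<le> \<epsilon> / (1 + 2 * real L * real n)" by linarith
    qed simp
    also have "\<dots> = \<epsilon>"
    proof -
      have "0 \<le> 2 * real L * real n" by simp
      then have "1 + 2 * real L * real n \<noteq> 0" by linarith
      then show ?thesis by simp
    qed
    finally have "ennreal (real (c + 2 * L * n) / real (N (Suc j))) \<le> ennreal (real n / 2 + \<epsilon>)"
      by (intro ennreal_leI) simp
    also have "\<dots> = ennreal (real n / 2) + ennreal \<epsilon>" using \<epsilon> by (intro ennreal_plus) auto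
    finally have "ord_cover (top_of_set K) (shift_by 1) \<V> \<le> ennreal (real n / 2) + ennreal \<epsilon>"
      using V(3) by (rule order_trans[rotated])
    moreover have "dyn_dim_cover (top_of_set K) (shift_by 1) \<U> \<le> ord_cover (top_of_set K) (shift_by 1) \<V>"
      unfolding dyn_dim_cover_def using V by (intro INF_lower) auto
    ultimately show "dyn_dim_cover (top_of_set K) (shift_by 1) \<U> \<le> ennreal (real n / 2) + ennreal \<epsilon>"
      by (rule order_trans[rotated])
  qed
qed

end

section \<open>Lower bound for the dynamical dimension\<close>

text \<open>If the conclusion fails, then on each of the finitely many supports the map built from the signs c
  takes values in a hyperplane; moving the target 0 to a generic point contradicts Poincare--Miranda.\<close>

lemma product_covering:
  fixes Fr :: "('k \<times> 'i) set" and \<phi> :: "'k \<Rightarrow> 'v \<Rightarrow> ('k \<times> 'i \<Rightarrow> real) \<Rightarrow> real" and c :: "'i \<Rightarrow> 'v \<Rightarrow> real"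
  defines "cube \<equiv> sup_cube Fr"
  assumes fin: "finite T" "finite \<V>" "finite Fr" "fst ` Fr \<subseteq> T"
    and cont: "\<And>k V. k \<in> T \<Longrightarrow> V \<in> \<V> \<Longrightarrow> continuous_on cube (\<phi> k V)"
    and nonneg: "\<And>k V y. k \<in> T \<Longrightarrow> V \<in> \<V> \<Longrightarrow> y \<in> cube \<Longrightarrow> 0 \<le> \<phi> k V y"
    and unity: "\<And>k y. k \<in> T \<Longrightarrow> y \<in> cube \<Longrightarrow> (\<Sum>V\<in>\<V>. \<phi> k V y) = 1"
    and top: "\<And>k i V y. (k, i) \<in> Fr \<Longrightarrow> V \<in> \<V> \<Longrightarrow> y \<in> cube \<Longrightarrow> y (k, i) = 1 \<Longrightarrow> 0 < \<phi> k V y \<Longrightarrow> c i V = 1"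
    and bot: "\<And>k i V y. (k, i) \<in> Fr \<Longrightarrow> V \<in> \<V> \<Longrightarrow> y \<in> cube \<Longrightarrow> y (k, i) = - 1 \<Longrightarrow> 0 < \<phi> k V y \<Longrightarrow> c i V = - 1"
  obtains y where "y \<in> cube" "card Fr + card T \<le> (\<Sum>k\<in>T. card {V \<in> \<V>. 0 < \<phi> k V y})"
proof -
  \<comment> \<open>The finitely many patterns of non-empty supports that would violate the claimed
    bound.\<close>
  define configs where "configs = {s. (\<forall>k. (k \<in> T \<longrightarrow> s k \<in> Pow \<V> - {{}}) \<and> (k \<notin> T \<longrightarrow> s k = {})) \<and>
      (\<Sum>k\<in>T. card (s k)) < card Fr + card T}"
  have "finite {s. \<forall>k. (k \<in> T \<longrightarrow> s k \<in> Pow \<V> - {{}}) \<and> (k \<notin> T \<longrightarrow> s k = {})}"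
    using fin by (intro finite_set_of_finite_funs) auto
  then have fin_configs: "finite configs" unfolding configs_def by (rule rev_finite_subset) auto
  \<comment> \<open>The pair is a hyperplane with non-zero normal vector. Its block \<open>k\<close>
    has the same value \<open>b k\<close> at the sign vectors of all sets in \<open>s k\<close>,
    hence also at their convex combinations.\<close>
  define solves where "solves s ab \<longleftrightarrow> (\<exists>p\<in>Fr. fst ab p \<noteq> 0) \<and>
      (\<exists>b. snd ab = (\<Sum>k\<in>T. b k) \<and> (\<forall>k\<in>T. \<forall>V\<in>s k. (\<Sum>p\<in>Fr. if fst p = k then fst ab p * c (snd p) V else 0) = b k))"
    for s :: "'k \<Rightarrow> 'v set" and ab :: "('k \<times> 'i \<Rightarrow> real) \<times> real"
  have "\<exists>ab. solves s ab" if s: "s \<in> configs" for s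
  proof -
    \<comment> \<open>Unknowns are the coefficients on \<open>Fr\<close> and the constants on
      \<open>T\<close>, with one equation for each pair of a time and a set in its support. A
      violating pattern has fewer equations than unknowns.\<close>
    let ?I = "Inl ` Fr \<union> Inr ` T :: ('k \<times> 'i + 'k) set"
    let ?E = "SIGMA k:T. s k"
    have sV: "finite (s k)" if "k \<in> T" for k
      using s that fin(2) unfolding configs_def by (metis (mono_tags, lifting) DiffD1 PowD finite_subset mem_Collect_eq)
    have finE: "finite ?E" using fin(1) sV by auto
    have "card ?E = (\<Sum>k\<in>T. card (s k))" using fin(1) sV by (intro card_SigmaI) auto
    also have "\<dots> < card Fr + card T" using s unfolding configs_def by blast
    also have "\<dots> = card ?I"
      using fin by (subst card_Un_disjoint) (auto simp: card_image)
    finally have lt: "card ?E < card ?I" .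
    define coef :: "'k \<times> 'v \<Rightarrow> 'k \<times> 'i + 'k \<Rightarrow> real" where "coef = (\<lambda>(k, V) q. case q of Inl p \<Rightarrow> if fst p = k then c (snd p) V else 0 | Inr k' \<Rightarrow> if k' = k then - 1 else (0::real))"
    have finI: "finite ?I" using fin by auto
    obtain x where x: "\<exists>q\<in>?I. x q \<noteq> 0" "\<And>e. e \<in> ?E \<Longrightarrow> (\<Sum>q\<in>?I. coef e q * x q) = 0"
      using underdetermined_system_solvable[OF finI finE lt, of coef] by blast
    have eqn: "(\<Sum>p\<in>Fr. if fst p = k then x (Inl p) * c (snd p) V else 0) = x (Inr k)" if "k \<in> T" "V \<in> s k" for k V
    proof -
      have "0 = (\<Sum>q\<in>?I. coef (k, V) q * x q)" using x(2)[of "(k, V)"] that by simp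
      also have "\<dots> = (\<Sum>q\<in>Inl ` Fr. coef (k, V) q * x q) + (\<Sum>q\<in>Inr ` T. coef (k, V) q * x q)"
        using fin by (intro sum.union_disjoint) auto
      also have "(\<Sum>q\<in>Inl ` Fr. coef (k, V) q * x q) = (\<Sum>p\<in>Fr. if fst p = k then x (Inl p) * c (snd p) V else 0)"
        by (subst sum.reindex) (auto simp: coef_def intro!: sum.cong)
      also have "(\<Sum>q\<in>Inr ` T. coef (k, V) q * x q) = (\<Sum>k'\<in>T. if k' = k then - x (Inr k) else 0)"
        by (subst sum.reindex) (auto simp: coef_def intro!: sum.cong)
      also have "\<dots> = - x (Inr k)" using fin(1) that(1) by simp
      finally show ?thesis by simp
    qed
    \<comment> \<open>If all coefficients vanished, each constant would vanish too, as every
      \<open>s k\<close> is non-empty and so contributes an equation.\<close>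
    have "\<exists>p\<in>Fr. x (Inl p) \<noteq> 0"
    proof (rule ccontr)
      assume "\<not> ?thesis"
      then have z: "x (Inl p) = 0" if "p \<in> Fr" for p using that by blast
      have "x (Inr k) = 0" if k: "k \<in> T" for k
      proof -
        obtain V where "V \<in> s k" using s k unfolding configs_def by blast
        from eqn[OF k this] show ?thesis using z by (simp cong: if_cong)
      qed
      with z x(1) show False by auto
    qed
    then have "solves s (\<lambda>p. x (Inl p), \<Sum>k\<in>T. x (Inr k))"
      unfolding solves_def fst_conv snd_conv by (intro conjI exI[of _ "\<lambda>k. x (Inr k)"] ballI eqn refl)
    then show ?thesis by blast
  qed
  then obtain ab where ab: "\<And>s. s \<in> configs \<Longrightarrow> solves s (ab s)" by metis
  obtain \<delta> where \<delta>: "\<And>p. p \<in> Fr \<Longrightarrow> \<bar>\<delta> p\<bar> < 1" "\<And>a b. (a, b) \<in> ab ` configs \<Longrightarrow> (\<Sum>p\<in>Fr. a p * \<delta> p) \<noteq> b"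
  proof (rule generic_point[OF fin(3), of "ab ` configs"])
    fix a b assume "(a, b) \<in> ab ` configs"
    then show "\<exists>p\<in>Fr. a p \<noteq> 0" using ab unfolding solves_def by (metis fst_conv imageE)
  qed (use fin_configs in auto)
  define g :: "('k \<times> 'i \<Rightarrow> real) \<Rightarrow> 'k \<times> 'i \<Rightarrow> real" where "g y p = (\<Sum>V\<in>\<V>. c (snd p) V * \<phi> (fst p) V y)" for y p
  have g1: "g y p = s" if "y \<in> cube" "p \<in> Fr" "\<And>V. V \<in> \<V> \<Longrightarrow> 0 < \<phi> (fst p) V y \<Longrightarrow> c (snd p) V = s" for y p s
  proof -
    have k: "fst p \<in> T" using fin(4) that(2) by auto
    have "g y p = (\<Sum>V\<in>\<V>. s * \<phi> (fst p) V y)"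
      unfolding g_def
    proof (rule sum.cong[OF refl])
      fix V assume V: "V \<in> \<V>"
      show "c (snd p) V * \<phi> (fst p) V y = s * \<phi> (fst p) V y"
        using that(3)[OF V] nonneg[OF k V that(1)] by (cases "\<phi> (fst p) V y = 0") auto
    qed
    also have "\<dots> = s" using unity[OF k that(1)] by (simp flip: sum_distrib_left)
    finally show ?thesis .
  qed
  obtain y where y: "\<And>p. p \<notin> Fr \<Longrightarrow> y p = 0" "\<And>p. p \<in> Fr \<Longrightarrow> \<bar>y p\<bar> \<le> 1" "\<And>p. p \<in> Fr \<Longrightarrow> g y p - \<delta> p = 0"
  proof (rule poincare_miranda[OF fin(3), of "\<lambda>y p. g y p - \<delta> p"])
    fix p assume p: "p \<in> Fr"
    then have "fst p \<in> T" using fin(4) by auto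
    then show "continuous_on (sup_cube Fr) (\<lambda>y. g y p - \<delta> p)"
      using cont unfolding g_def cube_def[symmetric] by (intro continuous_intros)
  next
    fix y :: "'k \<times> 'i \<Rightarrow> real" and p assume p: "p \<in> Fr" and y: "\<forall>i. i \<notin> Fr \<longrightarrow> y i = 0" "\<forall>i\<in>Fr. \<bar>y i\<bar> \<le> 1" "y p = 1"
    then have yc: "y \<in> cube" unfolding cube_def by blast
    have "g y p = 1" by (rule g1[OF yc p]) (use top[of "fst p" "snd p"] p y yc in auto)
    then show "0 < g y p - \<delta> p" using \<delta>(1)[OF p] by linarith
  next
    fix y :: "'k \<times> 'i \<Rightarrow> real" and p assume p: "p \<in> Fr" and y: "\<forall>i. i \<notin> Fr \<longrightarrow> y i = 0" "\<forall>i\<in>Fr. \<bar>y i\<bar> \<le> 1" "y p = - 1"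
    then have yc: "y \<in> cube" unfolding cube_def by blast
    have "g y p = - 1" by (rule g1[OF yc p]) (use bot[of "fst p" "snd p"] p y yc in auto)
    then show "g y p - \<delta> p < 0" using \<delta>(1)[OF p] by linarith
  qed (rule that)
  then have yc: "y \<in> cube" unfolding cube_def by blast
  define s where "s k = (if k \<in> T then {V \<in> \<V>. 0 < \<phi> k V y} else {})" for k
  \<comment> \<open>Otherwise the supports at \<open>y\<close> form a violating pattern, and
    \<open>\<delta>\<close>, which equals \<open>g y\<close> on \<open>Fr\<close>, would lie on the
    hyperplane of that pattern.\<close>
  have "card Fr + card T \<le> (\<Sum>k\<in>T. card (s k))"
  proof (rule ccontr)
    assume "\<not> ?thesis"
    moreover have "s k \<noteq> {}" if "k \<in> T" for k
    proof
      assume "s k = {}"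
      then have "\<phi> k V y \<le> 0" if "V \<in> \<V>" for V using that \<open>k \<in> T\<close> by (force simp: s_def)
      then have "(\<Sum>V\<in>\<V>. \<phi> k V y) \<le> 0" by (intro sum_nonpos) auto
      with unity[OF that yc] show False by simp
    qed
    ultimately have s: "s \<in> configs" unfolding configs_def by (auto simp: s_def)
    obtain a b0 where a: "ab s = (a, b0)" by (cases "ab s")
    from ab[OF s] obtain b where b: "b0 = (\<Sum>k\<in>T. b k)"
      "\<And>k V. k \<in> T \<Longrightarrow> V \<in> s k \<Longrightarrow> (\<Sum>p\<in>Fr. if fst p = k then a p * c (snd p) V else 0) = b k"
      unfolding solves_def a fst_conv snd_conv by blast
    have "(\<Sum>p\<in>Fr. a p * \<delta> p) = (\<Sum>p\<in>Fr. a p * g y p)" using y(3) by (intro sum.cong) auto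
    also have "\<dots> = (\<Sum>p\<in>Fr. \<Sum>k\<in>T. if fst p = k then a p * (\<Sum>V\<in>s k. c (snd p) V * \<phi> k V y) else 0)"
    proof (rule sum.cong[OF refl])
      fix p assume p: "p \<in> Fr"
      then have k: "fst p \<in> T" using fin(4) by auto
      have "g y p = (\<Sum>V\<in>s (fst p). c (snd p) V * \<phi> (fst p) V y)"
        unfolding g_def
      proof (rule sum.mono_neutral_right)
        show "\<forall>V\<in>\<V> - s (fst p). c (snd p) V * \<phi> (fst p) V y = 0"
          using nonneg[OF k _ yc] k by (force simp: s_def)
      qed (use fin k in \<open>auto simp: s_def\<close>)
      then show "a p * g y p = (\<Sum>k\<in>T. if fst p = k then a p * (\<Sum>V\<in>s k. c (snd p) V * \<phi> k V y) else 0)"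
        using k fin(1) by simp
    qed
    also have "\<dots> = (\<Sum>k\<in>T. \<Sum>p\<in>Fr. \<Sum>V\<in>s k. (if fst p = k then a p * c (snd p) V else 0) * \<phi> k V y)"
      by (subst sum.swap) (intro sum.cong refl, auto simp: sum_distrib_left mult.assoc)
    also have "\<dots> = (\<Sum>k\<in>T. \<Sum>V\<in>s k. b k * \<phi> k V y)"
    proof (rule sum.cong[OF refl])
      fix k assume k: "k \<in> T"
      have "(\<Sum>p\<in>Fr. \<Sum>V\<in>s k. (if fst p = k then a p * c (snd p) V else 0) * \<phi> k V y)
          = (\<Sum>V\<in>s k. (\<Sum>p\<in>Fr. if fst p = k then a p * c (snd p) V else 0) * \<phi> k V y)"
        by (subst sum.swap) (simp add: sum_distrib_right)
      also have "\<dots> = (\<Sum>V\<in>s k. b k * \<phi> k V y)" by (intro sum.cong refl) (simp add: b(2)[OF k])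
      finally show "(\<Sum>p\<in>Fr. \<Sum>V\<in>s k. (if fst p = k then a p * c (snd p) V else 0) * \<phi> k V y) = (\<Sum>V\<in>s k. b k * \<phi> k V y)" .
    qed
    also have "\<dots> = (\<Sum>k\<in>T. b k)"
    proof (rule sum.cong[OF refl])
      fix k assume k: "k \<in> T"
      have "(\<Sum>V\<in>s k. \<phi> k V y) = (\<Sum>V\<in>\<V>. \<phi> k V y)"
        using nonneg[OF k _ yc] fin(2) k by (intro sum.mono_neutral_left) (force simp: s_def)+
      then show "(\<Sum>V\<in>s k. b k * \<phi> k V y) = b k" using unity[OF k yc] by (simp flip: sum_distrib_left)
    qed
    finally have "(\<Sum>p\<in>Fr. a p * \<delta> p) = b0" using b(1) by simp
    moreover have "(a, b0) \<in> ab ` configs" using s a by force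
    ultimately show False using \<delta>(2) by blast
  qed
  then show ?thesis using yc by (intro that[of y]) (auto simp: s_def)
qed

text \<open>On \<open>K\<close>, \<open>\<psi> V\<close> is a continuous function between the
  indicators of \<open>0 < \<phi> V x\<close> and of \<open>V\<close>, so that order can be tested
  by weak limits. With \<open>\<rho>\<close> the distance to the complement, compactness gives
  \<open>\<eta>\<close> such that some \<open>\<rho> V x\<close> is at least
  \<open>2 * \<eta>\<close> everywhere; \<open>\<phi>\<close> normalises the positive part of
  \<open>\<rho> - \<eta>\<close>, and \<open>\<psi>\<close> truncates \<open>\<rho> / \<eta>\<close>
  at 1.\<close>

lemma partition_with_plateaus:
  fixes K :: "'a::metric_space set"
  assumes K: "compact K" "K \<noteq> {}" and V: "finite \<V>" "\<And>V. V \<in> \<V> \<Longrightarrow> openin (top_of_set K) V" "\<Union>\<V> = K"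
  obtains \<phi> \<psi> :: "'a set \<Rightarrow> 'a \<Rightarrow> real" where
    "\<And>V. V \<in> \<V> \<Longrightarrow> continuous_on K (\<phi> V)" "\<And>V. V \<in> \<V> \<Longrightarrow> continuous_on K (\<psi> V)"
    "\<And>V x. 0 \<le> \<phi> V x" "\<And>x. x \<in> K \<Longrightarrow> (\<Sum>V\<in>\<V>. \<phi> V x) = 1"
    "\<And>V x. 0 \<le> \<psi> V x" "\<And>V x. \<psi> V x \<le> 1" "\<And>V x. 0 < \<phi> V x \<Longrightarrow> \<psi> V x = 1"
    "\<And>V x. V \<in> \<V> \<Longrightarrow> x \<in> K \<Longrightarrow> 0 < \<psi> V x \<Longrightarrow> x \<in> V"
proof -
  \<comment> \<open>The distance to an empty set is 0 by convention, so the case of empty complement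
    gets the value 1.\<close>
  define \<rho> where "\<rho> V x = (if K - V = {} then 1 else infdist x (K - V))" for V and x :: 'a
  have \<rho>0: "0 \<le> \<rho> V x" for V x by (simp add: \<rho>_def infdist_nonneg)
  have cont\<rho>: "continuous_on S (\<rho> V)" for S V
    by (cases "K - V = {}") (auto simp: \<rho>_def intro!: continuous_intros)
  have pos: "0 < \<rho> V x \<longleftrightarrow> x \<in> V" if "V \<in> \<V>" "x \<in> K" for V x
  proof (cases "K - V = {}")
    case True
    then show ?thesis using that by (auto simp: \<rho>_def)
  next
    case False
    have "closedin (top_of_set K) (K - V)" using V(2)[OF that(1)] by (simp add: closedin_diff)
    then have "closed (K - V)" using K closedin_closed_trans compact_imp_closed by blast
    from in_closed_iff_infdist_zero[OF this False, of x] show ?thesis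
      using False that(2) infdist_nonneg[of x "K - V"] unfolding \<rho>_def by (auto simp: less_le)
  qed
  have "\<V> \<noteq> {}" using V K by auto
  define m where "m x = Max ((\<lambda>V. \<rho> V x) ` \<V>)" for x
  have contm: "continuous_on K m"
    unfolding m_def by (intro continuous_on_Max_image V \<open>\<V> \<noteq> {}\<close> cont\<rho>)
  obtain z where z: "z \<in> K" "\<And>x. x \<in> K \<Longrightarrow> m z \<le> m x"
    using continuous_attains_inf[OF K contm] by blast
  define \<eta> where "\<eta> = m z / 2"
  obtain Vz where "Vz \<in> \<V>" "z \<in> Vz" using z V by blast
  then have "0 < \<rho> Vz z" "\<rho> Vz z \<le> m z"
    unfolding m_def using pos z(1) V(1) by auto
  then have \<eta>: "0 < \<eta>" by (simp add: \<eta>_def)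
  have big: "\<exists>V\<in>\<V>. 2 * \<eta> \<le> \<rho> V x" if "x \<in> K" for x
  proof -
    have "m x \<in> (\<lambda>V. \<rho> V x) ` \<V>" unfolding m_def using V(1) \<open>\<V> \<noteq> {}\<close> by (intro Max_in) auto
    then obtain V where "V \<in> \<V>" "m x = \<rho> V x" by blast
    then show ?thesis using z(2)[OF that] unfolding \<eta>_def by (intro bexI[of _ V]) auto
  qed
  define \<phi>0 where "\<phi>0 V x = max 0 (\<rho> V x - \<eta>)" for V x
  have \<phi>0: "0 \<le> \<phi>0 V x" for V x by (simp add: \<phi>0_def)
  have sum_pos: "0 < (\<Sum>V\<in>\<V>. \<phi>0 V x)" if x: "x \<in> K" for x
  proof -
    obtain V where V': "V \<in> \<V>" "2 * \<eta> \<le> \<rho> V x" using big[OF x] by blast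
    then have "0 < \<phi>0 V x" using \<eta> by (simp add: \<phi>0_def)
    then show ?thesis using V(1) V'(1) \<phi>0 by (intro sum_pos2) auto
  qed
  define \<phi> where "\<phi> V x = \<phi>0 V x / (\<Sum>V\<in>\<V>. \<phi>0 V x)" for V x
  define \<psi> where "\<psi> V x = min 1 (\<rho> V x / \<eta>)" for V x
  have cont\<phi>0: "continuous_on K (\<phi>0 V)" for V
    unfolding \<phi>0_def by (intro continuous_intros cont\<rho>)
  show ?thesis
  proof (rule that[of \<phi> \<psi>])
    show "continuous_on K (\<phi> V)" for V
      unfolding \<phi>_def
    proof (rule continuous_on_divide)
      show "continuous_on K (\<lambda>x. \<Sum>V\<in>\<V>. \<phi>0 V x)" by (intro continuous_on_sum cont\<phi>0)
      show "\<forall>x\<in>K. (\<Sum>V\<in>\<V>. \<phi>0 V x) \<noteq> 0" using sum_pos by (metis less_irrefl)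
    qed (rule cont\<phi>0)
    show "continuous_on K (\<psi> V)" for V
      unfolding \<psi>_def using \<eta> by (intro continuous_intros cont\<rho>) auto
    show "0 \<le> \<phi> V x" for V x unfolding \<phi>_def using \<phi>0 by (intro divide_nonneg_nonneg sum_nonneg) auto
    show "(\<Sum>V\<in>\<V>. \<phi> V x) = 1" if "x \<in> K" for x
      unfolding \<phi>_def using sum_pos[OF that] by (simp flip: sum_divide_distrib)
    show "0 \<le> \<psi> V x" "\<psi> V x \<le> 1" for V x unfolding \<psi>_def using \<rho>0 \<eta> by auto
    show "\<psi> V x = 1" if "0 < \<phi> V x" for V x
    proof -
      have "\<phi>0 V x \<noteq> 0" using that by (auto simp: \<phi>_def)
      then have "\<eta> \<le> \<rho> V x" by (simp add: \<phi>0_def max_def split: if_splits)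
      then show ?thesis using \<eta> by (simp add: \<psi>_def)
    qed
    show "x \<in> V" if "V \<in> \<V>" "x \<in> K" "0 < \<psi> V x" for V x
    proof -
      have "0 < \<rho> V x" using that(3) \<eta> by (simp add: \<psi>_def zero_less_divide_iff)
      then show ?thesis using pos that by blast
    qed
  qed
qed

section \<open>Orbits and measures of large order\<close>

context triod_system
begin

text \<open>Only leg 0 enters: an interval in each free triod already forces the order. A set of a
  refinement cannot contain points with values 0 and 1 on leg 0 of the same coordinate.\<close>

definition leg_set :: "nat set \<Rightarrow> (nat \<Rightarrow> real) set" where
  "leg_set S = {x \<in> K. (\<forall>i\<in>S. leg x 0 i 0 < 2/3) \<and> (\<forall>i\<in>{..<n} - S. 1/3 < leg x 0 i 0)}"

definition leg_cover :: "(nat \<Rightarrow> real) set set" where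
  "leg_cover = leg_set ` Pow {..<n}"

lemma leg_cover: "leg_cover \<in> open_covers (top_of_set K)"
  unfolding open_covers_def
proof (intro CollectI conjI ballI)
  show "finite leg_cover" unfolding leg_cover_def by simp
  fix U assume "U \<in> leg_cover"
  then obtain S where S: "S \<subseteq> {..<n}" and U: "U = leg_set S"
    unfolding leg_cover_def by blast
  have "finite S" using S finite_subset by blast
  have "open ((\<Inter>i\<in>S. {x. leg x 0 i 0 < 2/3}) \<inter> (\<Inter>i\<in>{..<n} - S. {x. 1/3 < leg x 0 i 0}))"
    using \<open>finite S\<close> by (intro open_Int open_INT ballI open_Collect_less continuous_on_crd continuous_on_const) auto
  moreover have "U = K \<inter> ((\<Inter>i\<in>S. {x. leg x 0 i 0 < 2/3}) \<inter> (\<Inter>i\<in>{..<n} - S. {x. 1/3 < leg x 0 i 0}))"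
    unfolding U leg_set_def by blast
  ultimately show "openin (top_of_set K) U" unfolding openin_open by blast
next
  show "\<Union>leg_cover = topspace (top_of_set K)"
  proof (intro equalityI subsetI)
    fix x assume "x \<in> topspace (top_of_set K)"
    then have "x \<in> leg_set {i. i < n \<and> leg x 0 i 0 < 2/3}"
      by (auto simp: leg_set_def)
    moreover have "{i. i < n \<and> leg x 0 i 0 < 2/3} \<in> Pow {..<n}" by auto
    ultimately show "x \<in> \<Union>leg_cover" unfolding leg_cover_def by blast
  qed (auto simp: leg_cover_def leg_set_def)
qed

lemma card_free_nat:
  "card {(k, i). k < N j \<and> F j (int k) i} = card (free_block (F j) (N j))"
proof (rule bij_betw_same_card)
  show "bij_betw (\<lambda>(k, i). (int k, i)) {(k, i). k < N j \<and> F j (int k) i} (free_block (F j) (N j))"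
    by (rule bij_betw_byWitness[where f' = "\<lambda>(k, i). (nat k, i)"]) auto
qed

text \<open>The cube coordinate \<open>y (k, i)\<close> is placed on leg 0 as
  \<open>(1 + y (k, i)) / 2\<close>, and \<open>V\<close> gets the sign \<open>- 1\<close> at
  \<open>i\<close> if \<open>i \<in> S V\<close>. Value 1 on the leg excludes
  \<open>i \<in> S V\<close> and value 0 forces it, which are the face conditions of
  \<open>product_covering\<close>.\<close>

lemma orbit_with_large_order:
  fixes \<phi> :: "(nat \<Rightarrow> real) set \<Rightarrow> (nat \<Rightarrow> real) \<Rightarrow> real"
  assumes V: "finite \<V>" "refines \<V> leg_cover"
    and cont: "\<And>V. V \<in> \<V> \<Longrightarrow> continuous_on K (\<phi> V)" and nonneg: "\<And>V x. 0 \<le> \<phi> V x"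
    and unity: "\<And>x. x \<in> K \<Longrightarrow> (\<Sum>V\<in>\<V>. \<phi> V x) = 1"
    and supp: "\<And>V x. V \<in> \<V> \<Longrightarrow> x \<in> K \<Longrightarrow> 0 < \<phi> V x \<Longrightarrow> x \<in> V"
  shows "\<exists>x\<in>K. card (free_block (F j) (N j)) + N j \<le>
     (\<Sum>k<N j. card {V \<in> \<V>. 0 < \<phi> V (shift_by (int k) x)})"
proof -
  have "\<exists>S. V \<subseteq> leg_set S" if "V \<in> \<V>" for V
    using V(2) that unfolding refines_def leg_cover_def by blast
  then obtain S where S: "\<And>V. V \<in> \<V> \<Longrightarrow> V \<subseteq> leg_set (S V)"
    by metis
  define Fr where "Fr = {(k, i). k < N j \<and> F j (int k) i}"
  have finFr: "finite Fr"
    unfolding Fr_def by (rule finite_subset[of _ "{..<N j} \<times> {..<n}"]) (use F_less in auto)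
  let ?cube = "sup_cube Fr"
  define w where "w y = (\<lambda>k i (l::nat). if 0 \<le> k \<and> (nat k, i) \<in> Fr \<and> l = 0 then (1 + y (nat k, i)) / 2 else 0)" for y :: "nat \<times> nat \<Rightarrow> real"
  have wK: "family (w y) \<in> K" if "y \<in> ?cube" for y
  proof (rule family_K)
    fix k i
    have "\<bar>y (nat k, i)\<bar> \<le> 1" if "(nat k, i) \<in> Fr" using \<open>y \<in> ?cube\<close> that by blast
    then show "triod (w y k i)" unfolding triod_def w_def by (auto simp: abs_le_iff)
  qed
  have contw: "continuous_on ?cube (\<lambda>y. family (w y))"
  proof (rule continuous_on_family)
    fix k i l
    show "continuous_on ?cube (\<lambda>y. w y k i l)"
      unfolding w_def by (cases "0 \<le> k \<and> (nat k, i) \<in> Fr \<and> l = 0") (auto intro!: continuous_intros continuous_on_coordinate)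
  qed
  let ?z = "\<lambda>k y. shift_by (int k) (family (w y))"
  have leg_w: "leg (?z k y) 0 i 0 = (1 + y (k, i)) / 2" if "(k, i) \<in> Fr" for k i y
  proof -
    have F: "F j (int k) i" "k < N j" "i < n" using that F_less unfolding Fr_def by auto
    then have "never_frozen (int k) i" using never_frozen_block[of "int k" j i] by simp
    then show ?thesis using leg_family[OF F(3), of 0 "w y" "int k"] that by (simp add: w_def)
  qed
  have shK: "?z k y \<in> K" if "y \<in> ?cube" for k y
    by (rule shift_by_K[OF wK[OF that]])
  obtain y where y: "y \<in> ?cube"
    "card Fr + card {..<N j} \<le> (\<Sum>k<N j. card {V \<in> \<V>. 0 < \<phi> V (?z k y)})"
  proof (rule product_covering[where T = "{..<N j}" and \<V> = \<V> and Fr = Fr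
        and \<phi> = "\<lambda>k V y. \<phi> V (?z k y)" and c = "\<lambda>i V. if i \<in> S V then - 1 else 1"])
    show "continuous_on ?cube (\<lambda>y. \<phi> V (?z k y))" if "V \<in> \<V>" for k V
      by (rule continuous_on_compose2[OF cont[OF that] continuous_on_compose2[OF continuous_on_shift_by[of UNIV] contw]])
         (use shK in auto)
    show "(\<Sum>V\<in>\<V>. \<phi> V (?z k y)) = 1" if "y \<in> ?cube" for k y
      by (rule unity[OF shK[OF that]])
    show "(if i \<in> S V then - 1 else 1) = (1::real)"
      if "(k, i) \<in> Fr" "V \<in> \<V>" "y \<in> ?cube" "y (k, i) = 1" "0 < \<phi> V (?z k y)" for k i V y
    proof -
      have "?z k y \<in> V" by (rule supp[OF that(2) shK[OF that(3)] that(5)])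
      then have "\<forall>i\<in>S V. leg (?z k y) 0 i 0 < 2/3" using S[OF that(2)] unfolding leg_set_def by blast
      then have "i \<notin> S V" using leg_w[OF that(1), of y] that(4) by auto
      then show ?thesis by simp
    qed
    show "(if i \<in> S V then - 1 else 1) = (- 1::real)"
      if "(k, i) \<in> Fr" "V \<in> \<V>" "y \<in> ?cube" "y (k, i) = - 1" "0 < \<phi> V (?z k y)" for k i V y
    proof -
      have "?z k y \<in> V" by (rule supp[OF that(2) shK[OF that(3)] that(5)])
      then have "\<forall>i\<in>{..<n} - S V. 1/3 < leg (?z k y) 0 i 0" using S[OF that(2)] unfolding leg_set_def by blast
      moreover have "i < n" using that(1) F_less unfolding Fr_def by auto
      ultimately have "i \<notin> S V \<Longrightarrow> 1/3 < leg (?z k y) 0 i 0" by blast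
      then have "i \<in> S V" using leg_w[OF that(1), of y] that(4) by auto
      then show ?thesis by simp
    qed
    show "fst ` Fr \<subseteq> {..<N j}" unfolding Fr_def by auto
  qed (use V(1) finFr nonneg in auto)
  then show ?thesis
    using wK[OF y(1)] card_free_nat[of j] unfolding Fr_def by (intro bexI[of _ "family (w y)"]) auto
qed

text \<open>The continuous function \<open>h\<close> lies between the number of sets with
  \<open>0 < \<phi> V x\<close>, minus 1, and the order. Its orbit averages over \<open>N j\<close>
  steps are thus at least the free density, which is at least \<open>n / 2\<close>, and
  \<open>krylov_bogoliubov\<close> passes this bound to an invariant measure.\<close>

lemma ord_cover_ge:
  assumes V: "\<V> \<in> open_covers (top_of_set K)" "refines \<V> leg_cover"
  shows "ennreal (real n / 2) \<le> ord_cover (top_of_set K) (shift_by 1) \<V>"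
proof -
  have V': "finite \<V>" "\<And>V. V \<in> \<V> \<Longrightarrow> openin (top_of_set K) V" "\<Union>\<V> = K"
    using V(1) by (auto simp: open_covers_def)
  show ?thesis
  proof (rule partition_with_plateaus[OF compact_K K_nonempty V'])
    fix \<phi> \<psi> :: "(nat \<Rightarrow> real) set \<Rightarrow> (nat \<Rightarrow> real) \<Rightarrow> real"
    assume cont: "\<And>V. V \<in> \<V> \<Longrightarrow> continuous_on K (\<phi> V)" "\<And>V. V \<in> \<V> \<Longrightarrow> continuous_on K (\<psi> V)"
      and \<phi>0: "\<And>V x. 0 \<le> \<phi> V x" and unity: "\<And>x. x \<in> K \<Longrightarrow> (\<Sum>V\<in>\<V>. \<phi> V x) = 1"
      and \<psi>: "\<And>V x. 0 \<le> \<psi> V x" "\<And>V x. \<psi> V x \<le> 1" "\<And>V x. 0 < \<phi> V x \<Longrightarrow> \<psi> V x = 1"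
      and supp: "\<And>V x. V \<in> \<V> \<Longrightarrow> x \<in> K \<Longrightarrow> 0 < \<psi> V x \<Longrightarrow> x \<in> V"
    define h where "h x = (\<Sum>V\<in>\<V>. \<psi> V x) - 1" for x
    have cont_h: "continuous_on K h" unfolding h_def by (intro continuous_intros cont)
    have h_ge: "real (card {V \<in> \<V>. 0 < \<phi> V x}) - 1 \<le> h x" for x
    proof -
      have "real (card {V \<in> \<V>. 0 < \<phi> V x}) = (\<Sum>V\<in>{V \<in> \<V>. 0 < \<phi> V x}. \<psi> V x)" using \<psi>(3) by simp
      also have "\<dots> \<le> (\<Sum>V\<in>\<V>. \<psi> V x)" using V'(1) \<psi>(1) by (intro sum_mono2) auto
      finally show ?thesis by (simp add: h_def)
    qed
    have h_nonneg: "0 \<le> h x" if "x \<in> K" for x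
    proof -
      have "{V \<in> \<V>. 0 < \<phi> V x} \<noteq> {}"
      proof
        assume "{V \<in> \<V>. 0 < \<phi> V x} = {}"
        then have "(\<Sum>V\<in>\<V>. \<phi> V x) \<le> 0" by (intro sum_nonpos) (auto simp: not_less)
        with unity[OF that] show False by simp
      qed
      then have "1 \<le> card {V \<in> \<V>. 0 < \<phi> V x}" using V'(1) by (simp add: Suc_le_eq card_gt_0_iff)
      then show ?thesis using h_ge[of x] by linarith
    qed
    have h_le: "h x \<le> real (ord_at \<V> x)" if "x \<in> K" for x
    proof -
      have "(\<Sum>V\<in>\<V>. \<psi> V x) = (\<Sum>V\<in>{V \<in> \<V>. x \<in> V}. \<psi> V x)"
        using V'(1) supp[OF _ that] \<psi>(1) by (intro sum.mono_neutral_right) (auto simp: less_le)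
      also have "\<dots> \<le> real (card {V \<in> \<V>. x \<in> V}) * 1" using \<psi>(2) by (intro sum_bounded_above) auto
      finally have le: "(\<Sum>V\<in>\<V>. \<psi> V x) \<le> real (card {V \<in> \<V>. x \<in> V})" by simp
      have "{V \<in> \<V>. x \<in> V} \<noteq> {}" using that V'(3) by auto
      then have "1 \<le> card {V \<in> \<V>. x \<in> V}" using V'(1) by (simp add: Suc_le_eq card_gt_0_iff)
      then show ?thesis using le by (simp add: h_def ord_at_def of_nat_diff)
    qed
    have "\<exists>x\<in>K. real n / 2 * real (N j) \<le> (\<Sum>k<N j. h ((shift_by 1 ^^ k) x))" for j
    proof -
      have "\<And>V x. V \<in> \<V> \<Longrightarrow> x \<in> K \<Longrightarrow> 0 < \<phi> V x \<Longrightarrow> x \<in> V" using supp \<psi>(3) by simp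
      from orbit_with_large_order[OF V'(1) V(2) cont(1) \<phi>0 unity this, of j] obtain x where x: "x \<in> K"
        "card (free_block (F j) (N j)) + N j \<le> (\<Sum>k<N j. card {V \<in> \<V>. 0 < \<phi> V (shift_by (int k) x)})"
        by blast
      have "real (n * N j) \<le> real (2 * card (free_block (F j) (N j)))"
        using card_free_ge[of j] unfolding of_nat_le_iff by linarith
      moreover have "real (card (free_block (F j) (N j)) + N j) \<le> real (\<Sum>k<N j. card {V \<in> \<V>. 0 < \<phi> V (shift_by (int k) x)})"
        using x(2) unfolding of_nat_le_iff .
      moreover have "real (\<Sum>k<N j. card {V \<in> \<V>. 0 < \<phi> V (shift_by (int k) x)}) - real (N j) = (\<Sum>k<N j. real (card {V \<in> \<V>. 0 < \<phi> V (shift_by (int k) x)}) - 1)"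
        by (simp add: sum_subtractf)
      moreover have "\<dots> \<le> (\<Sum>k<N j. h ((shift_by 1 ^^ k) x))"
        unfolding shift_by_funpow by (intro sum_mono h_ge)
      ultimately have "real n / 2 * real (N j) \<le> (\<Sum>k<N j. h ((shift_by 1 ^^ k) x))" by simp
      with x(1) show ?thesis by blast
    qed
    then obtain x where x: "\<And>j. x j \<in> K" "\<And>j. real n / 2 * real (N j) \<le> (\<Sum>k<N j. h ((shift_by 1 ^^ k) (x j)))"
      by metis
    have Ninf: "filterlim N at_top sequentially"
      by (rule filterlim_at_top_mono[OF filterlim_ident]) (rule always_eventually, use N_ge less_imp_le in blast)
    have shK: "shift_by 1 ` K \<subseteq> K" using shift_by_K by auto
    obtain \<mu> where \<mu>: "\<mu> \<in> invariant_probs (top_of_set K) (shift_by 1)" "integrable \<mu> h" "real n / 2 \<le> (\<integral>x. h x \<partial>\<mu>)"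
    proof (rule krylov_bogoliubov[of K "shift_by 1" x N h "real n / 2"])
      show "0 \<le> z i \<and> z i \<le> 1" if "z \<in> K" for z i by (rule K_bounds[OF that])
    qed (use compact_K continuous_on_shift_by shK x Ninf cont_h in auto)
    have s: "sets \<mu> = sets (borel_sigma (top_of_set K))" using \<mu>(1) by (simp add: invariant_probs_def)
    have sp: "space \<mu> = K" using sets_eq_imp_space_eq[OF s] space_borel_sigma by auto
    have "ennreal (real n / 2) \<le> ennreal (\<integral>x. h x \<partial>\<mu>)" by (rule ennreal_leI[OF \<mu>(3)])
    also have "\<dots> = (\<integral>\<^sup>+x. ennreal (h x) \<partial>\<mu>)"
      by (rule nn_integral_eq_integral[symmetric, OF \<mu>(2)]) (use h_nonneg sp in auto)
    also have "\<dots> \<le> (\<integral>\<^sup>+x. of_nat (ord_at \<V> x) \<partial>\<mu>)"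
    proof (rule nn_integral_mono)
      fix x assume "x \<in> space \<mu>"
      then show "ennreal (h x) \<le> of_nat (ord_at \<V> x)"
        using h_le[of x] sp by (simp add: ennreal_of_nat_eq_real_of_nat ennreal_leI)
    qed
    also have "\<dots> \<le> ord_cover (top_of_set K) (shift_by 1) \<V>"
      unfolding ord_cover_def by (rule SUP_upper[OF \<mu>(1)])
    finally show ?thesis .
  qed
qed

theorem dyn_dim_ge: "ennreal (real n / 2) \<le> dyn_dim (top_of_set K) (shift_by 1)"
proof -
  have "ennreal (real n / 2) \<le> dyn_dim_cover (top_of_set K) (shift_by 1) leg_cover"
    unfolding dyn_dim_cover_def by (rule INF_greatest) (use ord_cover_ge in auto)
  also have "\<dots> \<le> dyn_dim (top_of_set K) (shift_by 1)"
    unfolding dyn_dim_def by (rule SUP_upper[OF leg_cover])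
  finally show ?thesis .
qed

end

theorem proposition8p2:
  fixes n :: nat
  assumes "n \<ge> 1"
  shows "\<exists>(X :: (nat \<Rightarrow> real) topology) T.
           minimal_system X T \<and>
           dyn_dim X T = ennreal (real n / 2) \<and>
           \<not> (\<exists>F. equivariant_embedding X T (cube_shift_space n) seq_shift F)"
proof -
  obtain N F \<sigma> where "\<And>j. skeleton n j (N j) (F j) (\<sigma> j)"
    "\<And>j. skeleton_step n j (N j) (F j) (\<sigma> j) (N (Suc j)) (F (Suc j)) (\<sigma> (Suc j))"
    using skeleton_sequence_exists[OF assms] by blast
  then interpret triod_system n N F \<sigma>
    using assms by unfold_locales
  show ?thesis
    using minimal_shift antisym[OF dyn_dim_le dyn_dim_ge] no_equivariant_embedding by blast
qed

end
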